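(* Let $\psi:S^1\to\mathbb{R}$ be a $C^2$ function whose critical set $C'_\psi=\{\hat x\in S^1:\psi'(\hat x)=0\}$ is finite and such that $\psi''(\hat x)\neq 0$ for every $\hat x\in C'_\psi$. Let $\beta,c\in(0,1)$. Then there is $L_0>0$, depending only on $\psi,\beta,c$, such that the following holds for every $L\ge L_0$. Let $a\in[0,1)$ and $k\in\mathbb{N}$ (arbitrary) be such that $f=f_{L,a}=L\psi+a\ (\mathrm{mod}\ 1)$ satisfies $$d(f^l(\hat x),C'_\psi)\ge c\qquad\text{for all }\hat x\in C'_\psi\text{ and all }1\le l\le k,$$ and let $\epsilon\ge L^{-(2k+1)(1-\beta)+\alpha}$, where $\alpha\ge0$ is arbitrary. Then the Lyapunov exponent $$\lambda=\lim_{n\to\infty}\frac1n\log|(f^n_{\underline\omega})'(x)|$$ exists and is constant over $x\in S^1$ and $\mathbb{P}$-almost every $\underline\omega\in\Omega$ (that is, there is a constant $\lambda$ such that for every $x\in S^1$ the limit exists and equals $\lambda$ for $\mathbb{P}$-a.e. $\underline\omega$), and it satisfies $$\lambda\ge\lambda_0\log L,\qquad \lambda_0=\lambda_0(\alpha,k):=\min\Big\{\frac{\alpha}{k+1},\frac1{10}\Big\}.$$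
   Context: $S^1=\mathbb{R}/\mathbb{Z}$, parametrized by $[0,1)$, with the metric $d(x,y)=\min\{|x-y|,|x-y\pm1|\}$; for a set $A$, $d(x,A)=\inf_{y\in A}d(x,y)$. Given $\epsilon>0$, let $\nu^\epsilon$ be the uniform distribution on $[-\epsilon,\epsilon]$, $\Omega=[-\epsilon,\epsilon]^{\mathbb{Z}_{\ge0}}$ with elements $\underline\omega=(\omega_0,\omega_1,\dots)$, and $\mathbb{P}=(\nu^\epsilon)^{\otimes\mathbb{Z}_{\ge0}}$. For $\omega\in[-\epsilon,\epsilon]$ put $f_\omega(x)=f(x+\omega)$ (argument taken mod 1), and $f^n_{\underline\omega}=f_{\omega_{n-1}}\circ\cdots\circ f_{\omega_0}$. *)

theory Defs
  imports "HOL-Probability.Probability"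
begin

text \<open>The circle is the set of representatives in \<open>[0,1)\<close>, and reduction mod 1 is \<^const>\<open>frac\<close>.
  A function \<open>\<psi>\<close> on the circle is given by its 1-periodic extension to the real line, so that its
  derivatives are the ordinary ones.\<close>

definition S1 :: "real set" where
  "S1 = {0..<1}"

definition circle_dist :: "real \<Rightarrow> real \<Rightarrow> real" where
  "circle_dist x y = min \<bar>x - y\<bar> (min \<bar>x - y + 1\<bar> \<bar>x - y - 1\<bar>)"

definition circle_setdist :: "real \<Rightarrow> real set \<Rightarrow> real" where
  "circle_setdist x A = (INF y\<in>A. circle_dist x y)"

definition C2_on_circle :: "(real \<Rightarrow> real) \<Rightarrow> bool" where
  "C2_on_circle \<psi> \<longleftrightarrow>
     (\<forall>x. \<psi> (x + 1) = \<psi> x) \<and>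
     \<psi> C1_differentiable_on UNIV \<and> deriv \<psi> C1_differentiable_on UNIV"

definition crit_set :: "(real \<Rightarrow> real) \<Rightarrow> real set" where
  "crit_set \<psi> = {x \<in> S1. deriv \<psi> x = 0}"

definition circle_map :: "(real \<Rightarrow> real) \<Rightarrow> real \<Rightarrow> real \<Rightarrow> real \<Rightarrow> real" where
  "circle_map \<psi> L a x = frac (L * \<psi> x + a)"

text \<open>The composition \<open>f\<^sub>\<omega>\<^sub>(\<^sub>n\<^sub>-\<^sub>1\<^sub>) \<circ> \<dots> \<circ> f\<^sub>\<omega>\<^sub>0\<close> with \<open>f\<^sub>w(x) = f(x + w)\<close>, the argument taken mod 1.\<close>

definition perturbed :: "(real \<Rightarrow> real) \<Rightarrow> real \<Rightarrow> real \<Rightarrow> real" where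
  "perturbed f w x = f (frac (x + w))"

fun random_iterate :: "(real \<Rightarrow> real) \<Rightarrow> (nat \<Rightarrow> real) \<Rightarrow> nat \<Rightarrow> real \<Rightarrow> real" where
  "random_iterate f \<omega> 0 x = x"
| "random_iterate f \<omega> (Suc n) x = perturbed f (\<omega> n) (random_iterate f \<omega> n x)"

text \<open>The representative of least absolute value of a real number mod 1.\<close>

definition signed_frac :: "real \<Rightarrow> real" where
  "signed_frac t = t - of_int (round t)"

text \<open>The derivative of a map of the circle to itself: difference quotients are formed with the
  increment of the values taken mod 1, so the jumps of the representatives do not matter.\<close>

definition circle_deriv :: "(real \<Rightarrow> real) \<Rightarrow> real \<Rightarrow> real" where
  "circle_deriv g x = Lim (at 0) (\<lambda>h. signed_frac (g (frac (x + h)) - g x) / h)"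

text \<open>Logarithm of a nonnegative number with \<open>log 0 = -\<infinity>\<close> (in HOL, \<open>ln 0 = 0\<close>, which would turn a
  vanishing derivative into a zero exponent).\<close>

definition ext_ln :: "real \<Rightarrow> ereal" where
  "ext_ln t = (if t = 0 then -\<infinity> else ereal (ln t))"

definition has_lyapunov_exponent ::
    "(real \<Rightarrow> real) \<Rightarrow> (nat \<Rightarrow> real) \<Rightarrow> real \<Rightarrow> real \<Rightarrow> bool" where
  "has_lyapunov_exponent f \<omega> x l \<longleftrightarrow>
     (\<lambda>n. ereal (1 / real n) * ext_ln \<bar>circle_deriv (random_iterate f \<omega> n) x\<bar>)
       \<longlonglongrightarrow> ereal l"

text \<open>Each factor is a probability measure on the real line that is concentrated on \<open>[-\<epsilon>,\<epsilon>]\<close>, so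
  almost every sequence lies in \<open>[-\<epsilon>,\<epsilon>]\<^sup>\<nat>\<close>.\<close>

definition noise :: "real \<Rightarrow> (nat \<Rightarrow> real) measure" where
  "noise \<epsilon> = PiM UNIV (\<lambda>_::nat. uniform_measure lborel {-\<epsilon>..\<epsilon>})"

end

theory Submission
  imports Defs "HOL-Real_Asymp.Real_Asymp"
begin

text \<open>Lift everything to the real line: with \<open>F y = L \<psi>(y) + a\<close>, \<open>X\<^sub>n\<^sub>+\<^sub>1 = F (X\<^sub>n + \<omega>\<^sub>n)\<close> and
\<open>Y\<^sub>n = X\<^sub>n + \<omega>\<^sub>n\<close>, the chain rule gives \<open>ln |(f\<^sup>n)'(x)| = n ln L + \<Sum>i<n. ln |\<psi>'(Y\<^sub>i)|\<close>. The
Lyapunov exponent is therefore \<open>ln L\<close> plus the Birkhoff average of \<open>ln |\<psi>'|\<close> along the noisy orbit. The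
proof shows that this average converges to some \<open>m \<ge> - C\<close>, where \<open>C\<close> depends on \<open>\<psi>\<close> and \<open>c\<close> only. So the
exponent is at least \<open>ln L - C\<close>, which exceeds \<open>(1/10) ln L \<ge> \<lambda>\<^sub>0 ln L\<close> once \<open>L\<close> is large.

The key is a mixing statement for \<open>\<phi>\<^sub>l(y) = E(ln |\<psi>'(Y\<^sub>l)| | Y\<^sub>0 = y)\<close>. Let \<open>a\<^sub>l\<close> be the mean of \<open>\<phi>\<^sub>l\<close>
over the circle. Then \<open>|\<integral>\<^sub>I (\<phi>\<^sub>l - a\<^sub>l)| \<le> E / 2\<^sup>l\<close> for every interval \<open>I\<close>, and
\<open>|a\<^sub>l\<^sub>+\<^sub>1 - a\<^sub>l| \<le> E / 2\<^sup>l\<^sup>+\<^sup>1\<close>, with \<open>E\<close> independent of \<open>L\<close> (\<open>settled\<close>). Consequently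
\<open>a\<^sub>l\<close> tends to a limit \<open>m\<close> within \<open>E\<close> of \<open>a\<^sub>0 = \<integral> ln |\<psi>'|\<close>. Since the noise averages over intervals
of the fixed length \<open>2\<epsilon>\<close>, the conditional expectations of \<open>ln |\<psi>'(Y\<^sub>l)|\<close> converge to \<open>m\<close> exponentially fast,
uniformly in the starting point \<open>X\<^sub>0\<close>. Hence the centred Birkhoff sums have second moment \<open>O(n)\<close>, and a strong law
holds from every starting point (\<open>strong_law\<close>).

Mixing comes from one change of variables (\<open>osc_pullback\<close>): as \<open>\<phi>\<^sub>l\<^sub>+\<^sub>1\<close> is \<open>\<phi>\<^sub>l\<close> averaged over the noise and
composed with \<open>F\<close>, passing from \<open>\<phi>\<^sub>l\<close> to \<open>\<phi>\<^sub>l\<^sub>+\<^sub>1\<close> divides the integral bound by about \<open>|F'|\<close>. Away from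
the critical points this is a gain \<open>1/L\<close>. At distance \<open>r\<close> from a critical point \<open>F'\<close> is only of order
\<open>L r\<close>, but then the orbit shadows the critical orbit, which stays away from the critical set, for all
\<open>j \<le> k\<close> steps with \<open>L\<^sup>j r\<^sup>2\<close> small. The total gain over these \<open>j + 1\<close> steps is
\<open>1 / (L\<^sup>j\<^sup>+\<^sup>1 r)\<close>, roughly \<open>L\<close> to the power \<open>-(j + 1)/2\<close> (\<open>annulus_osc\<close>). The shadowing time cannot exceed \<open>k\<close>, so
closer in a second effect is needed: averaging over the noise of the next step bounds \<open>\<phi>\<^sub>l - a\<close> pointwise by
\<open>L\<^sup>-\<^sup>k / \<epsilon>\<close> (\<open>core_osc\<close>). The two bounds balance at \<open>r = sqrt (\<epsilon> / L)\<close>, where both give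
\<open>(L\<^sup>2\<^sup>k\<^sup>+\<^sup>1 \<epsilon>)\<close> to the power \<open>-1/2\<close>. The lower bound on \<open>\<epsilon>\<close> makes this at most \<open>L\<close> to the power
\<open>- \<beta> (k + 1) / 2\<close>. This small factor for each step absorbs all constants, even those that grow like
\<open>K\<^sup>k\<close>, so the threshold for \<open>L\<close> is uniform in \<open>k\<close>. Noise that is too strong for
shadowing over \<open>k\<close> steps is treated with a smaller \<open>k\<close> (\<open>shadowing_time\<close>).\<close>

section \<open>Antiderivatives and mean oscillation\<close>

text \<open>The antiderivative that vanishes at 0. One of the two integrals ranges over a degenerate or empty interval, so this
is the oriented integral from 0 to \<open>x\<close>.\<close>

definition antider :: "(real \<Rightarrow> real) \<Rightarrow> real \<Rightarrow> real" where
  "antider f x = integral {0..x} f - integral {x..0} f"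

lemma antider_diff:
  assumes f: "\<And>s t. f integrable_on {s..t::real}" and "s \<le> t"
  shows "antider f t - antider f s = integral {s..t} f"
proof -
  have c: "integral {x..y} f + integral {y..z} f = integral {x..z} f" if "x \<le> y" "y \<le> z" for x y z
    using Henstock_Kurzweil_Integration.integral_combine[OF that f] .
  consider "0 \<le> s" | "s < 0" "0 \<le> t" | "t < 0" by linarith
  then show ?thesis
  proof cases
    case 1
    then show ?thesis using assms(2) c[of 0 s t]
      by (cases "s = 0"; cases "t = 0") (auto simp: antider_def)
  next
    case 2
    then show ?thesis using c[of s 0 t] by (cases "t = 0") (auto simp: antider_def)
  next
    case 3
    then show ?thesis using assms(2) c[of s t 0] by (auto simp: antider_def)
  qed
qed

lemma has_derivative_antider:
  assumes "continuous_on UNIV f"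
  shows "(antider f has_real_derivative f x) (at x)"
proof -
  have f: "f integrable_on {s..t}" for s t
    by (intro integrable_continuous_real continuous_on_subset[OF assms]) auto
  have eq: "antider f (x - 1) + integral {x - 1..u} f = antider f u" if "u \<in> {x - 1..x + 1}" for u
    using antider_diff[OF f, of "x - 1" u] that by simp
  have "((\<lambda>u. integral {x - 1..u} f) has_real_derivative f x) (at x within {x - 1..x + 1})"
    by (rule integral_has_real_derivative) (auto intro: continuous_on_subset[OF assms])
  then have "((\<lambda>u. antider f (x - 1) + integral {x - 1..u} f) has_real_derivative f x)
      (at x within {x - 1..x + 1})"
    by (auto intro!: derivative_eq_intros)
  then have "(antider f has_real_derivative f x) (at x within {x - 1..x + 1})"
    by (rule has_field_derivative_transform_within[where d = 1]) (simp_all add: eq)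
  then show ?thesis
    using at_within_Icc_at[of "x - 1" x "x + 1"] by simp
qed

lemma continuous_antider:
  assumes f: "\<And>s t. f integrable_on {s..t::real}"
  shows "continuous_on UNIV (antider f)"
proof -
  have "isCont (antider f) x" for x
  proof -
    have eq: "antider f (x - 1) + integral {x - 1..u} f = antider f u" if "u \<in> {x - 1..x + 1}" for u
      using antider_diff[OF f, of "x - 1" u] that by simp
    have "continuous_on {x - 1..x + 1} (\<lambda>u. antider f (x - 1) + integral {x - 1..u} f)"
      by (intro continuous_intros indefinite_integral_continuous_1 f)
    then have "continuous_on {x - 1..x + 1} (antider f)"
      by (rule continuous_on_eq) (simp add: eq)
    then show ?thesis
      by (rule continuous_on_interior) auto
  qed
  then show ?thesis by (simp add: continuous_at_imp_continuous_on)
qed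

text \<open>Over every period the antiderivative of a 1-periodic function grows by the same amount.\<close>

lemma antider_shift:
  assumes f: "\<And>s t. f integrable_on {s..t::real}" and per: "\<And>x. f (x + 1) = f x"
  shows "antider f (x + 1) = antider f x + antider f 1"
proof -
  have "antider f (t + 1) - antider f (s + 1) = antider f t - antider f s" if "s \<le> t" for s t
  proof -
    have "integral {s + 1..t + 1} f = integral {s..t} f"
      using integral_shift_Icc_real[of s t f 1] per by (simp add: o_def add.commute)
    then show ?thesis
      using antider_diff[OF f, of s t] antider_diff[OF f, of "s + 1" "t + 1"] that by simp
  qed
  from this[of 0 x] this[of x 0] have "antider f (x + 1) - antider f 1 = antider f x - antider f 0"
    by (cases "0 \<le> x") auto
  then show ?thesis by (simp add: antider_def)
qed

text \<open>Functions are represented by their antiderivatives: if \<open>V' = \<phi>\<close>, then \<open>osc V m K e\<close> says that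
\<open>|\<integral>\<^sub>s\<^sup>t (\<phi> - m)| \<le> e\<close> for all \<open>s, t \<in> K\<close>, which for intervals \<open>K\<close> is a weak form of \<open>\<phi> \<approx> m\<close> on
\<open>K\<close>. In the same way \<open>lip V m K e\<close> is the pointwise bound \<open>|\<phi> - m| \<le> e\<close>. With antiderivatives, the
logarithmic singularities of \<open>\<phi>\<close> never have to be integrated again.\<close>

definition osc :: "(real \<Rightarrow> real) \<Rightarrow> real \<Rightarrow> real set \<Rightarrow> real \<Rightarrow> bool" where
  "osc V m K e \<longleftrightarrow> (\<forall>s\<in>K. \<forall>t\<in>K. \<bar>V t - V s - m * (t - s)\<bar> \<le> e)"

definition lip :: "(real \<Rightarrow> real) \<Rightarrow> real \<Rightarrow> real set \<Rightarrow> real \<Rightarrow> bool" where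
  "lip V m K e \<longleftrightarrow> (\<forall>s\<in>K. \<forall>t\<in>K. \<bar>V t - V s - m * (t - s)\<bar> \<le> e * \<bar>t - s\<bar>)"

text \<open>The average of \<open>V'\<close> over the interval of radius \<open>\<epsilon>\<close> about \<open>x\<close>.\<close>

definition window :: "real \<Rightarrow> (real \<Rightarrow> real) \<Rightarrow> real \<Rightarrow> real" where
  "window \<epsilon> V x = (V (x + \<epsilon>) - V (x - \<epsilon>)) / (2 * \<epsilon>)"

lemma abs_diff_le_derivative:
  fixes f g :: "real \<Rightarrow> real"
  assumes "s \<le> t"
    and f: "\<And>x. s \<le> x \<Longrightarrow> x \<le> t \<Longrightarrow> (f has_real_derivative f' x) (at x)"
    and g: "\<And>x. s \<le> x \<Longrightarrow> x \<le> t \<Longrightarrow> (g has_real_derivative g' x) (at x)"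
    and le: "\<And>x. s \<le> x \<Longrightarrow> x \<le> t \<Longrightarrow> \<bar>f' x\<bar> \<le> g' x"
  shows "\<bar>f t - f s\<bar> \<le> g t - g s"
proof -
  have "(\<lambda>x. g x - f x) s \<le> (\<lambda>x. g x - f x) t"
    by (rule DERIV_nonneg_imp_nondecreasing[OF assms(1)])
       (use le in \<open>force intro!: derivative_eq_intros f g\<close>)
  moreover have "(\<lambda>x. g x + f x) s \<le> (\<lambda>x. g x + f x) t"
    by (rule DERIV_nonneg_imp_nondecreasing[OF assms(1)])
       (use le in \<open>force intro!: derivative_eq_intros f g\<close>)
  ultimately show ?thesis by linarith
qed

lemma osc_mono: "osc V m K e \<Longrightarrow> K' \<subseteq> K \<Longrightarrow> e \<le> e' \<Longrightarrow> osc V m K' e'"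
  unfolding osc_def by (meson order_trans subsetD)

lemmas osc_weaken = osc_mono[OF _ order_refl]

text \<open>The quantity in \<open>osc\<close> only changes its sign when \<open>s\<close> and \<open>t\<close> are exchanged.\<close>

lemma osc_of_ordered:
  assumes "\<And>s t. s \<in> K \<Longrightarrow> t \<in> K \<Longrightarrow> s \<le> t \<Longrightarrow> \<bar>V t - V s - m * (t - s)\<bar> \<le> e"
  shows "osc V m K e"
  unfolding osc_def
proof (intro ballI)
  fix s t assume "s \<in> K" "t \<in> K"
  then show "\<bar>V t - V s - m * (t - s)\<bar> \<le> e"
    using assms[of s t] assms[of t s] by (cases "s \<le> t") (auto simp: abs_if algebra_simps split: if_splits)
qed

text \<open>Cut the integral from \<open>s\<close> to \<open>t\<close> at the common point \<open>x\<close>.\<close>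

lemma osc_union:
  assumes "osc V m K e" "osc V m K' e'" "x \<in> K" "x \<in> K'"
  shows "osc V m (K \<union> K') (e + e')"
proof -
  have ge: "0 \<le> e" "0 \<le> e'"
    using assms unfolding osc_def by (meson abs_ge_zero order_trans)+
  have 1: "\<bar>V t - V s - m * (t - s)\<bar> \<le> e + e'" if "s \<in> K" "t \<in> K'" for s t
  proof -
    have "V t - V s - m * (t - s) = (V x - V s - m * (x - s)) + (V t - V x - m * (t - x))"
      by (simp add: algebra_simps)
    then show ?thesis
      using assms that unfolding osc_def by (smt (verit, best))
  qed
  show ?thesis
    unfolding osc_def
  proof (intro ballI)
    fix s t assume st: "s \<in> K \<union> K'" "t \<in> K \<union> K'"
    have swap: "\<bar>V t - V s - m * (t - s)\<bar> = \<bar>V s - V t - m * (s - t)\<bar>"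
      by (simp add: algebra_simps abs_if)
    consider "s \<in> K" "t \<in> K" | "s \<in> K'" "t \<in> K'" | "s \<in> K" "t \<in> K'" | "s \<in> K'" "t \<in> K"
      using st by blast
    then show "\<bar>V t - V s - m * (t - s)\<bar> \<le> e + e'"
    proof cases
      case 1
      then show ?thesis using assms(1) ge unfolding osc_def by fastforce
    next
      case 2
      then show ?thesis using assms(2) ge unfolding osc_def by fastforce
    next
      case 3
      then show ?thesis using 1 by blast
    next
      case 4
      then show ?thesis using 1[of t s] swap by simp
    qed
  qed
qed

text \<open>The bounds obtained in different regions refer to the means of different functions. Exchanging the mean costs its
change times the length of the region, which is affordable because the regions are short.\<close>

lemma osc_recentre:
  assumes "osc V m K e" and "\<bar>m - m'\<bar> \<le> d" and "0 \<le> d" and "\<And>s t. s \<in> K \<Longrightarrow> t \<in> K \<Longrightarrow> \<bar>t - s\<bar> \<le> r"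
  shows "osc V m' K (e + d * r)"
  unfolding osc_def
proof (intro ballI)
  fix s t assume st: "s \<in> K" "t \<in> K"
  have "\<bar>(m - m') * (t - s)\<bar> \<le> d * r"
    using assms(2-) st by (simp add: abs_mult mult_mono)
  moreover have "V t - V s - m' * (t - s) = (V t - V s - m * (t - s)) + (m - m') * (t - s)"
    by (simp add: algebra_simps)
  ultimately show "\<bar>V t - V s - m' * (t - s)\<bar> \<le> e + d * r"
    using assms(1) st unfolding osc_def by (smt (verit, best))
qed

lemma osc_of_lip:
  assumes "lip V m K e" and "0 \<le> e" and "\<And>s t. s \<in> K \<Longrightarrow> t \<in> K \<Longrightarrow> \<bar>t - s\<bar> \<le> r"
  shows "osc V m K (e * r)"
  using assms unfolding lip_def osc_def by (meson mult_left_mono order_trans)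

lemma lip_of_derivative:
  fixes V :: "real \<Rightarrow> real"
  assumes "\<And>x. (V has_real_derivative V' x) (at x)"
    and "\<And>x. x \<in> {p..q} \<Longrightarrow> \<bar>V' x - m\<bar> \<le> e"
  shows "lip V m {p..q} e"
proof -
  have *: "\<bar>V t - V s - m * (t - s)\<bar> \<le> e * \<bar>t - s\<bar>" if "s \<in> {p..q}" "t \<in> {p..q}" "s \<le> t" for s t
  proof -
    have "\<bar>(V t - m * t) - (V s - m * s)\<bar> \<le> e * t - e * s"
      by (rule abs_diff_le_derivative[OF \<open>s \<le> t\<close>, of "\<lambda>x. V x - m * x" "\<lambda>x. V' x - m" "\<lambda>x. e * x" "\<lambda>_. e"])
         (use that assms in \<open>auto intro!: derivative_eq_intros\<close>)
    then show ?thesis using that by (simp add: algebra_simps)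
  qed
  show ?thesis
    unfolding lip_def
  proof (intro ballI)
    fix s t assume "s \<in> {p..q}" "t \<in> {p..q}"
    moreover have "\<bar>V t - V s - m * (t - s)\<bar> = \<bar>V s - V t - m * (s - t)\<bar>"
      by (simp add: algebra_simps abs_if)
    ultimately show "\<bar>V t - V s - m * (t - s)\<bar> \<le> e * \<bar>t - s\<bar>"
      using *[of s t] *[of t s] by (cases "s \<le> t") (auto simp: abs_minus_commute)
  qed
qed

text \<open>A bound in the mean becomes a pointwise bound after averaging over the noise, at the price of a factor \<open>1/(2\<epsilon>)\<close>.\<close>

lemma window_near_mean:
  assumes "0 < \<epsilon>" "osc V m {x - \<epsilon>..x + \<epsilon>} e"
  shows "\<bar>window \<epsilon> V x - m\<bar> \<le> e / (2 * \<epsilon>)"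
proof -
  have "\<bar>V (x + \<epsilon>) - V (x - \<epsilon>) - m * ((x + \<epsilon>) - (x - \<epsilon>))\<bar> \<le> e"
  proof -
    have "x - \<epsilon> \<in> {x - \<epsilon>..x + \<epsilon>}" "x + \<epsilon> \<in> {x - \<epsilon>..x + \<epsilon>}" using assms(1) by auto
    then show ?thesis using assms(2) unfolding osc_def by blast
  qed
  moreover have "window \<epsilon> V x - m = (V (x + \<epsilon>) - V (x - \<epsilon>) - m * ((x + \<epsilon>) - (x - \<epsilon>))) / (2 * \<epsilon>)"
    using assms(1) by (simp add: window_def field_simps)
  ultimately show ?thesis
    using assms(1) by (simp add: divide_right_mono)
qed

lemma window_near_mean_lip:
  assumes "0 < \<epsilon>" "lip V m {x - \<epsilon>..x + \<epsilon>} e"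
  shows "\<bar>window \<epsilon> V x - m\<bar> \<le> e"
proof -
  have "e * \<bar>t - s\<bar> \<le> \<bar>e\<bar> * (2 * \<epsilon>)" if "s \<in> {x - \<epsilon>..x + \<epsilon>}" "t \<in> {x - \<epsilon>..x + \<epsilon>}" for s t
    using that by (intro mult_mono) auto
  then have "osc V m {x - \<epsilon>..x + \<epsilon>} (\<bar>e\<bar> * (2 * \<epsilon>))"
    using assms(2) unfolding osc_def lip_def by (blast intro: order_trans)
  from window_near_mean[OF assms(1) this] have "\<bar>window \<epsilon> V x - m\<bar> \<le> \<bar>e\<bar>"
    using assms(1) by simp
  moreover have "0 \<le> e * \<bar>(x + \<epsilon>) - (x - \<epsilon>)\<bar>"
  proof -
    have "x - \<epsilon> \<in> {x - \<epsilon>..x + \<epsilon>}" "x + \<epsilon> \<in> {x - \<epsilon>..x + \<epsilon>}" using assms(1) by auto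
    then show ?thesis using assms(2) abs_ge_zero order_trans unfolding lip_def by blast
  qed
  ultimately show ?thesis
    using assms(1) by (simp add: zero_le_mult_iff)
qed

section \<open>Pulling mean oscillation back along an expanding map\<close>

text \<open>The average of \<open>V\<close> over the interval of radius \<open>\<epsilon>\<close> about \<open>x\<close>, so that it is an antiderivative of \<open>window \<epsilon> V\<close>.\<close>

definition smear :: "real \<Rightarrow> (real \<Rightarrow> real) \<Rightarrow> real \<Rightarrow> real" where
  "smear \<epsilon> V x = (antider V (x + \<epsilon>) - antider V (x - \<epsilon>)) / (2 * \<epsilon>)"

lemma has_derivative_smear:
  assumes "continuous_on UNIV V"
  shows "(smear \<epsilon> V has_real_derivative window \<epsilon> V x) (at x)"
proof -
  have "((\<lambda>x. antider V (x + \<epsilon>) - antider V (x - \<epsilon>)) has_real_derivative V (x + \<epsilon>) - V (x - \<epsilon>)) (at x)"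
    by (rule derivative_eq_intros DERIV_chain'[OF _ has_derivative_antider[OF assms]] refl | simp)+
  then show ?thesis
    unfolding smear_def window_def by (rule DERIV_cdivide)
qed

text \<open>An average of translates of \<open>V\<close> oscillates no more than \<open>V\<close> does on the enlarged interval. The function \<open>h\<close> turns this
averaging over translations into an application of the mean value inequality.\<close>

lemma osc_smear:
  assumes V: "continuous_on UNIV V" and "0 < \<epsilon>"
    and o: "osc V m {p - \<epsilon>..q + \<epsilon>} e"
  shows "osc (smear \<epsilon> V) m {p..q} e"
proof (rule osc_of_ordered)
  fix s t assume st: "s \<in> {p..q}" "t \<in> {p..q}" "s \<le> t"
  define h where "h y = antider V (t + y) - antider V (s + y) - m * (t - s) * y" for y
  have "\<bar>h \<epsilon> - h (- \<epsilon>)\<bar> \<le> e * \<epsilon> - e * (- \<epsilon>)"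
  proof (rule abs_diff_le_derivative)
    fix y assume y: "- \<epsilon> \<le> y" "y \<le> \<epsilon>"
    show "(h has_real_derivative V (t + y) - V (s + y) - m * (t - s)) (at y)"
    proof -
      have "((\<lambda>y. antider V (r + y)) has_real_derivative V (r + y)) (at y)" for r
        using has_derivative_antider[OF V, of "y + r"] DERIV_shift[of "antider V" _ y r]
        by (simp add: add.commute)
      from DERIV_diff[OF DERIV_diff[OF this[of t] this[of s]] DERIV_cmult_Id[of "m * (t - s)"]]
      show ?thesis unfolding h_def .
    qed
    show "((\<lambda>y. e * y) has_real_derivative e) (at y)"
      by (auto intro!: derivative_eq_intros)
    have "t + y \<in> {p - \<epsilon>..q + \<epsilon>}" "s + y \<in> {p - \<epsilon>..q + \<epsilon>}"
      using st y by auto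
    then have "\<bar>V (t + y) - V (s + y) - m * ((t + y) - (s + y))\<bar> \<le> e"
      using o unfolding osc_def by blast
    then show "\<bar>V (t + y) - V (s + y) - m * (t - s)\<bar> \<le> e" by simp
  qed (use assms in auto)
  moreover have "smear \<epsilon> V t - smear \<epsilon> V s - m * (t - s) = (h \<epsilon> - h (- \<epsilon>)) / (2 * \<epsilon>)"
    using \<open>0 < \<epsilon>\<close> by (simp add: smear_def h_def field_simps)
  ultimately show "\<bar>smear \<epsilon> V t - smear \<epsilon> V s - m * (t - s)\<bar> \<le> e"
    using \<open>0 < \<epsilon>\<close> by (simp add: abs_divide pos_divide_le_eq algebra_simps)
qed

text \<open>This is the change of variables in \<open>\<integral> (\<phi>(F x) - m) dx\<close>, where \<open>\<phi> = window \<epsilon> V\<close> and \<open>W\<close> is an antiderivative of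
\<open>\<phi> \<circ> F\<close>. Let \<open>U\<close> be the antiderivative of \<open>\<phi> - m\<close> in the image, and \<open>w = 1/F'\<close>. Then
\<open>(U \<circ> F)' w = \<phi> \<circ> F - m\<close>, and integration by parts leaves the boundary term \<open>(U \<circ> F) w\<close> and the
integral of \<open>(U \<circ> F) w'\<close>. Both are controlled by \<open>|U| \<le> e\<close>. The function \<open>g\<close> dominates the variation of \<open>1/F'\<close>, as
\<open>|w'| = |F''| / F'\<^sup>2 \<le> g'\<close>.\<close>

lemma osc_pullback:
  fixes F F' F'' V W :: "real \<Rightarrow> real"
  assumes V: "continuous_on UNIV V" and "0 < \<epsilon>"
    and W: "\<And>x. (W has_real_derivative window \<epsilon> V (F x)) (at x)"
    and F: "\<And>x. (F has_real_derivative F' x) (at x)"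
    and F': "\<And>x. (F' has_real_derivative F'' x) (at x)"
    and o: "osc V m {p - \<epsilon>..q + \<epsilon>} e"
    and K: "\<And>x. x \<in> {b..c} \<Longrightarrow> F x \<in> {p..q}"
    and mu: "0 < \<mu>" "\<And>x. x \<in> {b..c} \<Longrightarrow> \<mu> \<le> \<bar>F' x\<bar>"
    and g: "\<And>x. x \<in> {b..c} \<Longrightarrow> (g has_real_derivative g' x) (at x)"
    and var: "\<And>x. x \<in> {b..c} \<Longrightarrow> \<bar>F'' x\<bar> / (F' x)\<^sup>2 \<le> g' x"
  shows "osc W m {b..c} (e * (1 / \<mu> + (g c - g b)))"
proof (rule osc_of_ordered)
  fix s t assume st: "s \<in> {b..c}" "t \<in> {b..c}" "s \<le> t"
  define U where "U x = smear \<epsilon> V (F x) - smear \<epsilon> V (F s) - m * (F x - F s)" for x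
  define w where "w x = 1 / F' x" for x
  \<comment> \<open>\<open>Z\<close> is what integration by parts leaves over: its derivative is minus \<open>U\<close> times the derivative of \<open>w\<close>.\<close>
  define Z where "Z x = W x - m * x - U x * w x" for x
  have U: "\<bar>U x\<bar> \<le> e" if "x \<in> {b..c}" for x
    using osc_smear[OF V \<open>0 < \<epsilon>\<close> o] K[OF that] K[OF st(1)] unfolding osc_def U_def by blast
  then have e: "0 \<le> e" using st(1) by (meson abs_ge_zero order_trans)
  have nz: "F' x \<noteq> 0" if "x \<in> {b..c}" for x using mu that by force
  have w: "\<bar>w x\<bar> \<le> 1 / \<mu>" if "x \<in> {b..c}" for x
    using frac_le[of 1 1 \<mu> "\<bar>F' x\<bar>"] mu that by (simp add: w_def)
  have dw: "(w has_real_derivative - F'' x / (F' x)\<^sup>2) (at x)" if "x \<in> {b..c}" for x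
    unfolding w_def
    by (rule DERIV_cong[OF DERIV_divide[OF DERIV_const F' nz[OF that]]]) (simp add: power2_eq_square)
  have dU: "(U has_real_derivative (window \<epsilon> V (F x) - m) * F' x) (at x)" for x
  proof -
    have sm: "((\<lambda>x. smear \<epsilon> V (F x)) has_real_derivative window \<epsilon> V (F x) * F' x) (at x)"
      by (rule DERIV_chain2[OF has_derivative_smear[OF V] F])
    have "((\<lambda>x. m * (F x - F s)) has_real_derivative m * (F' x - 0)) (at x)"
      by (rule DERIV_cmult[OF DERIV_diff[OF F DERIV_const]])
    from DERIV_diff[OF DERIV_diff[OF sm DERIV_const[of "smear \<epsilon> V (F s)"]] this]
    show ?thesis unfolding U_def by (simp add: left_diff_distrib)
  qed
  have dZ: "(Z has_real_derivative U x * (F'' x / (F' x)\<^sup>2)) (at x)" if "x \<in> {b..c}" for x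
  proof -
    have "(Z has_real_derivative window \<epsilon> V (F x) - m -
        ((window \<epsilon> V (F x) - m) * F' x * w x + (- F'' x / (F' x)\<^sup>2) * U x)) (at x)"
      unfolding Z_def
      by (rule DERIV_diff[OF DERIV_diff[OF W DERIV_cmult_Id] DERIV_mult[OF dU dw[OF that]]])
    then show ?thesis using nz[OF that] by (simp add: w_def algebra_simps)
  qed
  have sub: "x \<in> {b..c}" if "s \<le> x" "x \<le> t" for x using st that by auto
  have bZ: "\<bar>U x * (F'' x / (F' x)\<^sup>2)\<bar> \<le> e * (\<bar>F'' x\<bar> / (F' x)\<^sup>2)" if "x \<in> {b..c}" for x
    using mult_right_mono[OF U[OF that], of "\<bar>F'' x\<bar> / (F' x)\<^sup>2"] by (simp add: abs_mult)
  have g_mono: "g x \<le> g y" if "b \<le> x" "x \<le> y" "y \<le> c" for x y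
  proof (rule DERIV_nonneg_imp_nondecreasing[OF that(2)])
    fix z assume "x \<le> z" "z \<le> y"
    then have z: "z \<in> {b..c}" using that by auto
    have "0 \<le> \<bar>F'' z\<bar> / (F' z)\<^sup>2" by simp
    then show "\<exists>y. (g has_real_derivative y) (at z) \<and> 0 \<le> y"
      using g[OF z] var[OF z] order_trans by blast
  qed
  have "\<bar>Z t - Z s\<bar> \<le> e * g t - e * g s"
  proof (rule abs_diff_le_derivative[OF \<open>s \<le> t\<close> dZ])
    fix x assume x: "s \<le> x" "x \<le> t"
    show "((\<lambda>x. e * g x) has_real_derivative e * g' x) (at x)"
      by (rule DERIV_cmult[OF g[OF sub[OF x]]])
    show "\<bar>U x * (F'' x / (F' x)\<^sup>2)\<bar> \<le> e * g' x"
      using bZ[OF sub[OF x]] var[OF sub[OF x]] e by (meson mult_left_mono order_trans)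
  qed (use sub in auto)
  also have "\<dots> = e * (g t - g s)" by (simp add: algebra_simps)
  also have "\<dots> \<le> e * (g c - g b)"
    using st g_mono[of b s] g_mono[of t c] by (intro mult_left_mono e) auto
  finally have Z: "\<bar>Z t - Z s\<bar> \<le> e * (g c - g b)" .
  have "W t - W s - m * (t - s) = (Z t - Z s) + U t * w t"
    by (simp add: Z_def U_def algebra_simps)
  moreover have "\<bar>U t * w t\<bar> \<le> e * (1 / \<mu>)"
    using U[OF st(2)] w[OF st(2)] e by (simp only: abs_mult) (intro mult_mono, auto)
  ultimately show "\<bar>W t - W s - m * (t - s)\<bar> \<le> e * (1 / \<mu> + (g c - g b))"
    using Z by (simp add: distrib_left)
qed

lemma osc_pullback_far:
  fixes F F' F'' V W :: "real \<Rightarrow> real"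
  assumes V: "continuous_on UNIV V" and "0 < \<epsilon>"
    and W: "\<And>x. (W has_real_derivative window \<epsilon> V (F x)) (at x)"
    and F: "\<And>x. (F has_real_derivative F' x) (at x)"
    and F': "\<And>x. (F' has_real_derivative F'' x) (at x)"
    and o: "osc V m {p - \<epsilon>..q + \<epsilon>} e" "0 \<le> e"
    and K: "\<And>x. x \<in> {b..c} \<Longrightarrow> F x \<in> {p..q}"
    and mu: "0 < \<mu>" "\<And>x. x \<in> {b..c} \<Longrightarrow> \<mu> \<le> \<bar>F' x\<bar>"
    and curv: "\<And>x. x \<in> {b..c} \<Longrightarrow> \<bar>F'' x\<bar> \<le> \<tau>" and short: "c - b \<le> 1" "0 \<le> \<tau>"
  shows "osc W m {b..c} (e * (1 / \<mu> + \<tau> / \<mu>\<^sup>2))"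
proof -
  have "osc W m {b..c} (e * (1 / \<mu> + (\<tau> / \<mu>\<^sup>2 * c - \<tau> / \<mu>\<^sup>2 * b)))"
  proof (rule osc_pullback[OF V \<open>0 < \<epsilon>\<close> W F F' o(1) K mu])
    fix x assume x: "x \<in> {b..c}"
    have "\<mu>\<^sup>2 \<le> \<bar>F' x\<bar>\<^sup>2" using mu x by (intro power_mono) auto
    then show "\<bar>F'' x\<bar> / (F' x)\<^sup>2 \<le> \<tau> / \<mu>\<^sup>2"
      using curv[OF x] mu(1) by (intro frac_le) auto
    show "((\<lambda>x. \<tau> / \<mu>\<^sup>2 * x) has_real_derivative \<tau> / \<mu>\<^sup>2) (at x)"
      by (rule DERIV_cmult_Id)
  qed
  moreover have "\<tau> / \<mu>\<^sup>2 * c - \<tau> / \<mu>\<^sup>2 * b \<le> \<tau> / \<mu>\<^sup>2"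
    using short mult_left_mono[of "c - b" 1 "\<tau> / \<mu>\<^sup>2"] by (simp add: right_diff_distrib)
  ultimately show ?thesis
    using \<open>0 \<le> e\<close> osc_mono[OF _ order_refl] mult_left_mono[OF add_left_mono] by blast
qed

text \<open>If \<open>F''\<close> does not change sign then \<open>1/F'\<close> is monotone, so its variation is at most twice its supremum. This gives the right
order near a fold, where the quotient of the bounds for \<open>F''\<close> and \<open>F'\<^sup>2\<close> would be too large.\<close>

lemma osc_pullback_monotone:
  fixes F F' F'' V W :: "real \<Rightarrow> real"
  assumes V: "continuous_on UNIV V" and "0 < \<epsilon>"
    and W: "\<And>x. (W has_real_derivative window \<epsilon> V (F x)) (at x)"
    and F: "\<And>x. (F has_real_derivative F' x) (at x)"
    and F': "\<And>x. (F' has_real_derivative F'' x) (at x)"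
    and o: "osc V m {p - \<epsilon>..q + \<epsilon>} e" "0 \<le> e"
    and K: "\<And>x. x \<in> {b..c} \<Longrightarrow> F x \<in> {p..q}" and "b \<le> c"
    and mu: "0 < \<mu>" "\<And>x. x \<in> {b..c} \<Longrightarrow> \<mu> \<le> \<bar>F' x\<bar>"
    and mono: "(\<forall>x\<in>{b..c}. 0 \<le> F'' x) \<or> (\<forall>x\<in>{b..c}. F'' x \<le> 0)"
  shows "osc W m {b..c} (e * (3 / \<mu>))"
proof -
  obtain \<sigma> :: real where \<sigma>: "\<bar>\<sigma>\<bar> = 1" "\<And>x. x \<in> {b..c} \<Longrightarrow> \<bar>F'' x\<bar> = \<sigma> * F'' x"
  proof (cases "\<forall>x\<in>{b..c}. 0 \<le> F'' x")
    case True
    then show ?thesis using that[of 1] by auto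
  next
    case False
    then show ?thesis using that[of "-1"] mono by auto
  qed
  have nz: "F' x \<noteq> 0" if "x \<in> {b..c}" for x using mu that by force
  have w: "\<bar>\<sigma> / F' x\<bar> \<le> 1 / \<mu>" if "x \<in> {b..c}" for x
    using frac_le[of 1 1 \<mu> "\<bar>F' x\<bar>"] mu that \<sigma>(1) by simp
  have "- \<sigma> / F' c - - \<sigma> / F' b \<le> 2 * (1 / \<mu>)"
  proof -
    have "\<sigma> / F' b \<le> 1 / \<mu>" "- (\<sigma> / F' c) \<le> 1 / \<mu>"
      using w[of b] w[of c] \<open>b \<le> c\<close> by (simp_all only: atLeastAtMost_iff order_refl abs_le_iff)
    then show ?thesis by simp
  qed
  then have "1 / \<mu> + (- \<sigma> / F' c - - \<sigma> / F' b) \<le> 3 / \<mu>" by simp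
  moreover have "osc W m {b..c} (e * (1 / \<mu> + ((- \<sigma> / F' c) - (- \<sigma> / F' b))))"
  proof (rule osc_pullback[OF V \<open>0 < \<epsilon>\<close> W F F' o(1) K mu])
    fix x assume x: "x \<in> {b..c}"
    show "((\<lambda>x. - \<sigma> / F' x) has_real_derivative \<bar>F'' x\<bar> / (F' x)\<^sup>2) (at x)"
      unfolding \<sigma>(2)[OF x]
      by (rule DERIV_cong[OF DERIV_divide[OF DERIV_const F' nz[OF x]]]) (simp add: power2_eq_square)
  qed auto
  ultimately show ?thesis
    using \<open>0 \<le> e\<close> osc_mono[OF _ order_refl] mult_left_mono by blast
qed

section \<open>Morse functions and their noisy maps\<close>

text \<open>Here \<open>\<psi>\<close> is a Morse function on the circle, lifted to the real line, with quantitative versions of nondegeneracy: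
\<open>|\<psi>'|\<close> grows linearly within distance \<open>D\<close> of a critical point, \<open>\<psi>''\<close> has constant sign there, and
\<open>|\<psi>'| \<ge> c\<^sub>1\<close> away from the critical points. The function \<open>B\<close> is to be an antiderivative of
\<open>ln |\<psi>'|\<close>, which enters the mixing argument through its oscillation and its Lipschitz bound away from the critical points.\<close>

locale morse_function =
  fixes \<psi> \<psi>' \<psi>'' B :: "real \<Rightarrow> real" and c D c\<^sub>0 c\<^sub>1 M E :: real
  assumes periodic: "\<psi> (x + 1) = \<psi> x"
    and deriv1: "(\<psi> has_real_derivative \<psi>' x) (at x)"
    and deriv2: "(\<psi>' has_real_derivative \<psi>'' x) (at x)"
    and M: "1 \<le> M" "\<bar>\<psi>' x\<bar> \<le> M" "\<bar>\<psi>'' x\<bar> \<le> M"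
    and c: "0 < c" "c < 1" and D: "0 < D" "D \<le> 1" and c\<^sub>0: "0 < c\<^sub>0" and c\<^sub>1: "0 < c\<^sub>1"
    and near: "\<psi>' p = 0 \<Longrightarrow> \<bar>y - p\<bar> \<le> D \<Longrightarrow> c\<^sub>0 * \<bar>y - p\<bar> \<le> \<bar>\<psi>' y\<bar>"
    and fold: "\<psi>' p = 0 \<Longrightarrow> (\<forall>y. \<bar>y - p\<bar> \<le> D \<longrightarrow> 0 \<le> \<psi>'' y) \<or> (\<forall>y. \<bar>y - p\<bar> \<le> D \<longrightarrow> \<psi>'' y \<le> 0)"
    and far: "(\<And>p. \<psi>' p = 0 \<Longrightarrow> min c D / 2 \<le> \<bar>y - p\<bar>) \<Longrightarrow> c\<^sub>1 \<le> \<bar>\<psi>' y\<bar>"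
    and B_cont: "continuous_on UNIV B"
    and B_shift: "B (x + 1) = B x + (B 1 - B 0)"
    and B_osc: "osc B (B 1 - B 0) UNIV E"
    and B_lip: "(\<And>y. y \<in> {u..v} \<Longrightarrow> c\<^sub>1 \<le> \<bar>\<psi>' y\<bar>) \<Longrightarrow> lip B (B 1 - B 0) {u..v} E"

text \<open>The critical orbits are at distance at least \<open>c\<close> from the critical points for \<open>k\<close> steps (\<open>clear\<close>), and the noise is weak
enough that nearby orbits follow them for that long (\<open>quiet\<close>). Condition \<open>escape\<close> is the lower bound on the noise in the
form in which the balanced estimate near the critical points uses it, with \<open>Q\<close> in the role of \<open>L\<close> to the power
\<open>\<beta>/2\<close>: this is the gain for each step. It has to beat the constants collected in \<open>K\<close>, and the number \<open>N\<close>
of pieces of length \<open>D/2\<close> that cover the circle.\<close>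

locale noisy_morse_map = morse_function +
  fixes L a \<epsilon> Q K :: real and k N :: nat
  assumes L: "1 \<le> L" and \<epsilon>: "0 < \<epsilon>"
    and clear: "\<psi>' p = 0 \<Longrightarrow> \<psi>' p' = 0 \<Longrightarrow> 1 \<le> i \<Longrightarrow> i \<le> k \<Longrightarrow>
      c \<le> \<bar>((\<lambda>y. L * \<psi> y + a) ^^ i) p - p'\<bar>"
    and quiet: "k = 0 \<or> 2 * \<epsilon> * (L * M) ^ (k - 1) \<le> c / 4"
    and escape: "Q ^ (k + 1) \<le> sqrt (L * M) ^ (2 * k + 1) * sqrt (min \<epsilon> 1)"
    and Q: "0 < Q" "Q \<le> sqrt (L * M)" "1 / sqrt (L * M) \<le> D"
    and K: "1 \<le> K" "6 * M / (c\<^sub>0 * sqrt c) \<le> K" "3 * M / c\<^sub>0 \<le> K" "(1 / c\<^sub>1 + M / c\<^sub>1\<^sup>2) * M \<le> K"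
    and N: "1 \<le> N" "2 \<le> real N * D" "40 * N * K \<le> Q"
begin

definition F :: "real \<Rightarrow> real" where "F y = L * \<psi> y + a"

definition A :: real where "A = L * M"
definition s :: real where "s = sqrt A"
definition q :: real where "q = K / Q"

text \<open>The factor by which one step in the region \<open>|\<psi>'| \<ge> c\<^sub>1\<close> reduces mean oscillation.\<close>

definition \<kappa> :: real where "\<kappa> = (1 / c\<^sub>1 + M / c\<^sub>1\<^sup>2) / L"

text \<open>\<open>V l\<close> is an antiderivative of \<open>\<phi>\<^sub>l(y) = E(ln |\<psi>'(Y\<^sub>l)| | Y\<^sub>0 = y)\<close>: given \<open>Y\<^sub>0 = y\<close>, the point
\<open>Y\<^sub>1\<close> is uniform on the interval of radius \<open>\<epsilon>\<close> about \<open>F y\<close>.\<close>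

fun V :: "nat \<Rightarrow> real \<Rightarrow> real" where
  "V 0 = B"
| "V (Suc l) = antider (\<lambda>y. window \<epsilon> (V l) (F y))"

declare V.simps(2) [simp del]

text \<open>The mean of \<open>\<phi>\<^sub>l\<close> over one period.\<close>

definition avg :: "nat \<Rightarrow> real" where "avg l = V l 1 - V l 0"

lemma s_ge: "40 \<le> s" and A_eq: "A = s\<^sup>2" and A_ge: "40 \<le> A" "2 \<le> A"
  and q_pos: "0 < q" and q_le: "40 * N * q \<le> 1" "q \<le> 1 / 40" and \<kappa>_pos: "0 < \<kappa>"
proof -
  have "40 * 1 * 1 \<le> 40 * real N * K" using N(1) K(1) by (intro mult_mono) auto
  then have "40 \<le> Q" using N(3) by simp
  then show s: "40 \<le> s" using Q(2) by (simp add: s_def A_def)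
  show A: "A = s\<^sup>2" using L M(1) by (simp add: s_def A_def)
  have "40 * 1 \<le> s * s" using s by (intro mult_mono) auto
  then show "40 \<le> A" "2 \<le> A" using A by (simp_all add: power2_eq_square)
  show "0 < q" using K(1) Q(1) by (simp add: q_def)
  show Nq: "40 * N * q \<le> 1" using N(3) Q(1) by (simp add: q_def field_simps)
  have "40 * 1 * q \<le> 40 * real N * q" using N(1) \<open>0 < q\<close> by (intro mult_mono) auto
  then show "q \<le> 1 / 40" using Nq by simp
  show "0 < \<kappa>" using c\<^sub>1 M(1) L by (auto simp: \<kappa>_def intro!: divide_pos_pos add_pos_nonneg)
qed

lemma F_deriv: "(F has_real_derivative L * \<psi>' x) (at x)"
  unfolding F_def by (rule DERIV_cong[OF DERIV_add[OF DERIV_cmult[OF deriv1] DERIV_const]]) simp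

lemma F'_deriv: "((\<lambda>y. L * \<psi>' y) has_real_derivative L * \<psi>'' x) (at x)"
  by (rule DERIV_cmult[OF deriv2])

lemma continuous_F: "continuous_on UNIV F"
  by (rule DERIV_continuous_on[OF F_deriv])

lemma abs_diff_le_of_deriv:
  assumes "\<And>x. (f has_real_derivative f' x) (at x)" "\<And>x. \<bar>x - y\<bar> \<le> \<bar>z - y\<bar> \<Longrightarrow> \<bar>f' x\<bar> \<le> C"
  shows "\<bar>f z - f y\<bar> \<le> C * \<bar>z - y\<bar>"
  using field_differentiable_bound[of "cball y \<bar>z - y\<bar>" f f' C z y] assms
  by (auto simp: dist_real_def abs_minus_commute intro: has_field_derivative_at_within)

lemma F_lip: "\<bar>F z - F y\<bar> \<le> A * \<bar>z - y\<bar>"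
  by (rule abs_diff_le_of_deriv[OF F_deriv]) (use L M in \<open>simp add: A_def abs_mult\<close>)

text \<open>\<open>F'\<close> vanishes at \<open>p\<close>, so the deviation is quadratic.\<close>

lemma F_crit:
  assumes "\<psi>' p = 0" shows "\<bar>F y - F p\<bar> \<le> A * \<bar>y - p\<bar>\<^sup>2"
proof -
  have "\<bar>F y - F p\<bar> \<le> (A * \<bar>y - p\<bar>) * \<bar>y - p\<bar>"
  proof (rule abs_diff_le_of_deriv[OF F_deriv])
    fix x assume x: "\<bar>x - p\<bar> \<le> \<bar>y - p\<bar>"
    have "\<bar>\<psi>' x - \<psi>' p\<bar> \<le> M * \<bar>x - p\<bar>"
      by (rule abs_diff_le_of_deriv[OF deriv2]) (use M in auto)
    also have "\<dots> \<le> M * \<bar>y - p\<bar>" using x M(1) by (intro mult_left_mono) auto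
    finally have "L * \<bar>\<psi>' x\<bar> \<le> L * (M * \<bar>y - p\<bar>)"
      using assms L by (intro mult_left_mono) auto
    then show "\<bar>L * \<psi>' x\<bar> \<le> A * \<bar>y - p\<bar>" using L by (simp add: A_def abs_mult mult.assoc)
  qed
  then show ?thesis by (simp add: power2_eq_square mult.assoc)
qed

lemma continuous_window:
  assumes "continuous_on UNIV W" shows "continuous_on UNIV (\<lambda>y. window \<epsilon> W (F y))"
  unfolding window_def
  by (intro continuous_intros continuous_on_compose2[OF assms] continuous_F) (use \<epsilon> in auto)

lemma continuous_V: "continuous_on UNIV (V l)"
proof (induction l)
  case 0
  show ?case by (simp add: B_cont)
next
  case (Suc l)
  show ?case unfolding V.simps(2)
    by (rule DERIV_continuous_on[OF has_derivative_antider[OF continuous_window[OF Suc]]])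
qed

lemma V_deriv: "(V (Suc l) has_real_derivative window \<epsilon> (V l) (F x)) (at x)"
  unfolding V.simps(2) by (rule has_derivative_antider[OF continuous_window[OF continuous_V]])

lemma V_shift: "V l (x + 1) = V l x + avg l"
proof (cases l)
  case 0
  then show ?thesis using B_shift by (simp add: avg_def)
next
  case (Suc n)
  let ?f = "\<lambda>y. window \<epsilon> (V n) (F y)"
  have "?f integrable_on {x..y}" for x y
    by (intro integrable_continuous_real continuous_on_subset[OF continuous_window[OF continuous_V]]) auto
  moreover have "?f (y + 1) = ?f y" for y
    by (simp add: F_def periodic)
  ultimately have "V l (x + 1) = V l x + V l 1" for x
    unfolding Suc V.simps(2) by (rule antider_shift)
  from this[of x] this[of 0] show ?thesis by (simp add: avg_def)
qed

lemma avg_0: "avg 0 = B 1 - B 0" by (simp add: avg_def)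

lemma E_nonneg: "0 \<le> E"
  using B_osc unfolding osc_def by (meson UNIV_I abs_ge_zero order_trans)

section \<open>Following a critical orbit\<close>

lemma expanding_disc:
  assumes "\<And>p. \<psi>' p = 0 \<Longrightarrow> c \<le> \<bar>z - p\<bar>" "R \<le> c / 2" "x \<in> {z - R..z + R}"
  shows "c\<^sub>1 \<le> \<bar>\<psi>' x\<bar>"
proof (rule far)
  fix p assume "\<psi>' p = 0"
  then have "c \<le> \<bar>z - p\<bar>" by (rule assms(1))
  moreover have "\<bar>z - p\<bar> \<le> \<bar>x - p\<bar> + R" using assms(3) unfolding atLeastAtMost_iff by linarith
  moreover have "min c D \<le> c" by simp
  ultimately show "min c D / 2 \<le> \<bar>x - p\<bar>" using assms(2) by linarith
qed

text \<open>A disc of radius \<open>R\<close> is mapped into a disc of radius \<open>A R\<close>, which the noise enlarges to \<open>A R + \<epsilon>\<close>. The condition on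
\<open>A\<^sup>n (R + \<epsilon>)\<close> is passed on to the next step because \<open>A \<ge> 2\<close> makes the quantity \<open>R + \<epsilon>\<close> grow at most by the factor
\<open>A\<close>.\<close>

lemma shadow_radius:
  assumes "A ^ n * (R + \<epsilon>) \<le> c / 2" "0 \<le> R"
  shows "R \<le> c / 2" "n = 0 \<or> A ^ (n - 1) * ((A * R + \<epsilon>) + \<epsilon>) \<le> c / 2"
proof -
  have "1 * (R + \<epsilon>) \<le> A ^ n * (R + \<epsilon>)"
    using A_ge assms(2) \<epsilon> by (intro mult_right_mono one_le_power) auto
  then show "R \<le> c / 2" using assms(1) \<epsilon> by simp
  show "n = 0 \<or> A ^ (n - 1) * ((A * R + \<epsilon>) + \<epsilon>) \<le> c / 2"
  proof (cases n)
    case (Suc m)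
    have "2 * \<epsilon> \<le> A * \<epsilon>" using A_ge \<epsilon> by (intro mult_right_mono) auto
    then have "A ^ m * ((A * R + \<epsilon>) + \<epsilon>) \<le> A ^ m * (A * (R + \<epsilon>))"
      using A_ge by (intro mult_left_mono) (auto simp: distrib_left)
    also have "\<dots> = A ^ n * (R + \<epsilon>)" by (simp add: Suc)
    finally show ?thesis using assms(1) Suc by simp
  qed simp
qed

text \<open>As long as the discs around \<open>z, F z, F (F z), \<dots>\<close> stay away from the critical points, every step gains the factor
\<open>\<kappa>\<close>. No derivative of an iterate is needed: the bound is pulled back one step at a time.\<close>

lemma shadow_osc:
  assumes "osc (V l) m UNIV e" "0 \<le> e" "\<And>i p. i < n \<Longrightarrow> \<psi>' p = 0 \<Longrightarrow> c \<le> \<bar>(F ^^ i) z - p\<bar>"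
    and "n = 0 \<or> A ^ (n - 1) * (R + \<epsilon>) \<le> c / 2" "0 \<le> R"
  shows "osc (V (l + n)) m {z - R..z + R} (e * \<kappa> ^ n)"
  using assms(3-)
proof (induction n arbitrary: z R)
  case 0
  then show ?case using osc_mono[OF assms(1), of _ e] by simp
next
  case (Suc n)
  have R: "R \<le> c / 2" "n = 0 \<or> A ^ (n - 1) * ((A * R + \<epsilon>) + \<epsilon>) \<le> c / 2"
    using shadow_radius[of n R] Suc.prems by auto
  have cl: "c \<le> \<bar>(F ^^ i) (F z) - p\<bar>" if "i < n" "\<psi>' p = 0" for i p
    using Suc.prems(1)[of "Suc i" p] that by (simp add: funpow_swap1)
  have "0 \<le> A * R + \<epsilon>" using A_ge Suc.prems(3) \<epsilon> by simp
  from Suc.IH[OF cl R(2) this]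
  have IH: "osc (V (l + n)) m {F z - A * R - \<epsilon>..F z + A * R + \<epsilon>} (e * \<kappa> ^ n)"
    by (simp add: algebra_simps)
  have "osc (V (Suc (l + n))) m {z - R..z + R} (e * \<kappa> ^ n * (1 / (L * c\<^sub>1) + L * M / (L * c\<^sub>1)\<^sup>2))"
  proof (rule osc_pullback_far[OF continuous_V \<epsilon> V_deriv F_deriv F'_deriv IH])
    fix x assume x: "x \<in> {z - R..z + R}"
    have "A * \<bar>x - z\<bar> \<le> A * R" using x A_ge by (intro mult_left_mono) auto
    then show "F x \<in> {F z - A * R..F z + A * R}" using F_lip[of x z] by auto
    have "c\<^sub>1 \<le> \<bar>\<psi>' x\<bar>"
      using expanding_disc[of z R x] Suc.prems(1)[of 0] R(1) x by simp
    then show "L * c\<^sub>1 \<le> \<bar>L * \<psi>' x\<bar>" using L by (simp add: abs_mult)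
    show "\<bar>L * \<psi>'' x\<bar> \<le> L * M" using L M by (simp add: abs_mult)
  qed (use L M(1) c\<^sub>1 c R \<open>0 \<le> e\<close> \<kappa>_pos in auto)
  moreover have "1 / (L * c\<^sub>1) + L * M / (L * c\<^sub>1)\<^sup>2 = \<kappa>"
    using L c\<^sub>1 by (simp add: \<kappa>_def field_simps power2_eq_square)
  ultimately show ?case by (simp add: ac_simps)
qed

text \<open>Pointwise bounds are simply transported: along the whole stretch, \<open>ln |\<psi>'|\<close> is only evaluated in the region
\<open>|\<psi>'| \<ge> c\<^sub>1\<close>, where it differs from its mean by at most \<open>E\<close>.\<close>

lemma shadow_lip:
  assumes "\<And>i p. i \<le> n \<Longrightarrow> \<psi>' p = 0 \<Longrightarrow> c \<le> \<bar>(F ^^ i) z - p\<bar>"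
    and "A ^ n * (R + \<epsilon>) \<le> c / 2" "0 \<le> R"
  shows "lip (V n) (avg 0) {z - R..z + R} E"
  using assms
proof (induction n arbitrary: z R)
  case 0
  then show ?case using B_lip[of "z - R" "z + R"] expanding_disc[of z R] \<epsilon> by (simp add: avg_0)
next
  case (Suc n)
  have R: "R \<le> c / 2" "A ^ n * ((A * R + \<epsilon>) + \<epsilon>) \<le> c / 2"
    using shadow_radius[of "Suc n" R] Suc.prems by auto
  have cl: "c \<le> \<bar>(F ^^ i) (F z) - p\<bar>" if "i \<le> n" "\<psi>' p = 0" for i p
    using Suc.prems(1)[of "Suc i" p] that by (simp add: funpow_swap1)
  have "0 \<le> A * R + \<epsilon>" using A_ge Suc.prems(3) \<epsilon> by simp
  from Suc.IH[OF cl R(2) this]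
  have IH: "lip (V n) (avg 0) {F z - (A * R + \<epsilon>)..F z + (A * R + \<epsilon>)} E" .
  show ?case
  proof (rule lip_of_derivative[OF V_deriv])
    fix x assume x: "x \<in> {z - R..z + R}"
    have "A * \<bar>x - z\<bar> \<le> A * R" using x A_ge by (intro mult_left_mono) auto
    then have "{F x - \<epsilon>..F x + \<epsilon>} \<subseteq> {F z - (A * R + \<epsilon>)..F z + (A * R + \<epsilon>)}"
      using F_lip[of x z] by auto
    then have "lip (V n) (avg 0) {F x - \<epsilon>..F x + \<epsilon>} E"
      using IH unfolding lip_def by blast
    then show "\<bar>window \<epsilon> (V n) (F x) - avg 0\<bar> \<le> E"
      by (rule window_near_mean_lip[OF \<epsilon>])
  qed
qed


text \<open>The points at distance between \<open>\<rho>\<close> and \<open>r\<close> from \<open>p\<close>, to the right if \<open>\<sigma> = 1\<close> and to the left if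
\<open>\<sigma> = -1\<close>. The two sides are treated separately because \<open>F'\<close> vanishes at \<open>p\<close>.\<close>

definition side :: "real \<Rightarrow> real \<Rightarrow> real \<Rightarrow> real \<Rightarrow> real set" where
  "side p \<sigma> \<rho> r = {x. \<rho> \<le> \<sigma> * (x - p) \<and> \<sigma> * (x - p) \<le> r}"

lemma side_interval:
  assumes "\<bar>\<sigma>\<bar> = 1" "0 \<le> \<rho>" "\<rho> \<le> r"
  obtains u v where "side p \<sigma> \<rho> r = {u..v}" "u \<le> v" "\<And>x. x \<in> {u..v} \<Longrightarrow> \<rho> \<le> \<bar>x - p\<bar> \<and> \<bar>x - p\<bar> \<le> r"
proof (cases "\<sigma> = 1")
  case True
  have eq: "side p \<sigma> \<rho> r = {p + \<rho>..p + r}" using True by (auto simp: side_def)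
  show ?thesis by (rule that[OF eq]) (use assms in auto)
next
  case False
  then have "\<sigma> = -1" using assms(1) by auto
  then have eq: "side p \<sigma> \<rho> r = {p - r..p - \<rho>}" by (auto simp: side_def)
  show ?thesis by (rule that[OF eq]) (use assms in auto)
qed

lemma side_length:
  assumes "\<bar>\<sigma>\<bar> = 1" "0 \<le> \<rho>" "x \<in> side p \<sigma> \<rho> r" "y \<in> side p \<sigma> \<rho> r"
  shows "\<bar>y - x\<bar> \<le> r"
proof -
  have "\<bar>\<sigma> * (y - p) - \<sigma> * (x - p)\<bar> \<le> r" using assms unfolding side_def by auto
  moreover have "\<sigma> * (y - p) - \<sigma> * (x - p) = \<sigma> * (y - x)" by (simp add: algebra_simps)
  ultimately show ?thesis using assms(1) by (simp add: abs_mult)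
qed

lemma F_crit_ball:
  assumes "\<psi>' p = 0" "\<bar>x - p\<bar> \<le> r"
  shows "F x \<in> {F p - A * r\<^sup>2..F p + A * r\<^sup>2}"
proof -
  have "A * \<bar>x - p\<bar>\<^sup>2 \<le> A * r\<^sup>2"
    using assms(2) A_ge by (intro mult_left_mono power_mono) auto
  then show ?thesis using F_crit[OF assms(1), of x] by auto
qed

lemma clear_crit:
  assumes "\<psi>' p = 0" "\<psi>' p' = 0" "i < k"
  shows "c \<le> \<bar>(F ^^ i) (F p) - p'\<bar>"
proof -
  have "(F ^^ i) (F p) = ((\<lambda>y. L * \<psi> y + a) ^^ Suc i) p"
    by (simp only: funpow_Suc_right o_apply F_def[abs_def])
  then show ?thesis using clear[OF assms(1,2), of "Suc i"] assms(3) by simp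
qed

text \<open>One step with derivative at least \<open>L c\<^sub>0 \<rho>\<close>, then \<open>j\<close> steps along the critical orbit. The image of the annulus lies within
\<open>A r\<^sup>2\<close> of \<open>F p\<close>, which is why the radius enters the shadowing condition quadratically.\<close>

lemma annulus_osc:
  assumes "\<psi>' p = 0" "\<bar>\<sigma>\<bar> = 1" "0 < \<rho>" "\<rho> \<le> r" "r \<le> D" "j \<le> k"
    and "osc (V i) m UNIV e" "0 \<le> e"
    and "j = 0 \<or> A ^ (j - 1) * (A * r\<^sup>2 + 2 * \<epsilon>) \<le> c / 2"
  shows "osc (V (Suc (i + j))) m (side p \<sigma> \<rho> r) (e * \<kappa> ^ j * (3 / (L * (c\<^sub>0 * \<rho>))))"
proof -
  have \<rho>: "0 \<le> \<rho>" using assms by simp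
  obtain u v where uv: "side p \<sigma> \<rho> r = {u..v}" "u \<le> v"
      "\<And>x. x \<in> {u..v} \<Longrightarrow> \<rho> \<le> \<bar>x - p\<bar> \<and> \<bar>x - p\<bar> \<le> r"
    by (rule side_interval[OF assms(2) \<rho> assms(4), of p]) blast
  have "osc (V (i + j)) m {F p - (A * r\<^sup>2 + \<epsilon>)..F p + (A * r\<^sup>2 + \<epsilon>)} (e * \<kappa> ^ j)"
  proof (rule shadow_osc[OF assms(7,8)])
    show "c \<le> \<bar>(F ^^ i) (F p) - p'\<bar>" if "i < j" "\<psi>' p' = 0" for i p'
      using clear_crit[OF assms(1) that(2)] that(1) assms(6) by simp
  qed (use assms A_ge \<epsilon> in \<open>auto simp: algebra_simps\<close>)
  then have sh: "osc (V (i + j)) m {F p - A * r\<^sup>2 - \<epsilon>..F p + A * r\<^sup>2 + \<epsilon>} (e * \<kappa> ^ j)"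
    by (simp add: algebra_simps)
  show ?thesis
    unfolding uv(1)
  proof (rule osc_pullback_monotone[OF continuous_V \<epsilon> V_deriv F_deriv F'_deriv sh _ _ uv(2)])
    fix x assume x: "x \<in> {u..v}"
    show "F x \<in> {F p - A * r\<^sup>2..F p + A * r\<^sup>2}"
      using F_crit_ball[OF assms(1)] uv(3)[OF x] by blast
    have "c\<^sub>0 * \<rho> \<le> c\<^sub>0 * \<bar>x - p\<bar>" using uv(3)[OF x] c\<^sub>0 by (intro mult_left_mono) auto
    also have "\<dots> \<le> \<bar>\<psi>' x\<bar>" using uv(3)[OF x] assms(1,5) by (intro near) auto
    finally show "L * (c\<^sub>0 * \<rho>) \<le> \<bar>L * \<psi>' x\<bar>" using L by (simp add: abs_mult)
  next
    have "\<bar>x - p\<bar> \<le> D" if "x \<in> {u..v}" for x using uv(3)[OF that] assms(5) by simp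
    then show "(\<forall>x\<in>{u..v}. 0 \<le> L * \<psi>'' x) \<or> (\<forall>x\<in>{u..v}. L * \<psi>'' x \<le> 0)"
      using fold[OF assms(1)] L by (metis mult_nonneg_nonneg mult_nonneg_nonpos order_trans zero_le_one)
  qed (use L c\<^sub>0 assms(3,8) \<kappa>_pos in auto)
qed

text \<open>Arbitrarily close to \<open>p\<close> the map does not expand. But \<open>\<phi>\<^sub>l(x)\<close> is an average over the noise of the next step, so
after \<open>k\<close> steps along the critical orbit it is pointwise close to its mean, and the region is short.\<close>

lemma core_osc:
  assumes "\<psi>' p = 0" "\<bar>\<sigma>\<bar> = 1" "0 \<le> r"
    and "osc (V i) m UNIV e" "0 \<le> e"
    and "k = 0 \<or> A ^ (k - 1) * (A * r\<^sup>2 + 2 * \<epsilon>) \<le> c / 2"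
  shows "osc (V (Suc (i + k))) m (side p \<sigma> 0 r) (e * \<kappa> ^ k / (2 * \<epsilon>) * r)"
proof -
  obtain u v where uv: "side p \<sigma> 0 r = {u..v}" "u \<le> v"
      "\<And>x. x \<in> {u..v} \<Longrightarrow> 0 \<le> \<bar>x - p\<bar> \<and> \<bar>x - p\<bar> \<le> r"
    by (rule side_interval[OF assms(2) order_refl assms(3), of p]) blast
  have sh: "osc (V (i + k)) m {F p - (A * r\<^sup>2 + \<epsilon>)..F p + (A * r\<^sup>2 + \<epsilon>)} (e * \<kappa> ^ k)"
  proof (rule shadow_osc[OF assms(4,5)])
    show "c \<le> \<bar>(F ^^ i) (F p) - p'\<bar>" if "i < k" "\<psi>' p' = 0" for i p'
      using clear_crit[OF assms(1) that(2)] that(1) by simp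
  qed (use assms A_ge \<epsilon> in \<open>auto simp: algebra_simps\<close>)
  have "lip (V (Suc (i + k))) m {u..v} (e * \<kappa> ^ k / (2 * \<epsilon>))"
  proof (rule lip_of_derivative[OF V_deriv])
    fix x assume x: "x \<in> {u..v}"
    have "F x \<in> {F p - A * r\<^sup>2..F p + A * r\<^sup>2}"
      using F_crit_ball[OF assms(1)] uv(3)[OF x] by blast
    then have "{F x - \<epsilon>..F x + \<epsilon>} \<subseteq> {F p - (A * r\<^sup>2 + \<epsilon>)..F p + (A * r\<^sup>2 + \<epsilon>)}" by auto
    then show "\<bar>window \<epsilon> (V (i + k)) (F x) - m\<bar> \<le> e * \<kappa> ^ k / (2 * \<epsilon>)"
      by (intro window_near_mean[OF \<epsilon>] osc_mono[OF sh _ order_refl])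
  qed
  then show ?thesis
    unfolding uv(1)[symmetric]
    by (rule osc_of_lip) (use side_length[OF assms(2) order_refl] assms(5) \<kappa>_pos \<epsilon> in auto)
qed

text \<open>At times up to \<open>k\<close> no expansion has to be found close to \<open>p\<close>: an orbit that starts there still follows the critical orbit at
the time when \<open>ln |\<psi>'|\<close> is evaluated, so the integrand is bounded by \<open>E\<close>.\<close>

lemma early_osc:
  assumes "\<psi>' p = 0" "\<bar>\<sigma>\<bar> = 1" "0 \<le> r" "Suc n \<le> k"
    and "A ^ n * (A * r\<^sup>2 + 2 * \<epsilon>) \<le> c / 2"
  shows "osc (V (Suc n)) (avg 0) (side p \<sigma> 0 r) (E * r)"
proof -
  obtain u v where uv: "side p \<sigma> 0 r = {u..v}" "u \<le> v"
      "\<And>x. x \<in> {u..v} \<Longrightarrow> 0 \<le> \<bar>x - p\<bar> \<and> \<bar>x - p\<bar> \<le> r"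
    by (rule side_interval[OF assms(2) order_refl assms(3), of p]) blast
  have sh: "lip (V n) (avg 0) {F p - (A * r\<^sup>2 + \<epsilon>)..F p + (A * r\<^sup>2 + \<epsilon>)} E"
  proof (rule shadow_lip)
    show "c \<le> \<bar>(F ^^ i) (F p) - p'\<bar>" if "i \<le> n" "\<psi>' p' = 0" for i p'
      using clear_crit[OF assms(1) that(2)] that(1) assms(4) by simp
  qed (use assms A_ge \<epsilon> in \<open>auto simp: algebra_simps\<close>)
  have "lip (V (Suc n)) (avg 0) {u..v} E"
  proof (rule lip_of_derivative[OF V_deriv])
    fix x assume x: "x \<in> {u..v}"
    have "F x \<in> {F p - A * r\<^sup>2..F p + A * r\<^sup>2}"
      using F_crit_ball[OF assms(1)] uv(3)[OF x] by blast
    then have "{F x - \<epsilon>..F x + \<epsilon>} \<subseteq> {F p - (A * r\<^sup>2 + \<epsilon>)..F p + (A * r\<^sup>2 + \<epsilon>)}" by auto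
    then have "lip (V n) (avg 0) {F x - \<epsilon>..F x + \<epsilon>} E"
      using sh unfolding lip_def by blast
    then show "\<bar>window \<epsilon> (V n) (F x) - avg 0\<bar> \<le> E"
      by (rule window_near_mean_lip[OF \<epsilon>])
  qed
  then show ?thesis
    unfolding uv(1)[symmetric]
    by (rule osc_of_lip) (use side_length[OF assms(2) order_refl] E_nonneg in auto)
qed


section \<open>Scales around a critical point\<close>

text \<open>A point within \<open>rad j\<close> of a critical point follows the critical orbit for \<open>j\<close> steps, because
\<open>A\<^sup>j (rad j)\<^sup>2 = c/4\<close> for \<open>j \<ge> 1\<close>. At scale 0 nothing has to be followed.\<close>

definition rad :: "nat \<Rightarrow> real" where
  "rad j = (if j = 0 then D else sqrt c / 2 / s ^ j)"

text \<open>The radius at which \<open>annulus_osc\<close> and \<open>core_osc\<close> balance.\<close>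

definition core :: real where "core = sqrt (min \<epsilon> 1) / s"

lemma rad_pos: "0 < rad j"
  using D c s_ge by (simp add: rad_def)

lemma sqrt_c_le: "sqrt c / 2 \<le> 1"
proof -
  have "sqrt c \<le> 1" using c by simp
  then show ?thesis by linarith
qed

lemma rad_shadow:
  assumes "1 \<le> j" "j \<le> k" shows "A ^ (j - 1) * (A * (rad j)\<^sup>2 + 2 * \<epsilon>) \<le> c / 2"
proof -
  obtain i where i: "j = Suc i" using assms by (cases j) auto
  have "A ^ (j - 1) * (A * (rad j)\<^sup>2) = A ^ j * (rad j)\<^sup>2"
    by (simp add: i mult.assoc)
  also have "\<dots> = c / 4"
    using assms c s_ge by (simp add: rad_def power_divide A_eq power_mult_distrib flip: power_mult)
      (simp add: mult.commute)
  finally have 1: "A ^ (j - 1) * (A * (rad j)\<^sup>2) = c / 4" .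
  have "A ^ (j - 1) \<le> A ^ (k - 1)" using A_ge assms by (intro power_increasing) auto
  then have "2 * \<epsilon> * A ^ (j - 1) \<le> 2 * \<epsilon> * A ^ (k - 1)" using \<epsilon> by (intro mult_left_mono) auto
  also have "\<dots> \<le> c / 4" using quiet assms by (auto simp: A_def)
  finally show ?thesis using 1 by (simp add: distrib_left mult.commute)
qed

lemma rad_Suc_le: "rad (Suc j) \<le> rad j"
proof (cases "j = 0")
  case True
  have "sqrt c / 2 / s \<le> 1 / s" using sqrt_c_le s_ge by (intro divide_right_mono) auto
  then show ?thesis using True Q(3) by (simp add: rad_def s_def A_def)
next
  case False
  have "s ^ j * 1 \<le> s ^ j * s" using s_ge by (intro mult_left_mono) auto
  then have "sqrt c / 2 / s ^ Suc j \<le> sqrt c / 2 / s ^ j"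
    using c s_ge by (intro divide_left_mono) (auto simp: mult.commute)
  then show ?thesis using False by (simp add: rad_def)
qed

lemma rad_le_D: "rad j \<le> D"
  by (induction j) (use rad_Suc_le order_trans in \<open>auto simp: rad_def\<close>)

lemma inverse_s_le: "1 / s \<le> q"
proof -
  have "1 / s \<le> K / Q" using Q K(1) s_ge by (intro frac_le) (auto simp: s_def A_def)
  then show ?thesis by (simp add: q_def)
qed

lemma rad_le: "1 \<le> j \<Longrightarrow> rad j \<le> q ^ j"
proof -
  assume j: "1 \<le> j"
  have "rad j \<le> 1 / s ^ j"
  proof -
    have "sqrt c / 2 / s ^ j \<le> 1 / s ^ j"
      using sqrt_c_le s_ge by (intro divide_right_mono) auto
    then show ?thesis using j by (simp add: rad_def)
  qed
  also have "\<dots> = (1 / s) ^ j" by (simp add: power_divide)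
  also have "\<dots> \<le> q ^ j" using inverse_s_le s_ge by (intro power_mono) auto
  finally show ?thesis .
qed

lemma \<kappa>_le: "\<kappa> \<le> K / s\<^sup>2"
proof -
  have "(1 / c\<^sub>1 + M / c\<^sub>1\<^sup>2) * M / (L * M) \<le> K / (L * M)"
    using K L M(1) by (intro divide_right_mono) auto
  then show ?thesis using M(1) by (simp add: \<kappa>_def flip: A_eq add: A_def)
qed

lemma \<kappa>_le_q: "\<kappa> \<le> q"
proof -
  have "K / s\<^sup>2 \<le> K / Q"
  proof (rule divide_left_mono)
    have "Q \<le> s" using Q(2) by (simp add: s_def A_def)
    also have "s * 1 \<le> s\<^sup>2" unfolding power2_eq_square using s_ge by (intro mult_left_mono) auto
    finally show "Q \<le> s\<^sup>2" by simp
  qed (use K(1) Q(1) s_ge in auto)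
  then show ?thesis using \<kappa>_le by (simp add: q_def)
qed

text \<open>With \<open>L = s\<^sup>2 / M\<close>, the powers of \<open>s\<close> on the left add up to \<open>-(j + 1)\<close>: the inner radius \<open>rad (Suc j)\<close> costs
half of what the \<open>j + 1\<close> expanding steps gain.\<close>

lemma annulus_factor:
  shows "\<kappa> ^ j * (3 / (L * (c\<^sub>0 * rad (Suc j)))) \<le> q ^ Suc j"
proof -
  have "3 / (L * (c\<^sub>0 * rad (Suc j))) = (6 * M / (c\<^sub>0 * sqrt c)) * (s ^ Suc j / s\<^sup>2)"
    using L M(1) c c\<^sub>0 s_ge by (simp add: rad_def A_def flip: A_eq)
  also have "\<dots> \<le> K * (s ^ Suc j / s\<^sup>2)"
    using K s_ge by (intro mult_right_mono) auto
  finally have "\<kappa> ^ j * (3 / (L * (c\<^sub>0 * rad (Suc j)))) \<le> (K / s\<^sup>2) ^ j * (K * (s ^ Suc j / s\<^sup>2))"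
    using \<kappa>_le \<kappa>_pos K s_ge L c\<^sub>0 rad_pos[of "Suc j"] by (intro mult_mono power_mono) auto
  also have "\<dots> = (K / s) ^ Suc j"
    using s_ge by (simp add: field_simps power2_eq_square power_mult_distrib)
  also have "\<dots> \<le> q ^ Suc j"
  proof (rule power_mono)
    show "K / s \<le> q" unfolding q_def using K(1) Q by (intro frac_le) (auto simp: s_def A_def)
  qed (use K(1) s_ge in auto)
  finally show ?thesis .
qed

lemma core_pos: "0 < core"
  using \<epsilon> s_ge by (simp add: core_def)

lemma core_le: "core \<le> rad k"
proof (cases "k = 0")
  case True
  have "sqrt (min \<epsilon> 1) \<le> 1" by simp
  then have "core \<le> 1 / s" unfolding core_def using s_ge by (intro divide_right_mono) auto
  then show ?thesis using True Q(3) by (simp add: rad_def s_def A_def)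
next
  case False
  have "core\<^sup>2 \<le> (rad k)\<^sup>2"
  proof -
    have "core\<^sup>2 = min \<epsilon> 1 / A" using \<epsilon> by (simp add: core_def power_divide A_eq)
    also have "\<dots> \<le> \<epsilon> / A" using A_ge by (intro divide_right_mono) auto
    also have "\<dots> \<le> c / 4 / A ^ k"
    proof -
      have "\<epsilon> * A ^ (k - 1) \<le> c / 4" using quiet False \<epsilon> A_ge
        by (auto simp: A_def) (smt (verit, best) zero_le_mult_iff zero_le_power)
      then have "\<epsilon> * A ^ k \<le> c / 4 * A" using False A_ge by (cases k) auto
      then show ?thesis using A_ge by (simp add: field_simps)
    qed
    also have "\<dots> = (rad k)\<^sup>2"
      using False c s_ge by (simp add: rad_def power_divide A_eq power_mult_distrib flip: power_mult)
    finally show ?thesis .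
  qed
  then show ?thesis by (rule power2_le_imp_le) (use rad_pos[of k] in auto)
qed

text \<open>The condition \<open>escape\<close>, in the form of a factor \<open>q\<close> for each of \<open>k + 1\<close> steps.\<close>

lemma escape_factor: "K ^ Suc k / (s ^ (2 * k + 1) * sqrt (min \<epsilon> 1)) \<le> q ^ Suc k"
proof -
  have "K ^ Suc k / (s ^ (2 * k + 1) * sqrt (min \<epsilon> 1)) \<le> K ^ Suc k / Q ^ Suc k"
  proof (rule divide_left_mono)
    show "Q ^ Suc k \<le> s ^ (2 * k + 1) * sqrt (min \<epsilon> 1)" using escape by (simp add: s_def A_def)
    show "0 < s ^ (2 * k + 1) * sqrt (min \<epsilon> 1) * Q ^ Suc k"
      using Q(1) s_ge \<epsilon> by (intro mult_pos_pos zero_less_power) auto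
  qed (use K(1) in auto)
  then show ?thesis by (simp add: q_def power_divide)
qed

lemma last_annulus_factor: "\<kappa> ^ k * (3 / (L * (c\<^sub>0 * core))) \<le> q ^ Suc k"
proof -
  have "3 / (L * (c\<^sub>0 * core)) = 3 * M / c\<^sub>0 * (s / (s\<^sup>2 * sqrt (min \<epsilon> 1)))"
    using L M(1) c\<^sub>0 by (simp add: core_def A_def flip: A_eq)
  also have "\<dots> \<le> K * (s / (s\<^sup>2 * sqrt (min \<epsilon> 1)))"
    using K s_ge \<epsilon> by (intro mult_right_mono) auto
  finally have "\<kappa> ^ k * (3 / (L * (c\<^sub>0 * core))) \<le> (K / s\<^sup>2) ^ k * (K * (s / (s\<^sup>2 * sqrt (min \<epsilon> 1))))"
    using \<kappa>_le \<kappa>_pos K s_ge L c\<^sub>0 core_pos by (intro mult_mono power_mono) auto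
  also have "\<dots> = K ^ Suc k / (s ^ (2 * k + 1) * sqrt (min \<epsilon> 1))"
    using s_ge \<epsilon> by (simp add: power_divide power2_eq_square power_mult field_simps power_mult_distrib)
  also have "\<dots> \<le> q ^ Suc k" by (rule escape_factor)
  finally show ?thesis .
qed

lemma core_factor: "\<kappa> ^ k / (2 * \<epsilon>) * core \<le> q ^ Suc k"
proof -
  have r: "sqrt (min \<epsilon> 1) * sqrt (min \<epsilon> 1) = min \<epsilon> 1" using \<epsilon> by simp
  have "1 / (2 * \<epsilon>) * core \<le> 1 / min \<epsilon> 1 * core"
    using \<epsilon> core_pos by (intro mult_right_mono frac_le) auto
  also have "\<dots> = 1 / (s * sqrt (min \<epsilon> 1))"
    unfolding core_def using r \<epsilon> s_ge by (simp add: field_simps)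
  also have "\<dots> \<le> K * (1 / (s * sqrt (min \<epsilon> 1)))"
    using K(1) s_ge \<epsilon> by (simp add: divide_right_mono)
  finally have "\<kappa> ^ k * (1 / (2 * \<epsilon>) * core) \<le> (K / s\<^sup>2) ^ k * (K * (1 / (s * sqrt (min \<epsilon> 1))))"
    using \<kappa>_le \<kappa>_pos K(1) s_ge \<epsilon> core_pos by (intro mult_mono[OF power_mono]) auto
  also have "\<dots> = K ^ Suc k / (s ^ (2 * k + 1) * sqrt (min \<epsilon> 1))"
    using s_ge \<epsilon> by (simp add: power_divide power2_eq_square power_mult field_simps power_mult_distrib)
  also have "\<dots> \<le> q ^ Suc k" by (rule escape_factor)
  finally show ?thesis by simp
qed


section \<open>Exponential mixing\<close>

text \<open>The induction hypothesis of the mixing argument. The means \<open>avg i\<close> are part of it, because the estimates near a critical point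
look back up to \<open>k + 1\<close> steps and have to be recentred.\<close>

definition settled :: "nat \<Rightarrow> bool" where
  "settled n \<longleftrightarrow> (\<forall>i\<le>n. osc (V i) (avg i) UNIV (E / 2 ^ i)) \<and>
     (\<forall>i<n. \<bar>avg (Suc i) - avg i\<bar> \<le> E / 2 ^ Suc i)"

lemma settled_drift:
  assumes "settled n" "i \<le> n" shows "\<bar>avg i - avg n\<bar> \<le> E / 2 ^ i"
proof -
  have "\<bar>avg i - avg j\<bar> \<le> E / 2 ^ i - E / 2 ^ j" if "i \<le> j" "j \<le> n" for j
    using that
  proof (induction j rule: dec_induct)
    case (step j)
    then have "\<bar>avg (Suc j) - avg j\<bar> \<le> E / 2 ^ Suc j" using assms(1) by (simp add: settled_def)
    moreover have "E / 2 ^ j = 2 * (E / 2 ^ Suc j)" by simp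
    ultimately show ?case using step by linarith
  qed simp
  from this[of n] have "\<bar>avg i - avg n\<bar> \<le> E / 2 ^ i - E / 2 ^ n" using assms(2) by simp
  moreover have "0 \<le> E / 2 ^ n" using E_nonneg by simp
  ultimately show ?thesis by linarith
qed

lemma osc_side_recentre:
  assumes "settled n" "i \<le> n" "\<bar>\<sigma>\<bar> = 1" "0 \<le> \<rho>" "osc W (avg i) (side p \<sigma> \<rho> r) x" "r \<le> r'"
  shows "osc W (avg n) (side p \<sigma> \<rho> r) (x + E / 2 ^ i * r')"
  by (rule osc_recentre[OF assms(5) settled_drift[OF assms(1,2)]])
     (use E_nonneg order_trans[OF side_length[OF assms(3,4)] assms(6)] in auto)

text \<open>Looking back \<open>j\<close> further steps costs a factor \<open>2\<^sup>j\<close>, which is why the gain for each step appears as \<open>2 q\<close> below.\<close>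

lemma dyadic_scale:
  assumes "j \<le> n" shows "E / 2 ^ (n - j) * q ^ j = E / 2 ^ n * (2 * q) ^ j"
  using assms by (simp add: power_diff power_mult_distrib field_simps)

text \<open>The summand \<open>(2 q)\<^sup>j\<close> is the cost of recentring over the annulus, whose length is at most \<open>q\<^sup>j\<close>. It is absent for
\<open>j = 0\<close>, when only one step is made and the mean is already \<open>avg n\<close>.\<close>

lemma annulus_step:
  assumes "settled n" "\<psi>' p = 0" "\<bar>\<sigma>\<bar> = 1" "j \<le> n" "j < k"
  shows "osc (V (Suc n)) (avg n) (side p \<sigma> (rad (Suc j)) (rad j))
    (E / 2 ^ n * ((2 * q) ^ j * q + (if j = 0 then 0 else (2 * q) ^ j)))"
proof -
  have nj: "n - j + j = n" using assms by simp
  have o: "osc (V (n - j)) (avg (n - j)) UNIV (E / 2 ^ (n - j))" "0 \<le> E / 2 ^ (n - j)"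
    using assms(1) E_nonneg by (auto simp: settled_def)
  have "osc (V (Suc (n - j + j))) (avg (n - j)) (side p \<sigma> (rad (Suc j)) (rad j))
      (E / 2 ^ (n - j) * \<kappa> ^ j * (3 / (L * (c\<^sub>0 * rad (Suc j)))))"
    by (rule annulus_osc[OF assms(2,3) rad_pos rad_Suc_le rad_le_D _ o])
       (use assms rad_shadow[of j] in \<open>auto simp: not_less_eq_eq Suc_le_eq\<close>)
  note o1 = this[unfolded nj]
  have "E / 2 ^ (n - j) * \<kappa> ^ j * (3 / (L * (c\<^sub>0 * rad (Suc j)))) \<le> E / 2 ^ (n - j) * q ^ Suc j"
    using mult_left_mono[OF annulus_factor[of j] o(2)] by (simp add: mult.assoc)
  also have "E / 2 ^ (n - j) * q ^ Suc j = E / 2 ^ n * ((2 * q) ^ j * q)"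
    using arg_cong[OF dyadic_scale[OF assms(4)], of "\<lambda>x. x * q"]
    by (simp only: mult.assoc power_Suc2)
  finally have 1: "osc (V (Suc n)) (avg (n - j)) (side p \<sigma> (rad (Suc j)) (rad j))
      (E / 2 ^ n * ((2 * q) ^ j * q))"
    by (rule osc_weaken[OF o1])
  show ?thesis
  proof (cases "j = 0")
    case True
    then show ?thesis using 1 by simp
  next
    case False
    then have "rad j \<le> q ^ j" by (intro rad_le) auto
    from osc_side_recentre[OF assms(1) _ assms(3) _ 1 this]
    have "osc (V (Suc n)) (avg n) (side p \<sigma> (rad (Suc j)) (rad j))
        (E / 2 ^ n * ((2 * q) ^ j * q) + E / 2 ^ (n - j) * q ^ j)"
      using rad_pos[of "Suc j"] by simp
    then show ?thesis using False dyadic_scale[OF assms(4)] by (simp add: distrib_left)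
  qed
qed

lemma early_step:
  assumes "settled n" "\<psi>' p = 0" "\<bar>\<sigma>\<bar> = 1" "Suc n \<le> k"
  shows "osc (V (Suc n)) (avg n) (side p \<sigma> 0 (rad (Suc n))) (E / 2 ^ n * (2 * (2 * q) ^ Suc n))"
proof -
  have "osc (V (Suc n)) (avg 0) (side p \<sigma> 0 (rad (Suc n))) (E * rad (Suc n))"
    using rad_pos[of "Suc n"] assms rad_shadow[of "Suc n"] by (intro early_osc) auto
  from osc_side_recentre[OF assms(1) _ assms(3) _ this, of "rad (Suc n)"]
  have o: "osc (V (Suc n)) (avg n) (side p \<sigma> 0 (rad (Suc n))) (2 * (E * rad (Suc n)))" by simp
  have "E * rad (Suc n) \<le> E * q ^ Suc n"
    using rad_le[of "Suc n"] E_nonneg by (intro mult_left_mono) auto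
  also have "E * q ^ Suc n = E / 2 ^ n * ((2 * q) ^ Suc n / 2)"
    by (simp add: power_mult_distrib)
  also have "\<dots> \<le> E / 2 ^ n * (2 * q) ^ Suc n"
    using E_nonneg q_pos by (intro mult_left_mono) auto
  finally show ?thesis
    by (intro osc_mono[OF o order_refl]) simp
qed

lemma side_union:
  assumes "\<bar>\<sigma>\<bar> = 1" "0 \<le> \<rho>" "\<rho> \<le> r"
    and "osc W m (side p \<sigma> 0 \<rho>) x" "osc W m (side p \<sigma> \<rho> r) y"
  shows "osc W m (side p \<sigma> 0 r) (x + y)"
proof -
  have \<sigma>: "\<sigma> * \<sigma> = 1" using assms(1) by (metis abs_mult_self_eq mult_1)
  have "side p \<sigma> 0 \<rho> \<union> side p \<sigma> \<rho> r = side p \<sigma> 0 r"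
    using assms(2,3) by (auto simp: side_def)
  moreover have "p + \<sigma> * \<rho> \<in> side p \<sigma> 0 \<rho>" "p + \<sigma> * \<rho> \<in> side p \<sigma> \<rho> r"
    using assms(2,3) \<sigma> by (simp_all add: side_def flip: mult.assoc)
  ultimately show ?thesis using osc_union[OF assms(4,5)] by metis
qed

lemma core_step:
  assumes "settled n" "\<psi>' p = 0" "\<bar>\<sigma>\<bar> = 1" "k \<le> n"
  shows "osc (V (Suc n)) (avg n) (side p \<sigma> 0 (rad k))
    (E / 2 ^ n * (2 * ((2 * q) ^ k * q) + (if k = 0 then 0 else (2 * q) ^ k)))"
proof -
  have nk: "n - k + k = n" using assms by simp
  have o: "osc (V (n - k)) (avg (n - k)) UNIV (E / 2 ^ (n - k))" "0 \<le> E / 2 ^ (n - k)"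
    using assms(1) E_nonneg by (auto simp: settled_def)
  have sq: "E / 2 ^ (n - k) * q ^ Suc k = E / 2 ^ n * ((2 * q) ^ k * q)"
    using arg_cong[OF dyadic_scale[OF assms(4)], of "\<lambda>x. x * q"]
    by (simp only: mult.assoc power_Suc2)
  have sh: "k = 0 \<or> A ^ (k - 1) * (A * r\<^sup>2 + 2 * \<epsilon>) \<le> c / 2" if "0 \<le> r" "r \<le> rad k" for r
  proof (cases "k = 0")
    case False
    have "A ^ (k - 1) * (A * r\<^sup>2 + 2 * \<epsilon>) \<le> A ^ (k - 1) * (A * (rad k)\<^sup>2 + 2 * \<epsilon>)"
      using that A_ge by (intro mult_left_mono add_mono power_mono) auto
    then show ?thesis using rad_shadow[of k] False by simp
  qed simp
  have "osc (V (Suc (n - k + k))) (avg (n - k)) (side p \<sigma> core (rad k))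
      (E / 2 ^ (n - k) * \<kappa> ^ k * (3 / (L * (c\<^sub>0 * core))))"
    by (rule annulus_osc[OF assms(2,3) core_pos core_le rad_le_D order_refl o])
       (use sh rad_pos[of k] in auto)
  note o1 = this[unfolded nk]
  have "E / 2 ^ (n - k) * \<kappa> ^ k * (3 / (L * (c\<^sub>0 * core))) \<le> E / 2 ^ n * ((2 * q) ^ k * q)"
    using mult_left_mono[OF last_annulus_factor o(2)] unfolding sq by (simp add: mult.assoc)
  then have 1: "osc (V (Suc n)) (avg (n - k)) (side p \<sigma> core (rad k)) (E / 2 ^ n * ((2 * q) ^ k * q))"
    by (rule osc_weaken[OF o1])
  have "osc (V (Suc (n - k + k))) (avg (n - k)) (side p \<sigma> 0 core)
      (E / 2 ^ (n - k) * \<kappa> ^ k / (2 * \<epsilon>) * core)"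
    by (rule core_osc[OF assms(2,3) _ o]) (use sh core_pos core_le in auto)
  note o2 = this[unfolded nk]
  have "E / 2 ^ (n - k) * \<kappa> ^ k / (2 * \<epsilon>) * core \<le> E / 2 ^ n * ((2 * q) ^ k * q)"
    using mult_left_mono[OF core_factor o(2)] unfolding sq by (simp add: mult.assoc)
  then have 2: "osc (V (Suc n)) (avg (n - k)) (side p \<sigma> 0 core) (E / 2 ^ n * ((2 * q) ^ k * q))"
    by (rule osc_weaken[OF o2])
  have 3: "osc (V (Suc n)) (avg (n - k)) (side p \<sigma> 0 (rad k)) (E / 2 ^ n * (2 * ((2 * q) ^ k * q)))"
    using side_union[OF assms(3) _ core_le 2 1] core_pos by (simp add: algebra_simps)
  show ?thesis
  proof (cases "k = 0")
    case True
    then show ?thesis using 3 by simp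
  next
    case False
    then have "rad k \<le> q ^ k" by (intro rad_le) auto
    from osc_side_recentre[OF assms(1) _ assms(3) _ 3 this]
    have "osc (V (Suc n)) (avg n) (side p \<sigma> 0 (rad k))
        (E / 2 ^ n * (2 * ((2 * q) ^ k * q)) + E / 2 ^ (n - k) * q ^ k)" by simp
    moreover have "E / 2 ^ n * (2 * ((2 * q) ^ k * q)) + E / 2 ^ (n - k) * q ^ k =
        E / 2 ^ n * (2 * ((2 * q) ^ k * q) + (if k = 0 then 0 else (2 * q) ^ k))"
      unfolding dyadic_scale[OF assms(4)] if_not_P[OF False] by (rule distrib_left[symmetric])
    ultimately show ?thesis by (rule osc_weaken[OF _ eq_refl])
  qed
qed

text \<open>Sum over the scales, from the inside out. On \<open>side p \<sigma> 0 (rad j)\<close> the geometric series stays below twice its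
leading term \<open>(2 q)\<^sup>j\<close>; the outermost annulus contributes \<open>q\<close> and the rest at most \<open>4 q\<close>.\<close>

lemma half_disc_step:
  assumes "settled n" "\<psi>' p = 0" "\<bar>\<sigma>\<bar> = 1"
  shows "osc (V (Suc n)) (avg n) (side p \<sigma> 0 D) (E / 2 ^ n * (5 * q))"
proof -
  \<comment> \<open>\<open>J\<close> is the innermost scale: an orbit can be followed neither beyond \<open>k\<close> steps nor beyond the present time.\<close>
  define J where "J = min (Suc n) k"
  define h where "h = 2 * q"
  have h: "0 < h" "h \<le> 1 / 20" unfolding h_def using q_pos q_le(2) by linarith+
  have e: "0 \<le> E / 2 ^ n" using E_nonneg by simp
  have J: "osc (V (Suc n)) (avg n) (side p \<sigma> 0 (rad J)) (E / 2 ^ n * (2 * h ^ J))" if "1 \<le> J"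
  proof (cases "Suc n \<le> k")
    case True
    then show ?thesis using early_step[OF assms] by (simp add: J_def h_def)
  next
    case False
    then have "J = k" "k \<noteq> 0" "k \<le> n" using that by (auto simp: J_def)
    moreover have "2 * ((2 * q) ^ k * q) + (2 * q) ^ k \<le> 2 * h ^ k"
    proof -
      have "h ^ k * (h + 1) \<le> h ^ k * 2" using h by (intro mult_left_mono) auto
      then show ?thesis by (simp add: h_def algebra_simps)
    qed
    ultimately show ?thesis
      using osc_weaken[OF core_step[OF assms] mult_left_mono[OF _ e]] by simp
  qed
  have desc: "osc (V (Suc n)) (avg n) (side p \<sigma> 0 (rad j)) (E / 2 ^ n * (2 * h ^ j))" if "1 \<le> j" "j \<le> J" for j
    using that(2,1)
  proof (induction j rule: inc_induct)
    case base
    then show ?case using J by simp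
  next
    case (step j)
    have "osc (V (Suc n)) (avg n) (side p \<sigma> (rad (Suc j)) (rad j)) (E / 2 ^ n * (h ^ j * q + h ^ j))"
      using annulus_step[OF assms, of j] step by (simp add: J_def h_def)
    from side_union[OF assms(3) _ rad_Suc_le step.IH this]
    have "osc (V (Suc n)) (avg n) (side p \<sigma> 0 (rad j))
        (E / 2 ^ n * (2 * h ^ Suc j) + E / 2 ^ n * (h ^ j * q + h ^ j))"
      using rad_pos[of "Suc j"] by simp
    moreover have "2 * h ^ Suc j + (h ^ j * q + h ^ j) \<le> 2 * h ^ j"
    proof -
      have "h ^ j * (2 * h + (q + 1)) \<le> h ^ j * 2" using h unfolding h_def by (intro mult_left_mono) (linarith, simp)
      then show ?thesis by (simp add: algebra_simps)
    qed
    then have "E / 2 ^ n * (2 * h ^ Suc j) + E / 2 ^ n * (h ^ j * q + h ^ j) \<le> E / 2 ^ n * (2 * h ^ j)"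
      unfolding distrib_left[symmetric] using e by (intro mult_left_mono)
    ultimately show ?case by (rule osc_weaken)
  qed
  have "osc (V (Suc n)) (avg n) (side p \<sigma> 0 (rad 0)) (E / 2 ^ n * (5 * q))"
  proof (cases "k = 0")
    case True
    have "2 * q \<le> 5 * q" using q_pos by simp
    then show ?thesis
      using osc_weaken[OF core_step[OF assms] mult_left_mono[OF _ e]] True by simp
  next
    case False
    then have "1 \<le> J" by (simp add: J_def)
    have 1: "osc (V (Suc n)) (avg n) (side p \<sigma> (rad 1) (rad 0)) (E / 2 ^ n * q)"
      using annulus_step[OF assms, of 0] False by simp
    have "osc (V (Suc n)) (avg n) (side p \<sigma> 0 (rad 0)) (E / 2 ^ n * (2 * h ^ 1) + E / 2 ^ n * q)"
      using side_union[OF assms(3) _ _ desc[of 1] 1] rad_pos[of 1] rad_Suc_le[of 0] \<open>1 \<le> J\<close> by simp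
    then show ?thesis by (simp add: h_def algebra_simps)
  qed
  then show ?thesis by (simp add: rad_def)
qed

text \<open>A short interval either lies in the disc of radius \<open>D\<close> about one critical point, or it avoids the discs of radius \<open>D/2\<close>
and \<open>|\<psi>'| \<ge> c\<^sub>1\<close> on it.\<close>

lemma pair_step:
  assumes "settled n" "u \<le> v" "v - u \<le> D / 2"
  shows "\<bar>V (Suc n) v - V (Suc n) u - avg n * (v - u)\<bar> \<le> E / 2 ^ n * (10 * q)"
proof (cases "\<exists>y p. y \<in> {u..v} \<and> \<psi>' p = 0 \<and> \<bar>y - p\<bar> < D / 2")
  case True
  then obtain y p where y: "y \<in> {u..v}" "\<psi>' p = 0" "\<bar>y - p\<bar> < D / 2" by blast
  have mem: "x \<in> side p 1 0 D \<union> side p (-1) 0 D" if "\<bar>x - p\<bar> \<le> D" for x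
    using that by (auto simp: side_def)
  have "osc (V (Suc n)) (avg n) (side p 1 0 D \<union> side p (-1) 0 D) (E / 2 ^ n * (5 * q) + E / 2 ^ n * (5 * q))"
    using D by (intro osc_union[where x = p] half_disc_step[OF assms(1) y(2)]) (auto simp: side_def)
  moreover have "\<bar>u - p\<bar> \<le> D" "\<bar>v - p\<bar> \<le> D"
    using y assms(2,3) by (auto simp: abs_if split: if_splits)
  ultimately have "\<bar>V (Suc n) v - V (Suc n) u - avg n * (v - u)\<bar>
      \<le> E / 2 ^ n * (5 * q) + E / 2 ^ n * (5 * q)"
    using mem[of u] mem[of v] unfolding osc_def by blast
  then show ?thesis by (simp add: algebra_simps)
next
  case False
  have e: "0 \<le> E / 2 ^ n" using E_nonneg by simp
  have "osc (V (Suc n)) (avg n) {u..v} (E / 2 ^ n * (1 / (L * c\<^sub>1) + L * M / (L * c\<^sub>1)\<^sup>2))"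
  proof (rule osc_pullback_far[OF continuous_V \<epsilon> V_deriv F_deriv F'_deriv])
    show "osc (V n) (avg n) {F u - A - \<epsilon>..F u + A + \<epsilon>} (E / 2 ^ n)"
      by (rule osc_mono[OF _ subset_UNIV order_refl]) (use assms(1) in \<open>simp add: settled_def\<close>)
    fix x assume x: "x \<in> {u..v}"
    have "A * \<bar>x - u\<bar> \<le> A * 1" using x assms(3) D A_ge by (intro mult_left_mono) auto
    then show "F x \<in> {F u - A..F u + A}" using F_lip[of x u] by auto
    have "c\<^sub>1 \<le> \<bar>\<psi>' x\<bar>"
    proof (rule far)
      fix p assume "\<psi>' p = 0"
      then have "D / 2 \<le> \<bar>x - p\<bar>" using False x by force
      then show "min c D / 2 \<le> \<bar>x - p\<bar>" by linarith
    qed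
    then show "L * c\<^sub>1 \<le> \<bar>L * \<psi>' x\<bar>" using L by (simp add: abs_mult)
    show "\<bar>L * \<psi>'' x\<bar> \<le> L * M" using L M by (simp add: abs_mult)
  qed (use L M(1) c\<^sub>1 assms(3) D e in auto)
  moreover have "1 / (L * c\<^sub>1) + L * M / (L * c\<^sub>1)\<^sup>2 = \<kappa>"
    using L c\<^sub>1 by (simp add: \<kappa>_def field_simps power2_eq_square)
  ultimately have "osc (V (Suc n)) (avg n) {u..v} (E / 2 ^ n * \<kappa>)" by metis
  then have "\<bar>V (Suc n) v - V (Suc n) u - avg n * (v - u)\<bar> \<le> E / 2 ^ n * \<kappa>"
    using assms(2) unfolding osc_def by simp
  also have "\<dots> \<le> E / 2 ^ n * (10 * q)"
    using \<kappa>_le_q q_pos e by (intro mult_left_mono) auto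
  finally show ?thesis .
qed

lemma unit_step:
  assumes "settled n" "u \<le> v" "v - u \<le> 1"
  shows "\<bar>V (Suc n) v - V (Suc n) u - avg n * (v - u)\<bar> \<le> E / 2 ^ Suc n / 2"
proof -
  have sub: "\<bar>V (Suc n) v - V (Suc n) u - avg n * (v - u)\<bar> \<le> j * (E / 2 ^ n * (10 * q))"
    if "u \<le> v" "v - u \<le> j * (D / 2)" for j :: nat and v
    using that
  proof (induction j arbitrary: v)
    case (Suc j)
    \<comment> \<open>Cut off a piece of length \<open>D/2\<close> at the right end, or everything if less is left.\<close>
    define w where "w = max u (v - D / 2)"
    have w: "u \<le> w" "w \<le> v" "v - w \<le> D / 2" "w - u \<le> j * (D / 2)"
      using Suc.prems D by (auto simp: w_def distrib_right max_def)
    have "\<bar>V (Suc n) w - V (Suc n) u - avg n * (w - u)\<bar> \<le> j * (E / 2 ^ n * (10 * q))"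
      by (rule Suc.IH[OF w(1,4)])
    moreover have "\<bar>V (Suc n) v - V (Suc n) w - avg n * (v - w)\<bar> \<le> E / 2 ^ n * (10 * q)"
      by (rule pair_step[OF assms(1) w(2,3)])
    moreover have "V (Suc n) v - V (Suc n) u - avg n * (v - u) =
        (V (Suc n) w - V (Suc n) u - avg n * (w - u)) + (V (Suc n) v - V (Suc n) w - avg n * (v - w))"
      by (simp add: algebra_simps)
    moreover have "real (Suc j) * (E / 2 ^ n * (10 * q)) =
        real j * (E / 2 ^ n * (10 * q)) + E / 2 ^ n * (10 * q)"
      by (simp only: of_nat_Suc distrib_right mult_1_left add.commute)
    ultimately show ?case by linarith
  qed simp
  have "\<bar>V (Suc n) v - V (Suc n) u - avg n * (v - u)\<bar> \<le> N * (E / 2 ^ n * (10 * q))"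
    by (rule sub) (use assms N(2) in auto)
  also have "\<dots> = (E / 2 ^ Suc n / 2) * (40 * N * q)" by simp
  also have "\<dots> \<le> (E / 2 ^ Suc n / 2) * 1"
    using q_le(1) E_nonneg by (intro mult_left_mono) auto
  finally show ?thesis by simp
qed

lemma V_shift_int: "V l (x + of_int j) = V l x + avg l * of_int j"
proof (induction j rule: int_induct[where k = 0])
  case (step1 i)
  have "V l (x + of_int (i + 1)) = V l ((x + of_int i) + 1)" by (simp add: add.assoc)
  also have "\<dots> = V l (x + of_int i) + avg l" by (rule V_shift)
  finally show ?case using step1 by (simp add: algebra_simps)
next
  case (step2 i)
  have "V l (x + of_int i) = V l ((x + of_int (i - 1)) + 1)" by (simp add: algebra_simps)
  also have "\<dots> = V l (x + of_int (i - 1)) + avg l" by (rule V_shift)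
  finally show ?case using step2 by (simp add: algebra_simps)
qed simp

text \<open>The mean \<open>avg (Suc n)\<close> is itself the integral of \<open>\<phi>\<close> over a unit interval, so \<open>unit_step\<close> also bounds its change. The
deviation from the mean has integral zero over a period, so intervals of any length reduce to those of length at most 1.\<close>

lemma settled_Suc:
  assumes "settled n" shows "settled (Suc n)"
proof -
  define e where "e = E / 2 ^ Suc n"
  have av: "\<bar>avg (Suc n) - avg n\<bar> \<le> e / 2"
    using unit_step[OF assms, of 0 1] by (simp add: avg_def e_def)
  have "osc (V (Suc n)) (avg (Suc n)) UNIV e"
    unfolding osc_def
  proof (intro ballI)
    fix u v :: real
    \<comment> \<open>Translate \<open>v\<close> by an integer to within one period to the right of \<open>u\<close>.\<close>
    define j where "j = \<lfloor>v - u\<rfloor>"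
    define w where "w = v - of_int j"
    have w: "u \<le> w" "w - u \<le> 1" by (simp_all add: w_def j_def, linarith+)
    have "\<bar>V (Suc n) w - V (Suc n) u - avg n * (w - u)\<bar> \<le> e / 2"
      using unit_step[OF assms w] by (simp add: e_def)
    moreover have "\<bar>(avg n - avg (Suc n)) * (w - u)\<bar> \<le> e / 2 * 1"
      unfolding abs_mult using av w by (intro mult_mono) linarith+
    moreover have "V (Suc n) v = V (Suc n) w + avg (Suc n) * of_int j"
      using V_shift_int[of "Suc n" w j] by (simp add: w_def)
    then have "V (Suc n) v - V (Suc n) u - avg (Suc n) * (v - u) =
        (V (Suc n) w - V (Suc n) u - avg n * (w - u)) + (avg n - avg (Suc n)) * (w - u)"
      by (simp add: w_def algebra_simps)
    ultimately show "\<bar>V (Suc n) v - V (Suc n) u - avg (Suc n) * (v - u)\<bar> \<le> e" by linarith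
  qed
  moreover have "0 \<le> e" using E_nonneg by (simp add: e_def)
  ultimately show ?thesis
    using assms av unfolding settled_def e_def by (auto simp: le_Suc_eq less_Suc_eq)
qed

lemma settled: "settled n"
proof (induction n)
  case 0
  show ?case using B_osc by (simp add: settled_def avg_def)
qed (rule settled_Suc)

theorem avg_convergent:
  obtains m where "\<And>l. \<bar>avg l - m\<bar> \<le> E / 2 ^ l"
proof -
  have d: "\<bar>avg i - avg n\<bar> \<le> E / 2 ^ i" if "i \<le> n" for i n
    by (rule settled_drift[OF settled that])
  have "Cauchy avg"
  proof (rule metric_CauchyI)
    fix e :: real assume "0 < e"
    have "(\<lambda>i. E * (1 / 2) ^ i) \<longlonglongrightarrow> E * 0"
      by (intro tendsto_mult tendsto_const LIMSEQ_power_zero) simp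
    then have "\<forall>\<^sub>F i in sequentially. E * (1 / 2) ^ i < e / 2"
      using \<open>0 < e\<close> by (intro order_tendstoD) auto
    then obtain i where "E * (1 / 2) ^ i < e / 2" by (auto simp: eventually_sequentially)
    then have i: "E / 2 ^ i < e / 2" by (simp add: power_one_over)
    have "dist (avg n) (avg n') < e" if "i \<le> n" "i \<le> n'" for n n'
      using d[OF that(1)] d[OF that(2)] i unfolding dist_real_def by linarith
    then show "\<exists>M. \<forall>m\<ge>M. \<forall>n\<ge>M. dist (avg m) (avg n) < e" by blast
  qed
  then obtain m where m: "avg \<longlonglongrightarrow> m" using Cauchy_convergent convergentD by blast
  have "\<bar>avg l - m\<bar> \<le> E / 2 ^ l" for l
  proof (rule LIMSEQ_le_const2)
    show "(\<lambda>n. \<bar>avg l - avg n\<bar>) \<longlonglongrightarrow> \<bar>avg l - m\<bar>"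
      by (intro tendsto_intros m)
  qed (use d in blast)
  then show ?thesis by (rule that)
qed

lemma window_V_near_avg: "\<bar>window \<epsilon> (V l) x - avg l\<bar> \<le> E / 2 ^ l / (2 * \<epsilon>)"
proof -
  have "osc (V l) (avg l) UNIV (E / 2 ^ l)" using settled[of l] by (simp add: settled_def)
  from window_near_mean[OF \<epsilon> osc_mono[OF this subset_UNIV order_refl]] show ?thesis .
qed

end

section \<open>Random orbits and a strong law of large numbers\<close>

fun orbit :: "(real \<Rightarrow> real) \<Rightarrow> (nat \<Rightarrow> real) \<Rightarrow> nat \<Rightarrow> real \<Rightarrow> real" where
  "orbit F \<omega> 0 x = x"
| "orbit F \<omega> (Suc n) x = F (orbit F \<omega> n x + \<omega> n)"

definition birkhoff :: "(real \<Rightarrow> real) \<Rightarrow> (real \<Rightarrow> real) \<Rightarrow> (nat \<Rightarrow> real) \<Rightarrow> nat \<Rightarrow> real \<Rightarrow> real" where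
  "birkhoff F g \<omega> n x = (\<Sum>i<n. g (orbit F \<omega> i x + \<omega> i))"

text \<open>The Markov property: the orbit from \<open>x\<close> under noise starting with \<open>s\<close> is, from time 1 on, the orbit from \<open>F (x + s)\<close>
under the shifted noise. All expectations below are computed by conditioning on the first step.\<close>

lemma orbit_case_nat: "orbit F (case_nat s \<omega>) (Suc n) x = orbit F \<omega> n (F (x + s))"
  by (induction n) auto

lemma birkhoff_case_nat:
  "birkhoff F g (case_nat s \<omega>) (Suc n) x = g (x + s) + birkhoff F g \<omega> n (F (x + s))"
  unfolding birkhoff_def sum.lessThan_Suc_shift
  by (simp only: orbit_case_nat orbit.simps(1) nat.case)

lemma measurable_orbit:
  assumes F: "F \<in> borel_measurable borel" and W: "\<And>i. (\<lambda>p. W p i) \<in> borel_measurable N"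
    and X: "X \<in> borel_measurable N"
  shows "(\<lambda>p. orbit F (W p) n (X p)) \<in> borel_measurable N"
proof (induction n)
  case (Suc n)
  then have "(\<lambda>p. orbit F (W p) n (X p) + W p n) \<in> borel_measurable N"
    using W by (intro borel_measurable_add)
  from measurable_compose[OF this F] show ?case by simp
qed (use X in simp)

lemma measurable_birkhoff:
  assumes F: "F \<in> borel_measurable borel" and g: "g \<in> borel_measurable borel"
    and W: "\<And>i. (\<lambda>p. W p i) \<in> borel_measurable N" and X: "X \<in> borel_measurable N"
  shows "(\<lambda>p. birkhoff F g (W p) n (X p)) \<in> borel_measurable N"
  unfolding birkhoff_def
  by (intro borel_measurable_sum measurable_compose[OF _ g] borel_measurable_add
      measurable_orbit[OF F W X] W)

context sequence_space
begin

lemma measurable_case_nat_pair: "(\<lambda>(s, \<omega>). case_nat s \<omega>) \<in> measurable (M \<Otimes>\<^sub>M S) S"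
  by (auto intro!: measurable_PiM_single' simp: split_beta' space_PiM PiE_iff space_pair_measure
      split: nat.split)

lemma nn_integral_first_step:
  assumes [measurable]: "f \<in> borel_measurable S"
  shows "(\<integral>\<^sup>+\<omega>. f \<omega> \<partial>S) = (\<integral>\<^sup>+s. \<integral>\<^sup>+\<omega>. f (case_nat s \<omega>) \<partial>S \<partial>M)"
proof -
  note measurable_case_nat_pair[measurable]
  have "(\<integral>\<^sup>+\<omega>. f \<omega> \<partial>S) = (\<integral>\<^sup>+\<omega>. f \<omega> \<partial>distr (M \<Otimes>\<^sub>M S) S (\<lambda>(s, \<omega>). case_nat s \<omega>))"
    by (simp only: PiM_iter)
  also have "\<dots> = (\<integral>\<^sup>+p. f (case p of (s, \<omega>) \<Rightarrow> case_nat s \<omega>) \<partial>(M \<Otimes>\<^sub>M S))"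
    by (rule nn_integral_distr) measurable
  also have "\<dots> = (\<integral>\<^sup>+s. \<integral>\<^sup>+\<omega>. f (case_nat s \<omega>) \<partial>S \<partial>M)"
    by (subst P.nn_integral_fst[symmetric]) (auto simp: split_beta')
  finally show ?thesis .
qed

lemma integral_first_step:
  fixes f :: "_ \<Rightarrow> real"
  assumes f: "integrable S f"
  shows "(\<integral>\<omega>. f \<omega> \<partial>S) = (\<integral>s. \<integral>\<omega>. f (case_nat s \<omega>) \<partial>S \<partial>M)"
proof -
  note m = measurable_case_nat_pair
  interpret pair_sigma_finite M S ..
  have "integrable (distr (M \<Otimes>\<^sub>M S) S (\<lambda>(s, \<omega>). case_nat s \<omega>)) f"
    using f by (simp only: PiM_iter)
  then have i: "integrable (M \<Otimes>\<^sub>M S) (\<lambda>p. f (case p of (s, \<omega>) \<Rightarrow> case_nat s \<omega>))"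
    by (rule integrable_distr[OF m])
  have "(\<integral>\<omega>. f \<omega> \<partial>S) = (\<integral>\<omega>. f \<omega> \<partial>distr (M \<Otimes>\<^sub>M S) S (\<lambda>(s, \<omega>). case_nat s \<omega>))"
    by (simp only: PiM_iter)
  also have "\<dots> = (\<integral>p. f (case p of (s, \<omega>) \<Rightarrow> case_nat s \<omega>) \<partial>(M \<Otimes>\<^sub>M S))"
    by (rule integral_distr[OF m]) (use f in auto)
  also have "\<dots> = (\<integral>s. \<integral>\<omega>. f (case_nat s \<omega>) \<partial>S \<partial>M)"
    using integral_fst'[OF i] by simp
  finally show ?thesis .
qed

end

text \<open>\<open>h\<close> is a centred observable and \<open>v n x\<close> its expectation at time \<open>n\<close> for orbits that start at \<open>x\<close>. Exponential
mixing enters only through \<open>v_sum\<close>: the expectations of the Birkhoff sums are bounded.\<close>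

locale noisy_observable = sequence_space U for U :: "real measure" +
  fixes F h :: "real \<Rightarrow> real" and v :: "nat \<Rightarrow> real \<Rightarrow> real" and C C\<^sub>2 :: real
  assumes sets_U: "sets U = sets borel"
    and F[measurable]: "F \<in> borel_measurable borel" and h[measurable]: "h \<in> borel_measurable borel"
    and square: "(\<integral>\<^sup>+s. ennreal ((h (x + s))\<^sup>2) \<partial>U) \<le> ennreal C\<^sub>2" and C\<^sub>2: "0 \<le> C\<^sub>2"
    and v_0: "v 0 x = (\<integral>s. h (x + s) \<partial>U)"
    and v_Suc: "v (Suc n) x = (\<integral>s. v n (F (x + s)) \<partial>U)"
    and v_integrable: "integrable U (\<lambda>s. v n (F (x + s)))"
    and v_sum: "\<bar>\<Sum>i<n. v i x\<bar> \<le> C"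
begin

abbreviation "Sn \<omega> n x \<equiv> birkhoff F h \<omega> n x"

lemma coordinate_measurable: "(\<lambda>\<omega>. \<omega> i) \<in> borel_measurable S"
  using measurable_component_singleton[of i UNIV "\<lambda>_. U"] by (simp add: measurable_cong_sets[OF refl sets_U])

lemma Sn_measurable[measurable]: "(\<lambda>\<omega>. Sn \<omega> n x) \<in> borel_measurable S"
  by (rule measurable_birkhoff[OF F h coordinate_measurable]) simp

lemma U_measurable: "f \<in> borel_measurable borel \<Longrightarrow> f \<in> borel_measurable U"
  by (simp add: measurable_cong_sets[OF sets_U refl])

lemma h_shift_measurable: "(\<lambda>s. h (x + s)) \<in> borel_measurable U"
  by (rule U_measurable) measurable

lemma C_nonneg: "0 \<le> C" using v_sum[of 0 0] by simp

lemma h_square_integrable: "integrable U (\<lambda>s. (h (x + s))\<^sup>2)"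
proof (rule integrableI_nonneg)
  show "(\<lambda>s. (h (x + s))\<^sup>2) \<in> borel_measurable U"
    using h_shift_measurable by simp
  show "(\<integral>\<^sup>+s. ennreal ((h (x + s))\<^sup>2) \<partial>U) < \<infinity>"
    using square[of x] by (simp add: order.strict_trans1)
qed simp

lemma h_integrable: "integrable U (\<lambda>s. h (x + s))"
  by (rule M.square_integrable_imp_integrable[OF h_shift_measurable h_square_integrable])

text \<open>Conditioning on the first step, the square of a Birkhoff sum of length \<open>n + 1\<close> is \<open>(h + S\<^sub>n)\<^sup>2\<close>. The mixed term has
expectation \<open>2 h E(S\<^sub>n)\<close>, at most \<open>2 |h| C\<close>, so each step adds a bounded amount to the second moment. The claim about
the mean is needed for this term.\<close>

lemma moments:
  "integrable S (\<lambda>\<omega>. (Sn \<omega> n x)\<^sup>2) \<and> (\<integral>\<omega>. Sn \<omega> n x \<partial>S) = (\<Sum>i<n. v i x) \<and>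
    (\<integral>\<omega>. (Sn \<omega> n x)\<^sup>2 \<partial>S) \<le> n * ((1 + C) * C\<^sub>2 + C)"
proof (induction n arbitrary: x)
  case 0
  show ?case by (simp add: birkhoff_def)
next
  case (Suc n)
  let ?C3 = "(1 + C) * C\<^sub>2 + C"
  have sq: "integrable S (\<lambda>\<omega>. (Sn \<omega> n y)\<^sup>2)" for y using Suc by blast
  then have i: "integrable S (\<lambda>\<omega>. Sn \<omega> n y)" for y
    by (rule P.square_integrable_imp_integrable[OF Sn_measurable])
  have inner: "(\<integral>\<^sup>+\<omega>. ennreal ((h (x + s) + Sn \<omega> n (F (x + s)))\<^sup>2) \<partial>S)
      \<le> ennreal (1 + C) * ennreal ((h (x + s))\<^sup>2) + ennreal (C + n * ?C3)" for s
  proof -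
    define b where "b = h (x + s)"
    define y where "y = F (x + s)"
    have int: "integrable S (\<lambda>\<omega>. b\<^sup>2 + 2 * b * Sn \<omega> n y + (Sn \<omega> n y)\<^sup>2)"
      using i sq by auto
    have "(\<integral>\<^sup>+\<omega>. ennreal ((b + Sn \<omega> n y)\<^sup>2) \<partial>S) =
        (\<integral>\<^sup>+\<omega>. ennreal (b\<^sup>2 + 2 * b * Sn \<omega> n y + (Sn \<omega> n y)\<^sup>2) \<partial>S)"
      by (simp add: power2_sum algebra_simps)
    also have "\<dots> = ennreal (\<integral>\<omega>. b\<^sup>2 + 2 * b * Sn \<omega> n y + (Sn \<omega> n y)\<^sup>2 \<partial>S)"
    proof (rule nn_integral_eq_integral[OF int], rule AE_I2)
      fix \<omega>
      have "0 \<le> (b + Sn \<omega> n y)\<^sup>2" by simp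
      then show "0 \<le> b\<^sup>2 + 2 * b * Sn \<omega> n y + (Sn \<omega> n y)\<^sup>2" by (simp add: power2_sum algebra_simps)
    qed
    finally have e1: "(\<integral>\<^sup>+\<omega>. ennreal ((b + Sn \<omega> n y)\<^sup>2) \<partial>S) =
        ennreal (\<integral>\<omega>. b\<^sup>2 + 2 * b * Sn \<omega> n y + (Sn \<omega> n y)\<^sup>2 \<partial>S)" .
    have "(\<integral>\<omega>. b\<^sup>2 + 2 * b * Sn \<omega> n y + (Sn \<omega> n y)\<^sup>2 \<partial>S) =
        b\<^sup>2 + 2 * b * (\<Sum>i<n. v i y) + (\<integral>\<omega>. (Sn \<omega> n y)\<^sup>2 \<partial>S)"
      using i sq Suc[of y] by (simp add: P.prob_space)
    also have "\<dots> \<le> b\<^sup>2 + (1 + b\<^sup>2) * C + n * ?C3"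
    proof -
      \<comment> \<open>\<open>2 |b| \<le> 1 + b\<^sup>2\<close> leaves the second moment of \<open>h\<close> as the only moment that has to be bounded.\<close>
      have "2 * b * (\<Sum>i<n. v i y) \<le> \<bar>2 * b\<bar> * \<bar>\<Sum>i<n. v i y\<bar>"
        by (metis abs_ge_self abs_mult)
      also have "\<dots> \<le> (1 + b\<^sup>2) * C"
      proof (intro mult_mono v_sum)
        have "0 \<le> (\<bar>b\<bar> - 1)\<^sup>2" by simp
        then show "\<bar>2 * b\<bar> \<le> 1 + b\<^sup>2" by (simp add: power2_diff abs_mult)
      qed auto
      finally show ?thesis using Suc[of y] by simp
    qed
    also have "b\<^sup>2 + (1 + b\<^sup>2) * C + n * ?C3 = (1 + C) * b\<^sup>2 + (C + n * ?C3)"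
      by (simp add: algebra_simps)
    finally have "ennreal (\<integral>\<omega>. b\<^sup>2 + 2 * b * Sn \<omega> n y + (Sn \<omega> n y)\<^sup>2 \<partial>S)
        \<le> ennreal ((1 + C) * b\<^sup>2 + (C + n * ?C3))" by (rule ennreal_leI)
    also have "\<dots> = ennreal (1 + C) * ennreal (b\<^sup>2) + ennreal (C + n * ?C3)"
      using C_nonneg C\<^sub>2 by (simp add: ennreal_plus ennreal_mult)
    finally show ?thesis unfolding e1[symmetric] by (simp only: b_def y_def)
  qed
  have "(\<integral>\<^sup>+\<omega>. ennreal ((Sn \<omega> (Suc n) x)\<^sup>2) \<partial>S) =
      (\<integral>\<^sup>+s. \<integral>\<^sup>+\<omega>. ennreal ((h (x + s) + Sn \<omega> n (F (x + s)))\<^sup>2) \<partial>S \<partial>U)"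
    by (subst nn_integral_first_step) (auto simp: birkhoff_case_nat simp del: sum.lessThan_Suc)
  also have "\<dots> \<le> (\<integral>\<^sup>+s. ennreal (1 + C) * ennreal ((h (x + s))\<^sup>2) + ennreal (C + n * ?C3) \<partial>U)"
    by (rule nn_integral_mono) (rule inner)
  also have "\<dots> = ennreal (1 + C) * (\<integral>\<^sup>+s. ennreal ((h (x + s))\<^sup>2) \<partial>U) + ennreal (C + n * ?C3)"
    using h_shift_measurable by (simp add: nn_integral_add nn_integral_cmult M.emeasure_space_1)
  also have "\<dots> \<le> ennreal (1 + C) * ennreal C\<^sub>2 + ennreal (C + n * ?C3)"
    by (intro add_right_mono mult_left_mono square) simp
  also have "\<dots> = ennreal (Suc n * ?C3)"
    using C_nonneg C\<^sub>2 by (simp add: algebra_simps flip: ennreal_mult ennreal_plus)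
  finally have bound: "(\<integral>\<^sup>+\<omega>. ennreal ((Sn \<omega> (Suc n) x)\<^sup>2) \<partial>S) \<le> ennreal (Suc n * ?C3)" .
  have sq': "integrable S (\<lambda>\<omega>. (Sn \<omega> (Suc n) x)\<^sup>2)"
    by (rule integrableI_nonneg) (use bound in \<open>auto simp: order.strict_trans1\<close>)
  then have i': "integrable S (\<lambda>\<omega>. Sn \<omega> (Suc n) x)"
    by (rule P.square_integrable_imp_integrable[OF Sn_measurable])
  have "(\<integral>\<omega>. Sn \<omega> (Suc n) x \<partial>S) = (\<integral>s. \<integral>\<omega>. h (x + s) + Sn \<omega> n (F (x + s)) \<partial>S \<partial>U)"
    by (subst integral_first_step[OF i']) (simp only: birkhoff_case_nat)
  also have "\<dots> = (\<integral>s. h (x + s) + (\<Sum>i<n. v i (F (x + s))) \<partial>U)"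
    using i Suc by (simp add: P.prob_space)
  also have "\<dots> = v 0 x + (\<Sum>i<n. v (Suc i) x)"
    using h_integrable v_integrable by (simp add: v_0 v_Suc)
  also have "\<dots> = (\<Sum>i<Suc n. v i x)" by (simp only: sum.lessThan_Suc_shift)
  finally have mean: "(\<integral>\<omega>. Sn \<omega> (Suc n) x \<partial>S) = (\<Sum>i<Suc n. v i x)" .
  have "ennreal (\<integral>\<omega>. (Sn \<omega> (Suc n) x)\<^sup>2 \<partial>S) \<le> ennreal (Suc n * ?C3)"
    using bound by (subst nn_integral_eq_integral[OF sq', symmetric]) auto
  then have "(\<integral>\<omega>. (Sn \<omega> (Suc n) x)\<^sup>2 \<partial>S) \<le> Suc n * ?C3"
    using C_nonneg C\<^sub>2 by (subst (asm) ennreal_le_iff) (auto simp del: of_nat_Suc)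
  then show ?case using sq' mean by blast
qed


text \<open>Along the squares the second moments of the averages are summable, so their sum is almost surely finite and its terms tend to 0.\<close>

lemma AE_squares:
  "AE \<omega> in S. (\<lambda>m. Sn \<omega> ((Suc m)\<^sup>2) x / (Suc m)\<^sup>2) \<longlonglongrightarrow> 0"
proof -
  let ?C3 = "(1 + C) * C\<^sub>2 + C"
  define Z where "Z m \<omega> = (Sn \<omega> ((Suc m)\<^sup>2) x / (Suc m)\<^sup>2)\<^sup>2" for m \<omega>
  have Z[measurable]: "Z m \<in> borel_measurable S" for m
    unfolding Z_def by measurable
  have "(\<integral>\<^sup>+\<omega>. ennreal (Z m \<omega>) \<partial>S) \<le> ennreal (?C3 * inverse (real (Suc m) ^ 2))" for m
  proof -
    define N where "N = (Suc m)\<^sup>2"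
    have N: "0 < real N" by (simp add: N_def)
    have int: "integrable S (\<lambda>\<omega>. (Sn \<omega> N x)\<^sup>2)" and le: "(\<integral>\<omega>. (Sn \<omega> N x)\<^sup>2 \<partial>S) \<le> N * ?C3"
      using moments by blast+
    have eq: "Z m = (\<lambda>\<omega>. (Sn \<omega> N x)\<^sup>2 / (real N)\<^sup>2)"
      by (simp add: Z_def N_def power_divide fun_eq_iff)
    have "(\<integral>\<^sup>+\<omega>. ennreal (Z m \<omega>) \<partial>S) = ennreal (\<integral>\<omega>. (Sn \<omega> N x)\<^sup>2 / (real N)\<^sup>2 \<partial>S)"
      unfolding eq using int by (intro nn_integral_eq_integral) auto
    also have "(\<integral>\<omega>. (Sn \<omega> N x)\<^sup>2 / (real N)\<^sup>2 \<partial>S) \<le> (N * ?C3) / (real N)\<^sup>2"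
      using le by (simp add: divide_right_mono)
    then have "ennreal (\<integral>\<omega>. (Sn \<omega> N x)\<^sup>2 / (real N)\<^sup>2 \<partial>S) \<le> ennreal (?C3 * inverse (real N))"
      using N by (intro ennreal_leI) (simp add: power2_eq_square field_simps)
    finally show ?thesis by (simp add: N_def)
  qed
  then have "(\<integral>\<^sup>+\<omega>. (\<Sum>m. ennreal (Z m \<omega>)) \<partial>S) \<le> (\<Sum>m. ennreal (?C3 * inverse (real (Suc m) ^ 2)))"
    by (subst nn_integral_suminf) (auto intro!: suminf_le)
  also have "\<dots> < \<infinity>"
  proof -
    have "summable (\<lambda>m. inverse (real m ^ 2))" by (rule inverse_power_summable) simp
    then have "summable (\<lambda>m. inverse (real (Suc m) ^ 2))" by (subst summable_Suc_iff)
    then have "summable (\<lambda>m. ?C3 * inverse (real (Suc m) ^ 2))" by (rule summable_mult)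
    then show ?thesis
      using C_nonneg C\<^sub>2 by (simp add: ennreal_suminf_neq_top less_top)
  qed
  finally have "AE \<omega> in S. (\<Sum>m. ennreal (Z m \<omega>)) \<noteq> \<infinity>"
    by (intro nn_integral_PInf_AE) auto
  then show ?thesis
  proof eventually_elim
    case (elim \<omega>)
    then have "summable (\<lambda>m. Z m \<omega>)"
      by (intro summable_suminf_not_top) (auto simp: Z_def)
    then have "(\<lambda>m. (Sn \<omega> ((Suc m)\<^sup>2) x / (Suc m)\<^sup>2)\<^sup>2) \<longlonglongrightarrow> 0"
      unfolding Z_def by (rule summable_LIMSEQ_zero)
    from tendsto_real_sqrt[OF this]
    have "(\<lambda>m. \<bar>Sn \<omega> ((Suc m)\<^sup>2) x / (Suc m)\<^sup>2\<bar>) \<longlonglongrightarrow> 0"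
      by (simp only: real_sqrt_abs real_sqrt_zero)
    then show ?case by (simp only: tendsto_rabs_zero_iff)
  qed
qed

end

text \<open>Between consecutive squares, monotonicity squeezes \<open>T n / n\<close> between the averages at these squares, up to the quotient of the squares,
which tends to 1.\<close>

lemma tendsto_average_of_squares:
  fixes T :: "nat \<Rightarrow> real"
  assumes mono: "\<And>n. T n \<le> T (Suc n)" and "T 0 = 0"
    and sq: "(\<lambda>m. T ((Suc m)\<^sup>2) / (Suc m)\<^sup>2) \<longlonglongrightarrow> t"
  shows "(\<lambda>n. T n / n) \<longlonglongrightarrow> t"
proof -
  have mono': "T i \<le> T j" if "i \<le> j" for i j using lift_Suc_mono_le[of T i j] mono that by blast
  then have nonneg: "0 \<le> T n" for n using mono'[of 0 n] assms(2) by simp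
  define S where "S m = T (m\<^sup>2) / m\<^sup>2" for m :: nat
  have S: "S \<longlonglongrightarrow> t"
    by (rule LIMSEQ_imp_Suc) (use sq in \<open>simp add: S_def\<close>)
  have S': "(\<lambda>m. S (Suc m)) \<longlonglongrightarrow> t" using S by (rule LIMSEQ_Suc)
  define r where "r n = nat \<lfloor>sqrt (real n)\<rfloor>" for n :: nat
  have r_lim: "filterlim r at_top sequentially"
    unfolding r_def
    by (intro filterlim_compose[OF filterlim_nat_sequentially] filterlim_compose[OF filterlim_floor_sequentially]
      filterlim_compose[OF sqrt_at_top] filterlim_real_sequentially)
  \<comment> \<open>\<open>r n\<close> is the integer square root of \<open>n\<close>.\<close>
  have rr: "(real (r n))\<^sup>2 \<le> real n" "real n \<le> (real (r n) + 1)\<^sup>2" for n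
  proof -
    have "real (r n) \<le> sqrt n" "sqrt n \<le> real (r n) + 1" by (auto simp: r_def)
    then have "(real (r n))\<^sup>2 \<le> (sqrt n)\<^sup>2" "(sqrt n)\<^sup>2 \<le> (real (r n) + 1)\<^sup>2"
      by (simp_all only: power_mono of_nat_0_le_iff real_sqrt_ge_zero)
    then show "(real (r n))\<^sup>2 \<le> real n" "real n \<le> (real (r n) + 1)\<^sup>2" by simp_all
  qed
  have r: "(r n)\<^sup>2 \<le> n" "n \<le> (Suc (r n))\<^sup>2" for n
  proof -
    have "real ((r n)\<^sup>2) \<le> real n" "real n \<le> real ((Suc (r n))\<^sup>2)"
      using rr[of n] by (simp_all add: add.commute)
    then show "(r n)\<^sup>2 \<le> n" "n \<le> (Suc (r n))\<^sup>2" by (simp_all only: of_nat_le_iff)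
  qed
  have "(\<lambda>m::nat. (m / (m + 1))\<^sup>2) \<longlonglongrightarrow> 1" by real_asymp
  from tendsto_mult[OF S this] have low: "(\<lambda>m. S m * (m / (m + 1))\<^sup>2) \<longlonglongrightarrow> t" by simp
  have "(\<lambda>m::nat. ((m + 1) / m)\<^sup>2) \<longlonglongrightarrow> 1" by real_asymp
  from tendsto_mult[OF S' this] have up: "(\<lambda>m. S (Suc m) * ((m + 1) / m)\<^sup>2) \<longlonglongrightarrow> t" by simp
  have ev: "\<forall>\<^sub>F n in sequentially. 0 < r n"
    by (rule eventually_compose_filterlim[OF eventually_gt_at_top r_lim])
  show ?thesis
  proof (rule tendsto_sandwich)
    show "(\<lambda>n. S (r n) * (r n / (r n + 1))\<^sup>2) \<longlonglongrightarrow> t" by (rule filterlim_compose[OF low r_lim])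
    show "(\<lambda>n. S (Suc (r n)) * ((r n + 1) / r n)\<^sup>2) \<longlonglongrightarrow> t" by (rule filterlim_compose[OF up r_lim])
    show "\<forall>\<^sub>F n in sequentially. S (r n) * (r n / (r n + 1))\<^sup>2 \<le> T n / n"
      using ev
    proof eventually_elim
      case (elim n)
      have n: "0 < n" "real n \<le> (real (r n) + 1)\<^sup>2"
        using r(1)[of n] rr(2)[of n] elim by (auto intro: gr0I)
      have "S (r n) * (r n / (r n + 1))\<^sup>2 = T ((r n)\<^sup>2) / (real (r n) + 1)\<^sup>2"
        using elim by (simp add: S_def power_divide)
      also have "\<dots> \<le> T n / n"
        using n nonneg mono'[OF r(1)] by (intro frac_le) auto
      finally show ?case .
    qed
    show "\<forall>\<^sub>F n in sequentially. T n / n \<le> S (Suc (r n)) * ((r n + 1) / r n)\<^sup>2"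
      using ev
    proof eventually_elim
      case (elim n)
      have "T n / n \<le> T ((Suc (r n))\<^sup>2) / (real (r n))\<^sup>2"
        using rr(1)[of n] nonneg mono'[OF r(2)] elim by (intro frac_le) auto
      also have "\<dots> = S (Suc (r n)) * ((r n + 1) / r n)\<^sup>2"
        using elim by (simp add: S_def power_divide add.commute)
      finally show ?case .
    qed
  qed
qed

context noisy_observable
begin

text \<open>Subtracting the sums from those of the constant \<open>b\<close> makes them monotone, which fills the gaps between the squares.\<close>

theorem strong_law:
  assumes "\<And>y. h y \<le> b"
  shows "AE \<omega> in S. (\<lambda>n. Sn \<omega> n x / n) \<longlonglongrightarrow> 0"
  using AE_squares[of x]
proof eventually_elim
  case (elim \<omega>)
  define T where "T n = b * real n - Sn \<omega> n x" for n
  have "(\<lambda>m. b - Sn \<omega> ((Suc m)\<^sup>2) x / (Suc m)\<^sup>2) \<longlonglongrightarrow> b - 0"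
    by (intro tendsto_intros elim)
  moreover have "T ((Suc m)\<^sup>2) / (Suc m)\<^sup>2 = b - Sn \<omega> ((Suc m)\<^sup>2) x / (Suc m)\<^sup>2" for m
    by (simp add: T_def diff_divide_distrib)
  ultimately have "(\<lambda>m. T ((Suc m)\<^sup>2) / (Suc m)\<^sup>2) \<longlonglongrightarrow> b" by simp
  moreover have "T n \<le> T (Suc n)" for n
    using assms by (simp add: T_def birkhoff_def algebra_simps)
  moreover have "T 0 = 0" by (simp add: T_def birkhoff_def)
  ultimately have "(\<lambda>n. T n / n) \<longlonglongrightarrow> b" by (intro tendsto_average_of_squares)
  then have "(\<lambda>n. b - T n / n) \<longlonglongrightarrow> b - b" by (intro tendsto_intros)
  moreover have "\<forall>\<^sub>F n in sequentially. b - T n / n = Sn \<omega> n x / n"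
    using eventually_gt_at_top[of 0] by eventually_elim (simp add: T_def diff_divide_distrib)
  ultimately show ?case by (simp add: tendsto_cong)
qed

end

section \<open>Square integrability of the logarithm\<close>

lemma nonneg_set_integrable:
  fixes f :: "real \<Rightarrow> real"
  assumes "(f has_integral I) {a..b}" and "\<And>x. x \<in> {a..b} \<Longrightarrow> 0 \<le> f x"
    and f: "f \<in> borel_measurable borel"
  shows "set_integrable lborel {a..b} f"
proof -
  have "f absolutely_integrable_on {a..b}"
    using assms by (intro nonnegative_absolutely_integrable_1) (auto simp: integrable_on_def)
  moreover have "(\<lambda>x. indicator {a..b} x *\<^sub>R f x) \<in> borel_measurable lborel"
    using f by simp
  ultimately show ?thesis unfolding set_integrable_def by (simp only: integrable_completion)
qed

lemma set_integrable_inverse_sqrt: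
  "set_integrable lborel {p - D..p + D} (\<lambda>y. 1 / sqrt \<bar>y - p\<bar>)"
proof (cases "0 \<le> D")
  case True
  have "((\<lambda>y. 1 / sqrt \<bar>y - p\<bar>) has_integral (2 * sqrt (p + D - p) - 2 * sqrt (p - p))) {p..p + D}"
  proof (rule fundamental_theorem_of_calculus_interior)
    show "continuous_on {p..p + D} (\<lambda>y. 2 * sqrt (y - p))" by (intro continuous_intros)
    show "((\<lambda>y. 2 * sqrt (y - p)) has_vector_derivative 1 / sqrt \<bar>y - p\<bar>) (at y)" if "y \<in> {p<..<p + D}" for y
      using that unfolding has_real_derivative_iff_has_vector_derivative[symmetric]
      by (auto intro!: derivative_eq_intros simp: field_simps)
  qed (use True in auto)
  then have "set_integrable lborel {p..p + D} (\<lambda>y. 1 / sqrt \<bar>y - p\<bar>)"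
    by (rule nonneg_set_integrable) auto
  moreover have "((\<lambda>y. 1 / sqrt \<bar>y - p\<bar>) has_integral (- 2 * sqrt (p - p) - (- 2) * sqrt (p - (p - D)))) {p - D..p}"
  proof (rule fundamental_theorem_of_calculus_interior)
    show "continuous_on {p - D..p} (\<lambda>y. - 2 * sqrt (p - y))" by (intro continuous_intros)
    show "((\<lambda>y. - 2 * sqrt (p - y)) has_vector_derivative 1 / sqrt \<bar>y - p\<bar>) (at y)" if "y \<in> {p - D<..<p}" for y
      using that unfolding has_real_derivative_iff_has_vector_derivative[symmetric]
      by (auto intro!: derivative_eq_intros simp: field_simps)
  qed (use True in auto)
  then have "set_integrable lborel {p - D..p} (\<lambda>y. 1 / sqrt \<bar>y - p\<bar>)"
    by (rule nonneg_set_integrable) auto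
  ultimately have "set_integrable lborel ({p - D..p} \<union> {p..p + D}) (\<lambda>y. 1 / sqrt \<bar>y - p\<bar>)"
    by (intro set_integrable_Un) auto
  moreover have "{p - D..p} \<union> {p..p + D} = {p - D..p + D}" using True by auto
  ultimately show ?thesis by simp
next
  case False
  then have "{p - D..p + D} = {}" by auto
  then show ?thesis by (simp add: set_integrable_def)
qed

text \<open>For \<open>|g| < 1\<close> use \<open>ln y \<le> y\<close> at the fourth root of \<open>1/|g|\<close>; a fourth root leaves an integrable singularity of order
\<open>-1/2\<close> after squaring.\<close>

lemma ln_abs_le:
  assumes "0 < t" "t \<le> \<bar>g\<bar>" "\<bar>g\<bar> \<le> M" "1 \<le> M"
  shows "(ln \<bar>g\<bar>)\<^sup>2 \<le> (ln M)\<^sup>2 + 16 / sqrt t"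
proof (cases "1 \<le> \<bar>g\<bar>")
  case True
  have "(ln \<bar>g\<bar>)\<^sup>2 \<le> (ln M)\<^sup>2" using assms True by (intro power_mono) auto
  moreover have "0 \<le> 16 / sqrt t" using assms(1) by simp
  ultimately show ?thesis by linarith
next
  case False
  define r where "r = sqrt (sqrt (1 / \<bar>g\<bar>))"
  have g: "0 < \<bar>g\<bar>" using assms by simp
  have r: "0 < r" using g by (simp add: r_def)
  have r4: "r ^ 4 = 1 / \<bar>g\<bar>"
  proof -
    have "r ^ 4 = (r\<^sup>2)\<^sup>2" by simp
    then show ?thesis using g by (simp add: r_def)
  qed
  have "- ln \<bar>g\<bar> = ln (r ^ 4)" using g by (simp add: r4 ln_div)
  also have "\<dots> = 4 * ln r" using r by (simp add: ln_realpow)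
  also have "\<dots> \<le> 4 * r" using ln_less_self[OF r] by simp
  finally have "- ln \<bar>g\<bar> \<le> 4 * r" .
  moreover have "0 \<le> - ln \<bar>g\<bar>" using False g by simp
  ultimately have "(- ln \<bar>g\<bar>)\<^sup>2 \<le> (4 * r)\<^sup>2" by (intro power_mono)
  also have "\<dots> = 16 / sqrt \<bar>g\<bar>" using g by (simp add: r_def power_mult_distrib power_divide real_sqrt_divide)
  also have "\<dots> \<le> 16 / sqrt t" using assms by (intro divide_left_mono) auto
  finally have "(ln \<bar>g\<bar>)\<^sup>2 \<le> 16 / sqrt t" by simp
  then show ?thesis using zero_le_power2[of "ln M"] by linarith
qed

text \<open>Near a zero, \<open>|g|\<close> is at least a multiple of the distance, so the square of the logarithm is dominated by the inverse square root of
the distance. The interval is cut into pieces of length at most \<open>D/2\<close>, each of which is near a zero or away from all of them.\<close>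

lemma set_integrable_ln_square:
  fixes g :: "real \<Rightarrow> real"
  assumes cont: "continuous_on UNIV g" and M: "1 \<le> M" "\<And>y. \<bar>g y\<bar> \<le> M"
    and D: "0 < D" and c\<^sub>0: "0 < c\<^sub>0" and c\<^sub>1: "0 < c\<^sub>1"
    and near: "\<And>p y. g p = 0 \<Longrightarrow> \<bar>y - p\<bar> \<le> D \<Longrightarrow> c\<^sub>0 * \<bar>y - p\<bar> \<le> \<bar>g y\<bar>"
    and far: "\<And>y. (\<And>p. g p = 0 \<Longrightarrow> D / 2 \<le> \<bar>y - p\<bar>) \<Longrightarrow> c\<^sub>1 \<le> \<bar>g y\<bar>"
  shows "set_integrable lborel {a..b} (\<lambda>y. (ln \<bar>g y\<bar>)\<^sup>2)"
proof -
  have g[measurable]: "g \<in> borel_measurable borel" using cont by (rule borel_measurable_continuous_onI)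
  have meas: "set_borel_measurable lborel {u..v} (\<lambda>y. (ln \<bar>g y\<bar>)\<^sup>2)" for u v
    unfolding set_borel_measurable_def by measurable
  have piece: "set_integrable lborel {u..v} (\<lambda>y. (ln \<bar>g y\<bar>)\<^sup>2)" if "v - u \<le> D / 2" for u v
  proof (cases "\<exists>y p. y \<in> {u..v} \<and> g p = 0 \<and> \<bar>y - p\<bar> < D / 2")
    case True
    then obtain y p where y: "y \<in> {u..v}" "g p = 0" "\<bar>y - p\<bar> < D / 2" by blast
    have sub: "{u..v} \<subseteq> {p - D..p + D}" using y that by (auto simp: abs_if split: if_splits)
    let ?d = "\<lambda>y. (ln M)\<^sup>2 + 16 / sqrt c\<^sub>0 * (1 / sqrt \<bar>y - p\<bar>)"
    have "set_integrable lborel {p - D..p + D} (\<lambda>y. 16 / sqrt c\<^sub>0 * (1 / sqrt \<bar>y - p\<bar>))"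
      by (rule set_integrable_mult_right) (rule set_integrable_inverse_sqrt)
    moreover have "set_integrable lborel {p - D..p + D} (\<lambda>_. (ln M)\<^sup>2)"
      by (rule borel_integrable_atLeastAtMost') auto
    ultimately have "set_integrable lborel {p - D..p + D} ?d" by (intro set_integral_add(1))
    then have "set_integrable lborel {u..v} ?d" by (rule set_integrable_subset) (use sub in auto)
    then show ?thesis
    proof (rule set_integrable_bound[OF _ meas], intro AE_I2 impI)
      fix x assume "x \<in> {u..v}"
      then have x: "\<bar>x - p\<bar> \<le> D" using sub by auto
      show "norm ((ln \<bar>g x\<bar>)\<^sup>2) \<le> norm (?d x)"
      proof (cases "x = p")
        case True
        then show ?thesis using y(2) by simp
      next
        case False
        have "(ln \<bar>g x\<bar>)\<^sup>2 \<le> (ln M)\<^sup>2 + 16 / sqrt (c\<^sub>0 * \<bar>x - p\<bar>)"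
          by (rule ln_abs_le) (use False near[OF y(2) x] c\<^sub>0 M in auto)
        also have "\<dots> = ?d x" by (simp add: real_sqrt_mult)
        finally show ?thesis by simp
      qed
    qed
  next
    case False
    have "set_integrable lborel {u..v} (\<lambda>_. (ln M)\<^sup>2 + 16 / sqrt c\<^sub>1)"
      by (rule borel_integrable_atLeastAtMost') auto
    then show ?thesis
    proof (rule set_integrable_bound[OF _ meas], intro AE_I2 impI)
      fix x assume x: "x \<in> {u..v}"
      have "c\<^sub>1 \<le> \<bar>g x\<bar>" by (rule far) (use False x in force)
      then have "(ln \<bar>g x\<bar>)\<^sup>2 \<le> (ln M)\<^sup>2 + 16 / sqrt c\<^sub>1"
        by (intro ln_abs_le c\<^sub>1 M)
      then show "norm ((ln \<bar>g x\<bar>)\<^sup>2) \<le> norm ((ln M)\<^sup>2 + 16 / sqrt c\<^sub>1)" by simp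
    qed
  qed
  have "set_integrable lborel {u..v} (\<lambda>y. (ln \<bar>g y\<bar>)\<^sup>2)" if "v - u \<le> n * (D / 2)" for n :: nat and u v
    using that
  proof (induction n arbitrary: v)
    case 0
    then show ?case using piece[of v u] D by simp
  next
    case (Suc n)
    show ?case
    proof (cases "v - D / 2 \<le> u")
      case True
      then show ?thesis by (intro piece) simp
    next
      case False
      have "set_integrable lborel ({u..v - D / 2} \<union> {v - D / 2..v}) (\<lambda>y. (ln \<bar>g y\<bar>)\<^sup>2)"
        using Suc by (intro set_integrable_Un piece Suc.IH) (auto simp: algebra_simps)
      moreover have "{u..v - D / 2} \<union> {v - D / 2..v} = {u..v}" using False D by auto
      ultimately show ?thesis by simp
    qed
  qed
  moreover obtain n :: nat where "(b - a) / (D / 2) \<le> n" using real_arch_simple by blast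
  then have "b - a \<le> n * (D / 2)" using D by (simp add: pos_divide_le_eq)
  ultimately show ?thesis by blast
qed

lemma set_integrable_of_square:
  fixes g :: "real \<Rightarrow> real"
  assumes "set_integrable lborel {a..b} (\<lambda>y. (g y)\<^sup>2)" and g[measurable]: "g \<in> borel_measurable borel"
  shows "set_integrable lborel {a..b} g"
proof -
  have "set_integrable lborel {a..b} (\<lambda>y. 1 + (g y)\<^sup>2)"
    by (rule set_integral_add(1)[OF borel_integrable_atLeastAtMost' assms(1)]) auto
  then show ?thesis
  proof (rule set_integrable_bound)
    show "set_borel_measurable lborel {a..b} g" unfolding set_borel_measurable_def by measurable
    have "\<bar>g x\<bar> \<le> 1 + (g x)\<^sup>2" for x
    proof -
      have "0 \<le> (\<bar>g x\<bar> - 1)\<^sup>2" by simp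
      then have "2 * \<bar>g x\<bar> \<le> 1 + (g x)\<^sup>2" by (simp add: power2_diff)
      then show ?thesis by linarith
    qed
    then show "AE x in lborel. x \<in> {a..b} \<longrightarrow> norm (g x) \<le> norm (1 + (g x)\<^sup>2)"
      by (intro AE_I2) (simp add: order_trans[OF _ abs_ge_self])
  qed
qed

section \<open>Uniform noise\<close>

abbreviation "unif \<epsilon> \<equiv> uniform_measure lborel {-\<epsilon>..\<epsilon>::real}"

lemma unif_density:
  assumes "0 < \<epsilon>"
  shows "unif \<epsilon> = density lborel (\<lambda>s. ennreal (indicator {-\<epsilon>..\<epsilon>} s / (2 * \<epsilon>)))"
  unfolding uniform_measure_def
proof (rule density_cong)
  show "AE s in lborel. indicator {-\<epsilon>..\<epsilon>} s / emeasure lborel {-\<epsilon>..\<epsilon>} =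
      ennreal (indicator {-\<epsilon>..\<epsilon>} s / (2 * \<epsilon>))"
    using assms by (intro AE_I2) (auto simp: indicator_def ennreal_1[symmetric] divide_ennreal simp del: ennreal_1)
qed auto

lemma prob_space_unif: "0 < \<epsilon> \<Longrightarrow> prob_space (unif \<epsilon>)"
  by (rule prob_space_uniform_measure) auto

text \<open>This identifies averaging over one step of the noise with \<open>window\<close>.\<close>

lemma integral_unif:
  assumes "0 < \<epsilon>" and f[measurable]: "f \<in> borel_measurable borel"
    and int: "\<And>a b. set_integrable lborel {a..b} f"
  shows "integrable (unif \<epsilon>) (\<lambda>s. f (x + s))"
    and "(\<integral>s. f (x + s) \<partial>unif \<epsilon>) = window \<epsilon> (antider f) x"
proof -
  let ?g = "\<lambda>y. indicator {x - \<epsilon>..x + \<epsilon>} y *\<^sub>R f y"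
  have shift: "?g (x + 1 * s) = indicator {-\<epsilon>..\<epsilon>} s * f (x + s)" for s
    by (auto simp: indicator_def)
  have g: "integrable lborel ?g" using int[of "x - \<epsilon>" "x + \<epsilon>"] by (simp add: set_integrable_def)
  then have "has_bochner_integral lborel (\<lambda>s. ?g (x + 1 * s)) (integral\<^sup>L lborel ?g /\<^sub>R \<bar>1\<bar>)"
    by (subst lborel_has_bochner_integral_real_affine_iff[symmetric]) (auto simp: has_bochner_integral_integrable)
  then have s: "has_bochner_integral lborel (\<lambda>s. indicator {-\<epsilon>..\<epsilon>} s * f (x + s)) (integral\<^sup>L lborel ?g)"
    unfolding shift by simp
  have eq: "(indicator {-\<epsilon>..\<epsilon>} s / (2 * \<epsilon>)) *\<^sub>R f (x + s) =
      (indicator {-\<epsilon>..\<epsilon>} s * f (x + s)) / (2 * \<epsilon>)" for s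
    by simp
  show "integrable (unif \<epsilon>) (\<lambda>s. f (x + s))"
    unfolding unif_density[OF assms(1)] using s assms(1)
    by (subst integrable_density) (auto simp only: eq has_bochner_integral_iff intro!: AE_I2, auto)
  have "(\<integral>s. f (x + s) \<partial>unif \<epsilon>) = (\<integral>s. (indicator {-\<epsilon>..\<epsilon>} s * f (x + s)) / (2 * \<epsilon>) \<partial>lborel)"
    unfolding unif_density[OF assms(1)] using assms(1) by (subst integral_density) auto
  also have "\<dots> = integral\<^sup>L lborel ?g / (2 * \<epsilon>)"
    using s by (simp add: has_bochner_integral_iff)
  also have "integral\<^sup>L lborel ?g = integral {x - \<epsilon>..x + \<epsilon>} f"
    using set_borel_integral_eq_integral(2)[OF int] by (simp add: set_lebesgue_integral_def)
  also have "\<dots> = antider f (x + \<epsilon>) - antider f (x - \<epsilon>)"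
    using assms(1) by (intro antider_diff[symmetric] set_borel_integral_eq_integral(1) int) auto
  finally show "(\<integral>s. f (x + s) \<partial>unif \<epsilon>) = window \<epsilon> (antider f) x" by (simp add: window_def)
qed

section \<open>Constants of a Morse function\<close>

lemma periodic_int:
  fixes f :: "real \<Rightarrow> 'a" assumes "\<And>x. f (x + 1) = f x"
  shows "f (x + of_int j) = f x"
proof (induction j rule: int_induct[where k = 0])
  case (step1 i)
  then show ?case using assms[of "x + of_int i"] by (simp add: add.assoc)
next
  case (step2 i)
  then show ?case using assms[of "x + of_int (i - 1)"] by (simp add: algebra_simps)
qed simp

lemma periodic_frac:
  fixes f :: "real \<Rightarrow> 'a" assumes "\<And>x. f (x + 1) = f x"
  shows "f (frac x) = f x"
  using periodic_int[of f x "- \<lfloor>x\<rfloor>", OF assms] by (simp add: frac_def)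

lemma periodic_bounded:
  fixes f :: "real \<Rightarrow> real"
  assumes "continuous_on UNIV f" "\<And>x. f (x + 1) = f x"
  obtains M where "1 \<le> M" "\<And>x. \<bar>f x\<bar> \<le> M"
proof -
  have "bounded (f ` {0..1})"
    by (intro compact_imp_bounded compact_continuous_image continuous_on_subset[OF assms(1)]) auto
  then obtain b where b: "\<And>x. x \<in> {0..1} \<Longrightarrow> \<bar>f x\<bar> \<le> b"
    unfolding bounded_iff by (metis imageI real_norm_def)
  have "\<bar>f x\<bar> \<le> max 1 b" for x
  proof -
    have "frac x \<in> {0..1}" using frac_lt_1[of x] by (simp add: less_imp_le)
    from b[OF this] show ?thesis unfolding periodic_frac[of f, OF assms(2)] by simp
  qed
  then show ?thesis by (intro that[of "max 1 b"]) auto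
qed

lemma C1_on_UNIV:
  fixes f :: "real \<Rightarrow> real"
  assumes "f C1_differentiable_on UNIV"
  shows "(f has_real_derivative deriv f x) (at x)" "continuous_on UNIV (deriv f)"
proof -
  obtain g where g: "\<And>x. (f has_vector_derivative g x) (at x)" "continuous_on UNIV g"
    using assms by (auto simp: C1_differentiable_on_def)
  then have "(f has_real_derivative g x) (at x)" for x
    by (simp add: has_real_derivative_iff_has_vector_derivative)
  moreover from this have "deriv f = g" by (auto intro: DERIV_imp_deriv)
  ultimately show "(f has_real_derivative deriv f x) (at x)" "continuous_on UNIV (deriv f)"
    using g(2) by auto
qed

lemma deriv_periodic:
  fixes f :: "real \<Rightarrow> real"
  assumes "\<And>x. (f has_real_derivative f' x) (at x)" "\<And>x. f (x + 1) = f x"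
  shows "f' (x + 1) = f' x"
proof -
  have "((\<lambda>x. f (x + 1)) has_real_derivative f' (x + 1)) (at x)"
    using assms(1)[of "x + 1"] by (simp only: DERIV_shift)
  then show ?thesis using assms by (simp add: DERIV_unique[OF _ assms(1)])
qed

lemma finite_common_radius:
  assumes "finite S" and "\<And>p. p \<in> S \<Longrightarrow> \<exists>d>0. \<forall>r. 0 < r \<and> r \<le> (d::real) \<longrightarrow> P p r"
  obtains d where "0 < d" "d \<le> 1" "\<And>p. p \<in> S \<Longrightarrow> P p d"
proof -
  obtain f where f: "\<And>p. p \<in> S \<Longrightarrow> 0 < f p" "\<And>p r. p \<in> S \<Longrightarrow> 0 < r \<Longrightarrow> r \<le> f p \<Longrightarrow> P p r"
    using assms(2) by metis
  define d where "d = Min (insert 1 (f ` S))"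
  have "0 < d" "d \<le> 1" using assms(1) f(1) by (auto simp: d_def)
  moreover have "d \<le> f p" if "p \<in> S" for p using assms(1) that by (auto simp: d_def)
  ultimately show ?thesis using f(2) by (intro that) auto
qed

text \<open>On a small disc about a nondegenerate zero, \<open>f''\<close> keeps its sign and at least half of its size, and the mean value theorem
gives the linear growth of \<open>f'\<close>. Finitely many zeros admit a common disc size.\<close>

lemma fold_estimates:
  fixes f' f'' :: "real \<Rightarrow> real"
  assumes "finite C" and d: "\<And>x. (f' has_real_derivative f'' x) (at x)" and "continuous_on UNIV f''"
    and "\<And>p. p \<in> C \<Longrightarrow> f' p = 0" "\<And>p. p \<in> C \<Longrightarrow> f'' p \<noteq> 0"
  obtains D c\<^sub>0 where "0 < D" "D \<le> 1" "0 < c\<^sub>0"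
    "\<And>p y. p \<in> C \<Longrightarrow> \<bar>y - p\<bar> \<le> D \<Longrightarrow> c\<^sub>0 * \<bar>y - p\<bar> \<le> \<bar>f' y\<bar>"
    "\<And>p. p \<in> C \<Longrightarrow> (\<forall>y. \<bar>y - p\<bar> \<le> D \<longrightarrow> 0 \<le> f'' y) \<or> (\<forall>y. \<bar>y - p\<bar> \<le> D \<longrightarrow> f'' y \<le> 0)"
proof -
  have "\<exists>d>0. \<forall>r. 0 < r \<and> r \<le> d \<longrightarrow>
      (\<forall>y. \<bar>y - p\<bar> \<le> r \<longrightarrow> \<bar>f'' y - f'' p\<bar> \<le> \<bar>f'' p\<bar> / 2)" if "p \<in> C" for p
  proof -
    have "isCont f'' p" using assms(3) by (simp add: continuous_on_eq_continuous_at)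
    moreover have "0 < \<bar>f'' p\<bar> / 2" using assms(5)[OF that] by simp
    ultimately obtain s where s: "0 < s" "\<And>y. \<bar>y - p\<bar> < s \<Longrightarrow> \<bar>f'' y - f'' p\<bar> < \<bar>f'' p\<bar> / 2"
      unfolding continuous_at_eps_delta dist_real_def by blast
    show ?thesis
    proof (intro exI[of _ "s / 2"] conjI allI impI)
      fix r y assume "0 < r \<and> r \<le> s / 2" "\<bar>y - p\<bar> \<le> r"
      then have "\<bar>y - p\<bar> < s" using s(1) by linarith
      then show "\<bar>f'' y - f'' p\<bar> \<le> \<bar>f'' p\<bar> / 2" using s(2) by (intro less_imp_le)
    qed (use s(1) in simp)
  qed
  note ex1 = this
  obtain D where D: "0 < D" "D \<le> 1"
    and close0: "\<And>p. p \<in> C \<Longrightarrow> \<forall>y. \<bar>y - p\<bar> \<le> D \<longrightarrow> \<bar>f'' y - f'' p\<bar> \<le> \<bar>f'' p\<bar> / 2"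
    by (rule finite_common_radius[where P = "\<lambda>p r. \<forall>y. \<bar>y - p\<bar> \<le> r \<longrightarrow> \<bar>f'' y - f'' p\<bar> \<le> \<bar>f'' p\<bar> / 2",
        OF assms(1) ex1]) (assumption, rule that)
  have close: "\<bar>f'' y - f'' p\<bar> \<le> \<bar>f'' p\<bar> / 2" if "p \<in> C" "\<bar>y - p\<bar> \<le> D" for p y
    using close0 that by blast
  have ex2: "\<exists>d>0. \<forall>r. 0 < r \<and> r \<le> d \<longrightarrow> r \<le> \<bar>f'' p\<bar> / 2" if "p \<in> C" for p
    using assms(5)[OF that] by (intro exI[of _ "\<bar>f'' p\<bar> / 2"]) auto
  obtain c\<^sub>0 where c\<^sub>0: "0 < c\<^sub>0" "\<And>p. p \<in> C \<Longrightarrow> c\<^sub>0 \<le> \<bar>f'' p\<bar> / 2"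
    by (rule finite_common_radius[where P = "\<lambda>p r. r \<le> \<bar>f'' p\<bar> / 2", OF assms(1) ex2]) (assumption, rule that)
  have lower: "c\<^sub>0 \<le> \<bar>f'' y\<bar>" if "p \<in> C" "\<bar>y - p\<bar> \<le> D" for p y
    using close[OF that] c\<^sub>0(2)[OF that(1)] by linarith
  show ?thesis
  proof (rule that[OF D c\<^sub>0(1)])
    fix p y assume p: "p \<in> C" "\<bar>y - p\<bar> \<le> D"
    show "c\<^sub>0 * \<bar>y - p\<bar> \<le> \<bar>f' y\<bar>"
    proof -
      have "\<exists>z. \<bar>z - p\<bar> \<le> D \<and> \<bar>f' y\<bar> = \<bar>f'' z\<bar> * \<bar>y - p\<bar>"
      proof (cases y p rule: linorder_cases)
        case less
        from MVT2[OF less d] obtain z where "y < z" "z < p" "f' p - f' y = (p - y) * f'' z" by blast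
        then have "\<bar>f' y\<bar> = \<bar>(p - y) * f'' z\<bar>" using assms(4)[OF p(1)] by simp
        then have "\<bar>f' y\<bar> = \<bar>f'' z\<bar> * \<bar>y - p\<bar>" by (simp add: abs_mult abs_minus_commute)
        moreover have "\<bar>z - p\<bar> \<le> D" using \<open>y < z\<close> \<open>z < p\<close> p(2) by linarith
        ultimately show ?thesis by blast
      next
        case greater
        from MVT2[OF greater d] obtain z where "p < z" "z < y" "f' y - f' p = (y - p) * f'' z" by blast
        then show ?thesis using p assms(4)[OF p(1)] greater
          by (intro exI[of _ z]) (auto simp: abs_mult mult.commute)
      qed (use p assms(4)[OF p(1)] in \<open>auto intro!: exI[of _ p]\<close>)
      then obtain z where z: "\<bar>z - p\<bar> \<le> D" "\<bar>f' y\<bar> = \<bar>f'' z\<bar> * \<bar>y - p\<bar>" by blast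
      show ?thesis unfolding z(2) by (intro mult_right_mono lower[OF p(1) z(1)]) simp
    qed
  next
    fix p assume p: "p \<in> C"
    show "(\<forall>y. \<bar>y - p\<bar> \<le> D \<longrightarrow> 0 \<le> f'' y) \<or> (\<forall>y. \<bar>y - p\<bar> \<le> D \<longrightarrow> f'' y \<le> 0)"
    proof (cases "0 \<le> f'' p")
      case True
      have "0 \<le> f'' y" if "\<bar>y - p\<bar> \<le> D" for y using close[OF p that] True by linarith
      then show ?thesis by blast
    next
      case False
      have "f'' y \<le> 0" if "\<bar>y - p\<bar> \<le> D" for y using close[OF p that] False by linarith
      then show ?thesis by blast
    qed
  qed
qed

text \<open>By periodicity the points away from the zeros can be moved to a compact subset of \<open>[0,1]\<close>, on which \<open>|g|\<close> has a positive minimum.\<close>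

lemma far_estimate:
  fixes g :: "real \<Rightarrow> real"
  assumes "continuous_on UNIV g" and per: "\<And>x. g (x + 1) = g x" and "0 < \<eta>"
  obtains c where "0 < c" "\<And>y. (\<And>p. g p = 0 \<Longrightarrow> \<eta> \<le> \<bar>y - p\<bar>) \<Longrightarrow> c \<le> \<bar>g y\<bar>"
proof -
  define A where "A = {0..1} \<inter> (\<Inter>p\<in>{p. g p = 0}. {y. \<eta> \<le> \<bar>y - p\<bar>})"
  have "closed {y. \<eta> \<le> \<bar>y - p\<bar>}" for p :: real
    by (intro closed_Collect_le continuous_intros)
  then have "compact A" unfolding A_def by (intro compact_Int_closed closed_INT) auto
  have A: "frac y \<in> A" if y: "\<And>p. g p = 0 \<Longrightarrow> \<eta> \<le> \<bar>y - p\<bar>" for y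
  proof -
    have "\<eta> \<le> \<bar>frac y - p\<bar>" if "g p = 0" for p
      using y[of "p + of_int \<lfloor>y\<rfloor>"] periodic_int[of g p "\<lfloor>y\<rfloor>", OF per] that
      by (simp add: frac_def algebra_simps)
    then show ?thesis using frac_lt_1[of y] by (auto simp: A_def less_imp_le)
  qed
  show ?thesis
  proof (cases "A = {}")
    case True
    then show ?thesis using that[of 1] A by auto
  next
    case False
    have "continuous_on A (\<lambda>y. \<bar>g y\<bar>)" by (intro continuous_intros continuous_on_subset[OF assms(1)]) auto
    then obtain z where z: "z \<in> A" "\<And>y. y \<in> A \<Longrightarrow> \<bar>g z\<bar> \<le> \<bar>g y\<bar>"
      using continuous_attains_inf[OF \<open>compact A\<close> False] by metis
    have "g z \<noteq> 0" using z(1) \<open>0 < \<eta>\<close> by (auto simp: A_def)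
    then show ?thesis
    proof (intro that[of "\<bar>g z\<bar>"])
      fix y assume "\<And>p. g p = 0 \<Longrightarrow> \<eta> \<le> \<bar>y - p\<bar>"
      from z(2)[OF A[OF this]] show "\<bar>g z\<bar> \<le> \<bar>g y\<bar>" unfolding periodic_frac[of g, OF per] .
    qed simp
  qed
qed

lemma antider_0: "antider f 0 = 0" by (simp add: antider_def)

text \<open>\<open>B x - m x\<close> is continuous and periodic, hence bounded.\<close>

lemma periodic_deviation_bounded:
  fixes B :: "real \<Rightarrow> real"
  assumes "continuous_on UNIV B" "\<And>x. B (x + 1) = B x + m"
  obtains E where "0 \<le> E" "osc B m UNIV E"
proof -
  obtain K where K: "1 \<le> K" "\<And>x. \<bar>B x - m * x\<bar> \<le> K"
  proof (rule periodic_bounded)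
    show "continuous_on UNIV (\<lambda>x. B x - m * x)" by (intro continuous_intros assms(1))
    show "B (x + 1) - m * (x + 1) = B x - m * x" for x unfolding assms(2) by (simp add: algebra_simps)
  qed blast
  have "\<bar>B t - B s - m * (t - s)\<bar> \<le> 2 * K" for s t
    using K(2)[of t] K(2)[of s] by (simp add: algebra_simps)
  then have "osc B m UNIV (2 * K)" by (simp add: osc_def)
  then show ?thesis using K(1) by (intro that[of "2 * K"]) auto
qed

lemma lip_antider:
  assumes f: "\<And>s t. f integrable_on {s..t::real}" and "0 \<le> E" "\<And>y. y \<in> {u..v} \<Longrightarrow> \<bar>f y - m\<bar> \<le> E"
  shows "lip (antider f) m {u..v} E"
proof -
  have *: "\<bar>antider f t - antider f s - m * (t - s)\<bar> \<le> E * \<bar>t - s\<bar>"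
    if "s \<in> {u..v}" "t \<in> {u..v}" "s \<le> t" for s t
  proof -
    have "((\<lambda>y. f y - m) has_integral (integral {s..t} f - (t - s) * m)) {s..t}"
      using has_integral_diff[OF integrable_integral[OF f] has_integral_const_real[of m s t]] that by simp
    then have "norm (integral {s..t} f - (t - s) * m) \<le> E * measure lborel {s..t}"
      by (rule has_integral_bound_real[OF assms(2) finite.emptyI]) (use assms(3) that in auto)
    then show ?thesis using antider_diff[OF f that(3)] that by (simp add: mult.commute)
  qed
  show ?thesis
    unfolding lip_def
  proof (intro ballI)
    fix s t assume "s \<in> {u..v}" "t \<in> {u..v}"
    moreover have "\<bar>antider f t - antider f s - m * (t - s)\<bar> = \<bar>antider f s - antider f t - m * (s - t)\<bar>"
      by (simp add: algebra_simps abs_if)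
    ultimately show "\<bar>antider f t - antider f s - m * (t - s)\<bar> \<le> E * \<bar>t - s\<bar>"
      using *[of s t] *[of t s] by (cases "s \<le> t") (auto simp: abs_minus_commute)
  qed
qed

lemma morse_function_exists:
  assumes \<psi>: "C2_on_circle \<psi>" and fin: "finite (crit_set \<psi>)"
    and nondeg: "\<forall>x\<in>crit_set \<psi>. deriv (deriv \<psi>) x \<noteq> 0" and c: "0 < c" "c < 1"
  obtains D c\<^sub>0 c\<^sub>1 M E where
    "morse_function \<psi> (deriv \<psi>) (deriv (deriv \<psi>)) (antider (\<lambda>y. ln \<bar>deriv \<psi> y\<bar>)) c D c\<^sub>0 c\<^sub>1 M E"
    "\<And>a b. set_integrable lborel {a..b} (\<lambda>y. (ln \<bar>deriv \<psi> y\<bar>)\<^sup>2)"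
proof -
  let ?g = "deriv \<psi>" and ?g' = "deriv (deriv \<psi>)" and ?l = "\<lambda>y. ln \<bar>deriv \<psi> y\<bar>"
  have per: "\<psi> (x + 1) = \<psi> x" for x using \<psi> by (simp add: C2_on_circle_def)
  have d1: "(\<psi> has_real_derivative ?g x) (at x)" and d2: "(?g has_real_derivative ?g' x) (at x)"
    and cont: "continuous_on UNIV ?g" "continuous_on UNIV ?g'" for x
    using \<psi> C1_on_UNIV by (auto simp: C2_on_circle_def)
  have per1: "?g (x + 1) = ?g x" for x by (rule deriv_periodic[OF d1 per])
  have per2: "?g' (x + 1) = ?g' x" for x by (rule deriv_periodic[OF d2 per1])
  obtain M\<^sub>1 where M\<^sub>1: "1 \<le> M\<^sub>1" "\<And>x. \<bar>?g x\<bar> \<le> M\<^sub>1" using periodic_bounded[of ?g, OF cont(1) per1] by blast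
  obtain M\<^sub>2 where M\<^sub>2: "1 \<le> M\<^sub>2" "\<And>x. \<bar>?g' x\<bar> \<le> M\<^sub>2" using periodic_bounded[of ?g', OF cont(2) per2] by blast
  define M where "M = max M\<^sub>1 M\<^sub>2"
  have M: "1 \<le> M" "\<bar>?g x\<bar> \<le> M" "\<bar>?g' x\<bar> \<le> M" for x
    using M\<^sub>1 M\<^sub>2 order_trans[OF M\<^sub>1(2)[of x], of M] order_trans[OF M\<^sub>2(2)[of x], of M] by (auto simp: M_def)
  have crit: "?g p = 0" if "p \<in> crit_set \<psi>" for p using that by (simp add: crit_set_def)
  have nd: "?g' p \<noteq> 0" if "p \<in> crit_set \<psi>" for p using that nondeg by blast
  obtain D c\<^sub>0 where D: "0 < D" "D \<le> 1" "0 < c\<^sub>0"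
    and near: "\<And>p y. p \<in> crit_set \<psi> \<Longrightarrow> \<bar>y - p\<bar> \<le> D \<Longrightarrow> c\<^sub>0 * \<bar>y - p\<bar> \<le> \<bar>?g y\<bar>"
    and fold: "\<And>p. p \<in> crit_set \<psi> \<Longrightarrow>
      (\<forall>y. \<bar>y - p\<bar> \<le> D \<longrightarrow> 0 \<le> ?g' y) \<or> (\<forall>y. \<bar>y - p\<bar> \<le> D \<longrightarrow> ?g' y \<le> 0)"
    using fold_estimates[OF fin d2 cont(2) crit nd] by blast
  have frac_crit: "frac p \<in> crit_set \<psi>" if "?g p = 0" for p
    using that periodic_frac[of ?g p, OF per1] frac_lt_1[of p] by (simp add: crit_set_def S1_def)
  have shift: "y - p = (y - of_int \<lfloor>p\<rfloor>) - frac p" for y p :: real by (simp add: frac_def)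
  have g_shift: "?g (y - of_int j) = ?g y" "?g' (y - of_int j) = ?g' y" for y j
    using periodic_int[of ?g y "-j", OF per1] periodic_int[of ?g' y "-j", OF per2] by simp_all
  have near': "c\<^sub>0 * \<bar>y - p\<bar> \<le> \<bar>?g y\<bar>" if "?g p = 0" "\<bar>y - p\<bar> \<le> D" for p y
    using near[OF frac_crit[OF that(1)], of "y - of_int \<lfloor>p\<rfloor>"] that(2)
    unfolding shift[of y p, symmetric] g_shift by blast
  have fold': "(\<forall>y. \<bar>y - p\<bar> \<le> D \<longrightarrow> 0 \<le> ?g' y) \<or> (\<forall>y. \<bar>y - p\<bar> \<le> D \<longrightarrow> ?g' y \<le> 0)"
    if "?g p = 0" for p
    using fold[OF frac_crit[OF that]] shift[of _ p] g_shift(2) by metis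
  have "0 < min c D / 2" using c D by simp
  then obtain c\<^sub>1 where c\<^sub>1: "0 < c\<^sub>1" "\<And>y. (\<And>p. ?g p = 0 \<Longrightarrow> min c D / 2 \<le> \<bar>y - p\<bar>) \<Longrightarrow> c\<^sub>1 \<le> \<bar>?g y\<bar>"
    using far_estimate[of ?g "min c D / 2", OF cont(1) per1] by blast
  have meas: "?l \<in> borel_measurable borel"
    using borel_measurable_continuous_onI[OF cont(1)] by measurable
  have sq: "set_integrable lborel {a..b} (\<lambda>y. (?l y)\<^sup>2)" for a b
  proof (rule set_integrable_ln_square[OF cont(1) M(1,2) D(1,3) c\<^sub>1(1) near'])
    fix y assume *: "\<And>p. ?g p = 0 \<Longrightarrow> D / 2 \<le> \<bar>y - p\<bar>"
    show "c\<^sub>1 \<le> \<bar>?g y\<bar>"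
    proof (rule c\<^sub>1(2))
      show "min c D / 2 \<le> \<bar>y - p\<bar>" if "?g p = 0" for p using *[OF that] by linarith
    qed
  qed
  have int: "?l integrable_on {a..b}" for a b
    by (rule set_borel_integral_eq_integral(1)[OF set_integrable_of_square[OF sq meas]])
  define B where "B = antider ?l"
  define m where "m = B 1 - B 0"
  have Bc: "continuous_on UNIV B" unfolding B_def by (rule continuous_antider[OF int])
  have Bs: "B (x + 1) = B x + m" for x
    using antider_shift[OF int, of x] per1 by (simp add: B_def m_def antider_0)
  obtain E\<^sub>1 where E\<^sub>1: "0 \<le> E\<^sub>1" "osc B m UNIV E\<^sub>1" using periodic_deviation_bounded[of B m, OF Bc Bs] by blast
  define E\<^sub>2 where "E\<^sub>2 = \<bar>ln c\<^sub>1\<bar> + ln M + \<bar>m\<bar>"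
  have E\<^sub>2: "0 \<le> E\<^sub>2" using M(1) by (simp add: E\<^sub>2_def)
  have lip: "lip B m {u..v} (max E\<^sub>1 E\<^sub>2)" if "\<And>y. y \<in> {u..v} \<Longrightarrow> c\<^sub>1 \<le> \<bar>?g y\<bar>" for u v
    unfolding B_def
  proof (rule lip_antider[OF int])
    fix y assume "y \<in> {u..v}"
    then have "c\<^sub>1 \<le> \<bar>?g y\<bar>" by (rule that)
    then have "ln c\<^sub>1 \<le> ?l y" "?l y \<le> ln M" using c\<^sub>1(1) M(2)[of y] by auto
    then show "\<bar>?l y - m\<bar> \<le> max E\<^sub>1 E\<^sub>2" unfolding E\<^sub>2_def using ln_ge_zero[OF M(1)] by linarith
  qed (use E\<^sub>1 in auto)
  have "morse_function \<psi> ?g ?g' B c D c\<^sub>0 c\<^sub>1 M (max E\<^sub>1 E\<^sub>2)"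
  proof
    show "osc B (B 1 - B 0) UNIV (max E\<^sub>1 E\<^sub>2)" using osc_weaken[OF E\<^sub>1(2)] by (simp add: m_def)
    show "lip B (B 1 - B 0) {u..v} (max E\<^sub>1 E\<^sub>2)" if "\<And>y. y \<in> {u..v} \<Longrightarrow> c\<^sub>1 \<le> \<bar>?g y\<bar>" for u v
      using lip[OF that] by (simp add: m_def)
    show "B (x + 1) = B x + (B 1 - B 0)" for x using Bs by (simp add: m_def)
    show "c\<^sub>1 \<le> \<bar>?g y\<bar>" if "\<And>p. ?g p = 0 \<Longrightarrow> min c D / 2 \<le> \<bar>y - p\<bar>" for y
      by (rule c\<^sub>1(2)[OF that])
  qed (use per d1 d2 M c D c\<^sub>1(1) near' fold' Bc in auto)
  then show ?thesis using sq by (intro that) (auto simp: B_def)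
qed

section \<open>The derivative cocycle on the circle\<close>

lemma circle_dist_frac_le: "circle_dist (frac u) (frac v) \<le> \<bar>u - v\<bar>"
proof -
  define j where "j = \<lfloor>u\<rfloor> - \<lfloor>v\<rfloor>"
  have uv: "u - v = frac u - frac v + of_int j" by (simp add: j_def frac_def)
  have fr: "\<bar>frac u - frac v\<bar> < 1"
    using frac_ge_0[of u] frac_lt_1[of u] frac_ge_0[of v] frac_lt_1[of v] by linarith
  consider "j = 0" | "j = 1" | "j = -1" | "2 \<le> \<bar>j\<bar>" by linarith
  then show ?thesis
  proof cases
    case 4
    then have "2 \<le> \<bar>real_of_int j\<bar>" by linarith
    then have "\<bar>frac u - frac v\<bar> \<le> \<bar>u - v\<bar>" using uv fr by linarith
    then show ?thesis by (simp add: circle_dist_def min_le_iff_disj)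
  qed (use uv in \<open>simp_all add: circle_dist_def min_le_iff_disj\<close>)
qed

lemma circle_setdist_frac_le:
  assumes "frac v \<in> A" shows "circle_setdist (frac u) A \<le> \<bar>u - v\<bar>"
proof -
  have "circle_setdist (frac u) A \<le> circle_dist (frac u) (frac v)"
    unfolding circle_setdist_def
  proof (rule cINF_lower)
    show "bdd_below (circle_dist (frac u) ` A)"
      by (intro bdd_belowI[of _ 0]) (auto simp: circle_dist_def)
  qed (rule assms)
  then show ?thesis using circle_dist_frac_le[of u v] by linarith
qed

lemma signed_frac_add_int: "signed_frac (t + of_int j) = signed_frac t"
proof -
  have "round (t + of_int j) = round t + j"
  proof -
    have "t + of_int j + 1 / 2 = (t + 1 / 2) + of_int j" by simp
    then show ?thesis by (simp only: round_def floor_add_int)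
  qed
  then show ?thesis by (simp add: signed_frac_def)
qed

lemma signed_frac_small: "\<bar>t\<bar> < 1 / 2 \<Longrightarrow> signed_frac t = t"
proof -
  assume t: "\<bar>t\<bar> < 1 / 2"
  have "round t = 0" by (rule round_unique') (use t in simp)
  then show ?thesis by (simp add: signed_frac_def)
qed

text \<open>Reduction mod 1 changes the difference quotients of a lift by integers only, and \<open>signed_frac\<close> removes these as soon as the increment is
smaller than \<open>1/2\<close>.\<close>

lemma circle_deriv_frac:
  assumes G: "(G has_real_derivative d) (at x)" and per: "\<And>y. G (y + 1) = G y"
  shows "circle_deriv (\<lambda>y. frac (G y)) x = d"
proof -
  have eq: "signed_frac (frac (G (frac (x + h))) - frac (G x)) = signed_frac (G (x + h) - G x)" for h
  proof -
    have "frac (G (x + h)) - frac (G x) = (G (x + h) - G x) + of_int (\<lfloor>G x\<rfloor> - \<lfloor>G (x + h)\<rfloor>)"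
      by (simp add: frac_def)
    then show ?thesis by (simp only: periodic_frac[of G, OF per] signed_frac_add_int)
  qed
  have lim: "(\<lambda>h. (G (x + h) - G x) / h) \<midarrow>0\<rightarrow> d"
    using G by (simp add: DERIV_def)
  have "isCont G x" using G by (rule DERIV_isCont)
  then have "(\<lambda>h. G (x + h) - G x) \<midarrow>0\<rightarrow> 0"
    by (simp add: isCont_iff LIM_zero)
  then have "(\<lambda>h. \<bar>G (x + h) - G x\<bar>) \<midarrow>0\<rightarrow> 0" by (rule tendsto_rabs_zero)
  then have "\<forall>\<^sub>F h in at 0. \<bar>G (x + h) - G x\<bar> < 1 / 2" by (rule order_tendstoD(2)) simp
  then have "\<forall>\<^sub>F h in at 0. (G (x + h) - G x) / h = signed_frac (G (x + h) - G x) / h"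
    by eventually_elim (simp add: signed_frac_small)
  with lim have "(\<lambda>h. signed_frac (G (x + h) - G x) / h) \<midarrow>0\<rightarrow> d"
    by (rule tendsto_cong[THEN iffD1, rotated])
  then show ?thesis
    unfolding circle_deriv_def eq by (intro tendsto_Lim) auto
qed

context
  fixes \<psi> \<psi>' :: "real \<Rightarrow> real" and L a :: real and F :: "real \<Rightarrow> real"
  assumes per: "\<And>x. \<psi> (x + 1) = \<psi> x" and d: "\<And>x. (\<psi> has_real_derivative \<psi>' x) (at x)"
    and F: "\<And>y. F y = L * \<psi> y + a"
begin

lemma lifted_periodic: "F (x + 1) = F x" by (simp add: F per)

lemma frac_circle_map_iterate:
  assumes "1 \<le> i" shows "(circle_map \<psi> L a ^^ i) (frac x) = frac ((F ^^ i) x)"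
proof -
  have step: "circle_map \<psi> L a (frac y) = frac (F y)" for y
    using periodic_frac[of \<psi> y, OF per] by (simp add: circle_map_def F)
  have "(circle_map \<psi> L a ^^ Suc n) (frac x) = frac ((F ^^ Suc n) x)" for n
    by (induction n) (simp_all add: step)
  then show ?thesis using assms by (cases i) auto
qed

text \<open>At time 0 the lifted orbit and the orbit on the circle agree up to an integer; from time 1 on the latter is the fractional part of the former.\<close>

lemma random_iterate_lift:
  "\<exists>j. random_iterate (circle_map \<psi> L a) \<omega> n x = orbit F \<omega> n x + of_int j"
  "random_iterate (circle_map \<psi> L a) \<omega> (Suc n) x = frac (orbit F \<omega> (Suc n) x)"
proof -
  have step: "random_iterate (circle_map \<psi> L a) \<omega> (Suc m) x = frac (orbit F \<omega> (Suc m) x)"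
    if "random_iterate (circle_map \<psi> L a) \<omega> m x = orbit F \<omega> m x + of_int j" for m j
  proof -
    have "\<psi> (frac (orbit F \<omega> m x + of_int j + \<omega> m)) = \<psi> ((orbit F \<omega> m x + \<omega> m) + of_int j)"
      unfolding periodic_frac[of \<psi>, OF per] by (simp add: ac_simps)
    also have "\<dots> = \<psi> (orbit F \<omega> m x + \<omega> m)" by (rule periodic_int[of \<psi>, OF per])
    finally show ?thesis using that by (simp add: perturbed_def circle_map_def F)
  qed
  show ex: "\<exists>j. random_iterate (circle_map \<psi> L a) \<omega> n x = orbit F \<omega> n x + of_int j" for n
  proof (induction n)
    case 0
    show ?case by (rule exI[of _ 0]) simp
  next
    case (Suc n)
    then obtain j where "random_iterate (circle_map \<psi> L a) \<omega> n x = orbit F \<omega> n x + of_int j" by blast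
    from step[OF this] show ?case
      by (intro exI[of _ "- \<lfloor>orbit F \<omega> (Suc n) x\<rfloor>"]) (simp add: frac_def)
  qed
  show "random_iterate (circle_map \<psi> L a) \<omega> (Suc n) x = frac (orbit F \<omega> (Suc n) x)"
    using ex[of n] step by blast
qed

lemma orbit_deriv:
  "((\<lambda>y. orbit F \<omega> n y) has_real_derivative (\<Prod>i<n. L * \<psi>' (orbit F \<omega> i x + \<omega> i))) (at x)"
proof (induction n)
  case (Suc n)
  have dF: "(F has_real_derivative L * \<psi>' y) (at y)" for y
    unfolding F[abs_def] by (rule DERIV_cong[OF DERIV_add[OF DERIV_cmult[OF d] DERIV_const]]) simp
  have "((\<lambda>y. orbit F \<omega> n y + \<omega> n) has_real_derivative
      (\<Prod>i<n. L * \<psi>' (orbit F \<omega> i x + \<omega> i))) (at x)"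
    using DERIV_add[OF Suc DERIV_const] by simp
  from DERIV_chain2[OF dF this] show ?case by (simp add: mult.commute)
qed simp

lemma orbit_periodic: "orbit F \<omega> (Suc n) (y + 1) = orbit F \<omega> (Suc n) y"
proof (induction n)
  case 0
  show ?case using lifted_periodic[of "y + \<omega> 0"] by (simp add: ac_simps)
qed simp

lemma circle_deriv_random_iterate:
  "circle_deriv (random_iterate (circle_map \<psi> L a) \<omega> (Suc n)) x =
    (\<Prod>i<Suc n. L * \<psi>' (orbit F \<omega> i x + \<omega> i))"
proof -
  have "random_iterate (circle_map \<psi> L a) \<omega> (Suc n) = (\<lambda>y. frac (orbit F \<omega> (Suc n) y))"
    using random_iterate_lift(2) by blast
  then show ?thesis
    using circle_deriv_frac[OF orbit_deriv orbit_periodic, of \<omega> n x] by simp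
qed

text \<open>The derivative of the iterate is a product along the orbit. It has no zero factor, so \<open>ext_ln\<close> is the ordinary logarithm and turns the
product into a Birkhoff sum.\<close>

lemma has_lyapunov_exponent_of_average:
  assumes "0 < L" and nz: "\<And>i. \<psi>' (orbit F \<omega> i x + \<omega> i) \<noteq> 0"
    and lim: "(\<lambda>n. birkhoff F (\<lambda>y. ln \<bar>\<psi>' y\<bar>) \<omega> n x / n) \<longlonglongrightarrow> m"
  shows "has_lyapunov_exponent (circle_map \<psi> L a) \<omega> x (ln L + m)"
proof -
  have eq: "ereal (1 / real n) * ext_ln \<bar>circle_deriv (random_iterate (circle_map \<psi> L a) \<omega> n) x\<bar> =
      ereal (ln L + birkhoff F (\<lambda>y. ln \<bar>\<psi>' y\<bar>) \<omega> n x / n)" if "0 < n" for n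
  proof -
    obtain k where k: "n = Suc k" using \<open>0 < n\<close> gr0_implies_Suc by blast
    define P where "P = (\<Prod>i<n. \<bar>L * \<psi>' (orbit F \<omega> i x + \<omega> i)\<bar>)"
    have pos: "0 < \<bar>L * \<psi>' (orbit F \<omega> i x + \<omega> i)\<bar>" for i using nz assms(1) by simp
    have "ln P = (\<Sum>i<n. ln \<bar>L * \<psi>' (orbit F \<omega> i x + \<omega> i)\<bar>)"
      unfolding P_def by (rule ln_prod) (use pos in auto)
    also have "\<dots> = (\<Sum>i<n. ln L + ln \<bar>\<psi>' (orbit F \<omega> i x + \<omega> i)\<bar>)"
      by (intro sum.cong refl) (use nz assms(1) in \<open>simp add: abs_mult ln_mult\<close>)
    also have "\<dots> = n * ln L + birkhoff F (\<lambda>y. ln \<bar>\<psi>' y\<bar>) \<omega> n x"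
      by (simp add: sum.distrib birkhoff_def)
    finally have "1 / real n * ln P = ln L + birkhoff F (\<lambda>y. ln \<bar>\<psi>' y\<bar>) \<omega> n x / n"
      using that by (simp add: field_simps)
    moreover have "\<bar>circle_deriv (random_iterate (circle_map \<psi> L a) \<omega> n) x\<bar> = P"
      unfolding k circle_deriv_random_iterate P_def by (rule abs_prod)
    moreover have "P \<noteq> 0" unfolding P_def using pos by (simp add: less_imp_neq[symmetric] nz assms(1))
    ultimately show ?thesis by (simp add: ext_ln_def)
  qed
  have "(\<lambda>n. ereal (ln L + birkhoff F (\<lambda>y. ln \<bar>\<psi>' y\<bar>) \<omega> n x / n)) \<longlonglongrightarrow> ereal (ln L + m)"
    by (intro tendsto_intros lim)
  then show ?thesis
    unfolding has_lyapunov_exponent_def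
    by (rule tendsto_cong[THEN iffD1, rotated])
       (use eventually_gt_at_top[of 0] in \<open>eventually_elim, simp add: eq\<close>)
qed

end

text \<open>Conditioning on the first step reduces time \<open>n + 1\<close> to time \<open>n\<close>, uniformly in the starting point.\<close>

lemma orbit_avoids_null_set:
  fixes F :: "real \<Rightarrow> real" and M :: "real measure"
  assumes "sequence_space M" and sets_M: "sets M = sets borel" and F[measurable]: "F \<in> borel_measurable borel"
    and Z[measurable]: "Z \<in> sets borel" and null: "\<And>x. AE s in M. x + s \<notin> Z"
  shows "AE \<omega> in PiM UNIV (\<lambda>_::nat. M). \<forall>i. orbit F \<omega> i x + \<omega> i \<notin> Z"
proof -
  interpret sequence_space M by fact
  have coord[measurable]: "(\<lambda>\<omega>. \<omega> i) \<in> borel_measurable S" for i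
    using measurable_component_singleton[of i UNIV "\<lambda>_. M"] by (simp add: measurable_cong_sets[OF refl sets_M])
  have [measurable]: "(\<lambda>\<omega>. orbit F \<omega> n x + \<omega> n) \<in> borel_measurable S" for n x
    by (intro borel_measurable_add coord measurable_orbit[OF F coord]) simp
  have zero: "(\<integral>\<^sup>+\<omega>. indicator Z (orbit F \<omega> n x + \<omega> n) \<partial>S) = 0" for n x
  proof (induction n arbitrary: x)
    case 0
    have "(\<integral>\<^sup>+\<omega>. indicator Z (orbit F \<omega> 0 x + \<omega> 0) \<partial>S) = (\<integral>\<^sup>+s. indicator Z (x + s) \<partial>M)"
      by (subst nn_integral_first_step) (simp_all add: P.emeasure_space_1)
    also have "\<dots> = (\<integral>\<^sup>+s. 0 \<partial>M)"
      by (rule nn_integral_cong_AE) (use null[of x] in \<open>eventually_elim, simp\<close>)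
    finally show ?case by simp
  next
    case (Suc n)
    have "(\<integral>\<^sup>+\<omega>. indicator Z (orbit F \<omega> (Suc n) x + \<omega> (Suc n)) \<partial>S) =
        (\<integral>\<^sup>+s. \<integral>\<^sup>+\<omega>. indicator Z (orbit F \<omega> n (F (x + s)) + \<omega> n) \<partial>S \<partial>M)"
      by (subst nn_integral_first_step) (simp_all only: orbit_case_nat nat.case, measurable)
    then show ?case by (simp add: Suc)
  qed
  have "AE \<omega> in S. orbit F \<omega> i x + \<omega> i \<notin> Z" for i
  proof -
    have "AE \<omega> in S. indicator Z (orbit F \<omega> i x + \<omega> i) = (0::ennreal)"
      using zero[of i x] by (subst (asm) nn_integral_0_iff_AE) auto
    then show ?thesis by eventually_elim (simp add: indicator_eq_0_iff)
  qed
  then show ?thesis by (simp add: AE_all_countable)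
qed

section \<open>The lower bound for the Lyapunov exponent\<close>

context noisy_morse_map
begin

lemma deviation_sum: "\<bar>\<Sum>i<n. window \<epsilon> (V i) x - m\<bar> \<le> 2 * (E / (2 * \<epsilon>) + E)"
  if m: "\<And>l. \<bar>avg l - m\<bar> \<le> E / 2 ^ l"
proof -
  define b where "b = E / (2 * \<epsilon>) + E"
  have b: "0 \<le> b" using E_nonneg \<epsilon> by (simp add: b_def)
  have "\<bar>window \<epsilon> (V i) x - m\<bar> \<le> b / 2 ^ i" for i
  proof -
    have "\<bar>window \<epsilon> (V i) x - m\<bar> \<le> E / 2 ^ i / (2 * \<epsilon>) + E / 2 ^ i"
      using window_V_near_avg[of i x] m[of i] by linarith
    also have "\<dots> = b / 2 ^ i" by (simp add: b_def add_divide_distrib)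
    finally show ?thesis .
  qed
  then have "\<bar>\<Sum>i<n. window \<epsilon> (V i) x - m\<bar> \<le> (\<Sum>i<n. b / 2 ^ i)"
    by (intro order_trans[OF sum_abs] sum_mono)
  also have "(\<Sum>i<n. b / 2 ^ i) = 2 * b - 2 * b / 2 ^ n"
    by (induction n) (simp_all add: field_simps)
  also have "\<dots> \<le> 2 * b" using b by simp
  finally show ?thesis by (simp add: b_def)
qed

text \<open>The expected value of \<open>ln |\<psi>'(Y\<^sub>n)|\<close> from the starting point \<open>x\<close> is \<open>window \<epsilon> (V n) x\<close>, so the deviations from \<open>m\<close> are
summable and the strong law applies. The bound for \<open>m\<close> is the sum of all changes of the means \<open>avg n\<close>.\<close>

theorem birkhoff_average:
  assumes B: "B = antider (\<lambda>y. ln \<bar>\<psi>' y\<bar>)"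
    and sq: "\<And>a b. set_integrable lborel {a..b} (\<lambda>y. (ln \<bar>\<psi>' y\<bar>)\<^sup>2)"
  obtains m where "\<bar>m - (B 1 - B 0)\<bar> \<le> E"
    and "\<And>x. AE \<omega> in noise \<epsilon>. (\<lambda>n. birkhoff F (\<lambda>y. ln \<bar>\<psi>' y\<bar>) \<omega> n x / n) \<longlonglongrightarrow> m"
proof -
  obtain m where m: "\<And>l. \<bar>avg l - m\<bar> \<le> E / 2 ^ l" by (rule avg_convergent) blast
  define g where "g y = ln \<bar>\<psi>' y\<bar>" for y
  define h where "h y = g y - m" for y
  have F_meas: "F \<in> borel_measurable borel" by (rule borel_measurable_continuous_onI[OF continuous_F])
  have \<psi>'_cont: "continuous_on UNIV \<psi>'" by (rule DERIV_continuous_on[OF deriv2])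
  have g_meas[measurable]: "g \<in> borel_measurable borel"
    unfolding g_def using borel_measurable_continuous_onI[OF \<psi>'_cont] by measurable
  have h_meas[measurable]: "h \<in> borel_measurable borel" unfolding h_def by measurable
  have g_int: "set_integrable lborel {a..b} g" for a b
    by (rule set_integrable_of_square[OF _ g_meas]) (use sq in \<open>simp add: g_def\<close>)
  have h_sq: "set_integrable lborel {a..b} (\<lambda>y. (h y)\<^sup>2)" for a b
  proof -
    have "set_integrable lborel {a..b} (\<lambda>y. (g y)\<^sup>2)" using sq by (simp add: g_def)
    moreover have "set_integrable lborel {a..b} (\<lambda>y. - 2 * m * g y)"
      by (rule set_integrable_mult_right[OF g_int])
    moreover have "set_integrable lborel {a..b} (\<lambda>y. m\<^sup>2)"
      by (rule borel_integrable_atLeastAtMost') simp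
    ultimately have "set_integrable lborel {a..b} (\<lambda>y. (g y)\<^sup>2 + (- 2 * m * g y + m\<^sup>2))"
      by (intro set_integral_add(1))
    then show ?thesis by (simp add: h_def power2_diff algebra_simps)
  qed
  have h_sq_HK: "(\<lambda>y. (h y)\<^sup>2) integrable_on {a..b}" for a b
    by (rule set_borel_integral_eq_integral(1)[OF h_sq])
  have g_per: "g (y + 1) = g y" for y
    using deriv_periodic[OF deriv1 periodic] by (simp add: g_def)
  let ?H = "antider (\<lambda>y. (h y)\<^sup>2)"
  have H_cont: "continuous_on UNIV ?H" by (rule continuous_antider[OF h_sq_HK])
  have H_shift: "?H (x + 1) = ?H x + ?H 1" for x
    by (rule antider_shift[OF h_sq_HK]) (simp add: h_def g_per)
  obtain C\<^sub>2 where C\<^sub>2: "1 \<le> C\<^sub>2" "\<And>x. \<bar>window \<epsilon> ?H x\<bar> \<le> C\<^sub>2"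
  proof (rule periodic_bounded)
    show "continuous_on UNIV (window \<epsilon> ?H)"
      unfolding window_def
      by (intro continuous_intros continuous_on_compose2[OF H_cont]) (use \<epsilon> in auto)
    show "window \<epsilon> ?H (x + 1) = window \<epsilon> ?H x" for x
      using H_shift[of "x + \<epsilon>"] H_shift[of "x - \<epsilon>"] by (simp add: window_def algebra_simps)
  qed blast
  have wF_cont: "continuous_on UNIV (\<lambda>y. window \<epsilon> (V n) (F y))" for n
    by (rule continuous_window[OF continuous_V])
  have wF_int: "set_integrable lborel {a..b} (\<lambda>y. window \<epsilon> (V n) (F y))" for a b n
    by (rule borel_integrable_atLeastAtMost'[OF continuous_on_subset[OF wF_cont]]) simp
  have wF_meas: "(\<lambda>y. window \<epsilon> (V n) (F y)) \<in> borel_measurable borel" for n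
    by (rule borel_measurable_continuous_onI[OF wF_cont])
  interpret U: prob_space "unif \<epsilon>" by (rule prob_space_unif[OF \<epsilon>])
  have U_UNIV: "U.prob UNIV = 1" using U.prob_space by simp
  have V_0: "V 0 = antider g" unfolding V.simps(1) g_def[abs_def] by (rule B)
  have seq: "sequence_space (unif \<epsilon>)"
    unfolding sequence_space_def by (rule product_prob_spaceI) (rule U.prob_space_axioms)
  interpret obs: noisy_observable "unif \<epsilon>" F h "\<lambda>n x. window \<epsilon> (V n) x - m" "2 * (E / (2 * \<epsilon>) + E)" C\<^sub>2
  proof (intro noisy_observable.intro seq noisy_observable_axioms.intro F_meas h_meas)
    show "(\<integral>\<^sup>+s. ennreal ((h (x + s))\<^sup>2) \<partial>unif \<epsilon>) \<le> ennreal C\<^sub>2" for x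
    proof -
      have "(\<integral>\<^sup>+s. ennreal ((h (x + s))\<^sup>2) \<partial>unif \<epsilon>) = ennreal (\<integral>s. (h (x + s))\<^sup>2 \<partial>unif \<epsilon>)"
        by (rule nn_integral_eq_integral[OF integral_unif(1)[OF \<epsilon> _ h_sq]]) auto
      also have "(\<integral>s. (h (x + s))\<^sup>2 \<partial>unif \<epsilon>) = window \<epsilon> ?H x"
        by (rule integral_unif(2)[OF \<epsilon> _ h_sq]) auto
      also have "ennreal (window \<epsilon> ?H x) \<le> ennreal C\<^sub>2"
        using C\<^sub>2(2)[of x] by (intro ennreal_leI) auto
      finally show ?thesis .
    qed
    show "window \<epsilon> (V 0) x - m = (\<integral>s. h (x + s) \<partial>unif \<epsilon>)" for x
      using integral_unif[OF \<epsilon> g_meas g_int, of x] by (simp only: V_0) (simp add: h_def U_UNIV)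
    show "window \<epsilon> (V (Suc n)) x - m = (\<integral>s. window \<epsilon> (V n) (F (x + s)) - m \<partial>unif \<epsilon>)" for n x
      using integral_unif[OF \<epsilon> wF_meas wF_int, of n x] by (simp add: U_UNIV V.simps(2))
    show "integrable (unif \<epsilon>) (\<lambda>s. window \<epsilon> (V n) (F (x + s)) - m)" for n x
      using integral_unif(1)[OF \<epsilon> wF_meas wF_int, of n x] by simp
    show "\<bar>\<Sum>i<n. window \<epsilon> (V i) x - m\<bar> \<le> 2 * (E / (2 * \<epsilon>) + E)" for n x
      by (rule deviation_sum[OF m])
  qed (use C\<^sub>2(1) in auto)
  have upper: "h y \<le> ln M - m" for y
    using M(1) M(2)[of y] by (cases "\<psi>' y = 0") (auto simp: h_def g_def)
  have "AE \<omega> in noise \<epsilon>. (\<lambda>n. birkhoff F g \<omega> n x / n) \<longlonglongrightarrow> m" for x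
    using obs.strong_law[OF upper, of x] unfolding noise_def
  proof eventually_elim
    case (elim \<omega>)
    then have "(\<lambda>n. birkhoff F h \<omega> n x / n + m) \<longlonglongrightarrow> 0 + m" by (intro tendsto_intros)
    moreover have "\<forall>\<^sub>F n in sequentially. birkhoff F h \<omega> n x / n + m = birkhoff F g \<omega> n x / n"
      using eventually_gt_at_top[of 0]
      by eventually_elim (simp add: birkhoff_def h_def sum_subtractf diff_divide_distrib)
    ultimately show ?case by (simp add: tendsto_cong)
  qed
  moreover have "\<bar>m - (B 1 - B 0)\<bar> \<le> E" using m[of 0] by (simp add: avg_def abs_minus_commute)
  ultimately show ?thesis using that by (simp add: g_def[abs_def])
qed

end

text \<open>If the noise is too strong to follow the critical orbits for \<open>k\<close> steps, they are followed for the largest number \<open>j\<close> of steps that it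
permits. Then \<open>\<epsilon>\<close> is at least of order \<open>(L M)\<^sup>-\<^sup>j\<close>, which is far above what time \<open>j\<close> requires. If \<open>j = k\<close>, the assumed lower bound on
\<open>\<epsilon>\<close> is used. In both cases strong noise counts as noise of size 1.\<close>

lemma shadowing_time:
  fixes L M \<epsilon> c \<alpha> \<beta> :: real and k :: nat
  assumes \<beta>: "0 < \<beta>" "\<beta> < 1" and M: "1 \<le> M" and c: "0 < c" "c < 1" and L: "1 \<le> L"
    and \<epsilon>: "0 < \<epsilon>" and \<alpha>: "0 \<le> \<alpha>" and large: "L powr \<beta> \<le> c / 8 * L"
    and noise: "L powr (- (2 * real k + 1) * (1 - \<beta>) + \<alpha>) \<le> \<epsilon>"
  obtains j where "j \<le> k" "j = 0 \<or> 2 * \<epsilon> * (L * M) ^ (j - 1) \<le> c / 4"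
    "(L powr (\<beta> / 2)) ^ (j + 1) \<le> sqrt (L * M) ^ (2 * j + 1) * sqrt (min \<epsilon> 1)"
proof -
  have LM: "L \<le> L * M" "1 \<le> L * M" using L M mult_mono[of 1 L 1 M] mult_left_mono[of 1 M L] by auto
  have "\<exists>j\<le>k. (j = 0 \<or> 2 * \<epsilon> * (L * M) ^ (j - 1) \<le> c / 4) \<and> (j = k \<or> c / 4 < 2 * \<epsilon> * (L * M) ^ j)"
  proof (induction k)
    case (Suc k)
    then obtain j where j: "j \<le> k" "j = 0 \<or> 2 * \<epsilon> * (L * M) ^ (j - 1) \<le> c / 4"
        "j = k \<or> c / 4 < 2 * \<epsilon> * (L * M) ^ j" by blast
    show ?case
    proof (cases "c / 4 < 2 * \<epsilon> * (L * M) ^ j")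
      case True
      then show ?thesis using j by (intro exI[of _ j]) auto
    next
      case False
      then show ?thesis using j by (intro exI[of _ "Suc k"]) auto
    qed
  qed auto
  then obtain j where j: "j \<le> k" "j = 0 \<or> 2 * \<epsilon> * (L * M) ^ (j - 1) \<le> c / 4"
    "j = k \<or> c / 4 < 2 * \<epsilon> * (L * M) ^ j" by blast
  have pw: "L powr (real i) = L ^ i" for i using L by (simp add: powr_realpow)
  have "(L powr \<beta>) ^ (j + 1) \<le> (L * M) ^ (2 * j + 1) * min \<epsilon> 1"
  proof -
    have "(L powr \<beta>) ^ (j + 1) = L powr (real (j + 1) * \<beta>)" by (rule powr_power) (use L in simp)
    also have "real (j + 1) * \<beta> = \<beta> * (j + 1)" by simp
    finally have base: "(L powr \<beta>) ^ (j + 1) = L powr (\<beta> * (j + 1))" .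
    \<comment> \<open>Strong noise; the assumed bound at time \<open>k\<close>; or noise that ends shadowing at time \<open>j\<close>.\<close>
    consider "1 \<le> \<epsilon>" | "\<epsilon> < 1" "j = k" | "\<epsilon> < 1" "c / 4 < 2 * \<epsilon> * (L * M) ^ j" using j by linarith
    then show ?thesis
    proof cases
      case 1
      have "L powr (\<beta> * (j + 1)) \<le> L powr (real (2 * j + 1))"
      proof (rule powr_mono)
        have "\<beta> * (real j + 1) \<le> 1 * (real j + 1)" using \<beta> by (intro mult_right_mono) auto
        also have "\<dots> \<le> real (2 * j + 1)" by simp
        finally show "\<beta> * (j + 1) \<le> real (2 * j + 1)" by (simp add: add.commute)
      qed (rule L)
      also have "\<dots> \<le> (L * M) ^ (2 * j + 1)" unfolding pw using LM L by (intro power_mono) auto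
      finally show ?thesis using 1 base by simp
    next
      case 2
      have "\<beta> * (j + 1) \<le> real (2 * k + 1) + (- (2 * real k + 1) * (1 - \<beta>) + \<alpha>)"
        using 2 \<alpha> \<beta> by (simp add: algebra_simps)
      then have "L powr (\<beta> * (j + 1)) \<le> L powr (real (2 * k + 1) + (- (2 * real k + 1) * (1 - \<beta>) + \<alpha>))"
        using L by (intro powr_mono) auto
      also have "\<dots> = L ^ (2 * k + 1) * L powr (- (2 * real k + 1) * (1 - \<beta>) + \<alpha>)"
        unfolding powr_add pw ..
      also have "\<dots> \<le> (L * M) ^ (2 * k + 1) * \<epsilon>"
        using LM L noise by (intro mult_mono power_mono) auto
      finally show ?thesis using 2 base by simp
    next
      case 3
      have "(L powr \<beta>) ^ (j + 1) \<le> (c / 8 * L) ^ (j + 1)" using large by (intro power_mono) auto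
      also have "\<dots> = (c / 8) ^ (j + 1) * L ^ (j + 1)" by (rule power_mult_distrib)
      also have "\<dots> \<le> (c / 8) * (L * M) ^ (j + 1)"
        using c LM L power_decreasing[of 1 "j + 1" "c / 8"] by (intro mult_mono power_mono) auto
      also have "\<dots> \<le> (\<epsilon> * (L * M) ^ j) * (L * M) ^ (j + 1)"
        using 3 LM by (intro mult_right_mono) auto
      also have "\<dots> = (L * M) ^ (2 * j + 1) * \<epsilon>" by (simp add: power_add mult_2)
      finally show ?thesis using 3 by simp
    qed
  qed
  then have "sqrt ((L powr \<beta>) ^ (j + 1)) \<le> sqrt ((L * M) ^ (2 * j + 1) * min \<epsilon> 1)"
    by (rule real_sqrt_le_mono)
  moreover have "sqrt ((L powr \<beta>) ^ (j + 1)) = (L powr (\<beta> / 2)) ^ (j + 1)"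
  proof -
    have "sqrt (L powr \<beta>) = L powr (\<beta> / 2)" using L by (simp add: powr_half_sqrt[symmetric] powr_powr)
    then show ?thesis by (simp only: real_sqrt_power)
  qed
  moreover have "sqrt ((L * M) ^ (2 * j + 1) * min \<epsilon> 1) = sqrt (L * M) ^ (2 * j + 1) * sqrt (min \<epsilon> 1)"
    by (simp only: real_sqrt_mult real_sqrt_power)
  ultimately have "(L powr (\<beta> / 2)) ^ (j + 1) \<le> sqrt (L * M) ^ (2 * j + 1) * sqrt (min \<epsilon> 1)"
    by (simp only:)
  then show ?thesis by (rule that[OF j(1,2)])
qed

theorem theorem2:
  fixes \<psi> :: "real \<Rightarrow> real" and \<beta> c :: real
  assumes "C2_on_circle \<psi>"
    and "finite (crit_set \<psi>)"
    and "\<forall>x\<in>crit_set \<psi>. deriv (deriv \<psi>) x \<noteq> 0"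
    and "0 < \<beta>" "\<beta> < 1" and "0 < c" "c < 1"
  shows "\<exists>L0>0. \<forall>L\<ge>L0. \<forall>a\<in>{0..<1}. \<forall>k::nat.
    (\<forall>x\<in>crit_set \<psi>. \<forall>l\<in>{1..k}.
        circle_setdist ((circle_map \<psi> L a ^^ l) x) (crit_set \<psi>) \<ge> c) \<longrightarrow>
    (\<forall>\<alpha>\<ge>0. \<forall>\<epsilon>>0. \<epsilon> \<ge> L powr (- (2 * real k + 1) * (1 - \<beta>) + \<alpha>) \<longrightarrow>
      (\<exists>l::real.
        (\<forall>x\<in>S1. AE \<omega> in noise \<epsilon>. has_lyapunov_exponent (circle_map \<psi> L a) \<omega> x l) \<and>
        l \<ge> min (\<alpha> / (real k + 1)) (1 / 10) * ln L))"
proof -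
  let ?g = "deriv \<psi>" and ?B = "antider (\<lambda>y. ln \<bar>deriv \<psi> y\<bar>)"
  obtain D c\<^sub>0 c\<^sub>1 M E where mf: "morse_function \<psi> ?g (deriv ?g) ?B c D c\<^sub>0 c\<^sub>1 M E"
    and sq: "\<And>a b. set_integrable lborel {a..b} (\<lambda>y. (ln \<bar>?g y\<bar>)\<^sup>2)"
    by (rule morse_function_exists[OF assms(1-3) assms(6,7)]) blast
  interpret morse_function \<psi> ?g "deriv ?g" ?B c D c\<^sub>0 c\<^sub>1 M E by (rule mf)
  have g_per: "?g (x + 1) = ?g x" for x by (rule deriv_periodic[OF deriv1 periodic])
  define K where "K = Max {1, 6 * M / (c\<^sub>0 * sqrt c), 3 * M / c\<^sub>0, (1 / c\<^sub>1 + M / c\<^sub>1\<^sup>2) * M}"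
  have K: "1 \<le> K" "6 * M / (c\<^sub>0 * sqrt c) \<le> K" "3 * M / c\<^sub>0 \<le> K" "(1 / c\<^sub>1 + M / c\<^sub>1\<^sup>2) * M \<le> K"
    by (simp_all add: K_def)
  obtain n\<^sub>0 :: nat where n\<^sub>0: "2 / D \<le> n\<^sub>0" using real_arch_simple by blast
  define N where "N = Suc n\<^sub>0"
  have N: "1 \<le> N" "2 \<le> real N * D"
  proof -
    have "2 \<le> n\<^sub>0 * D" using n\<^sub>0 D(1) by (simp add: pos_divide_le_eq)
    then show "2 \<le> real N * D" using D(1) by (simp add: N_def distrib_right)
  qed (simp add: N_def)
  define b where "b = ?B 1 - ?B 0"
  \<comment> \<open>In this order: the basic scale, \<open>rad 1 \<le> D\<close>, the gain for each step, \<open>shadowing_time\<close>, and the final bound.\<close>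
  have "\<forall>\<^sub>F L in at_top. 1 \<le> L \<and> 1 / D\<^sup>2 \<le> L \<and> 40 * N * K \<le> L powr (\<beta> / 2) \<and>
      L powr \<beta> \<le> c / 8 * L \<and> ln L / 10 \<le> ln L + (b - E)"
  proof (intro eventually_conj eventually_ge_at_top)
    show "\<forall>\<^sub>F L in at_top. 40 * N * K \<le> L powr (\<beta> / 2)"
      using assms(4) by real_asymp
    show "\<forall>\<^sub>F L in at_top. L powr \<beta> \<le> c / 8 * L"
      using assms(4-6) by real_asymp
    show "\<forall>\<^sub>F L in at_top. ln L / 10 \<le> ln L + (b - E)"
      by real_asymp
  qed
  then obtain L\<^sub>1 where L\<^sub>1: "\<And>L. L\<^sub>1 \<le> L \<Longrightarrow> 1 \<le> L \<and> 1 / D\<^sup>2 \<le> L \<and> 40 * N * K \<le> L powr (\<beta> / 2) \<and>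
      L powr \<beta> \<le> c / 8 * L \<and> ln L / 10 \<le> ln L + (b - E)"
    by (auto simp: eventually_at_top_linorder)
  show ?thesis
  proof (rule exI[of _ "max 1 L\<^sub>1"], intro conjI allI ballI impI)
    fix L a :: real and k :: nat and \<alpha> \<epsilon> :: real
    assume "max 1 L\<^sub>1 \<le> L"
      and crit: "\<forall>x\<in>crit_set \<psi>. \<forall>l\<in>{1..k}.
        c \<le> circle_setdist ((circle_map \<psi> L a ^^ l) x) (crit_set \<psi>)"
      and \<alpha>: "0 \<le> \<alpha>" and \<epsilon>: "0 < \<epsilon>" "L powr (- (2 * real k + 1) * (1 - \<beta>) + \<alpha>) \<le> \<epsilon>"
    then have LL: "1 \<le> L" "1 / D\<^sup>2 \<le> L" "40 * N * K \<le> L powr (\<beta> / 2)" "L powr \<beta> \<le> c / 8 * L"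
        "ln L / 10 \<le> ln L + (b - E)"
      using L\<^sub>1[of L] by auto
    have LM: "L \<le> L * M" using LL(1) M(1) mult_left_mono[of 1 M L] by simp
    obtain j where j: "j \<le> k" "j = 0 \<or> 2 * \<epsilon> * (L * M) ^ (j - 1) \<le> c / 4"
      "(L powr (\<beta> / 2)) ^ (j + 1) \<le> sqrt (L * M) ^ (2 * j + 1) * sqrt (min \<epsilon> 1)"
      by (rule shadowing_time[OF assms(4,5) M(1) assms(6,7) LL(1) \<epsilon>(1) \<alpha> LL(4) \<epsilon>(2)])
    interpret noisy_morse_map \<psi> ?g "deriv ?g" ?B c D c\<^sub>0 c\<^sub>1 M E L a \<epsilon> "L powr (\<beta> / 2)" K j N
    proof unfold_locales
      fix p p' i assume p: "?g p = 0" "?g p' = 0" and i: "1 \<le> i" "i \<le> j"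
      have mem: "frac x \<in> crit_set \<psi>" if "?g x = 0" for x
        using that periodic_frac[of ?g x, OF g_per] frac_lt_1[of x] by (simp add: crit_set_def S1_def)
      have "c \<le> circle_setdist ((circle_map \<psi> L a ^^ i) (frac p)) (crit_set \<psi>)"
        using crit mem[OF p(1)] i j(1) by auto
      also have "(circle_map \<psi> L a ^^ i) (frac p) = frac (((\<lambda>y. L * \<psi> y + a) ^^ i) p)"
        by (rule frac_circle_map_iterate[OF periodic deriv1 refl i(1)])
      also have "circle_setdist \<dots> (crit_set \<psi>) \<le> \<bar>((\<lambda>y. L * \<psi> y + a) ^^ i) p - p'\<bar>"
        by (rule circle_setdist_frac_le[OF mem[OF p(2)]])
      finally show "c \<le> \<bar>((\<lambda>y. L * \<psi> y + a) ^^ i) p - p'\<bar>" .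
    next
      have "L powr (\<beta> / 2) \<le> L powr (1 / 2)" using assms(5) LL(1) by (intro powr_mono) auto
      also have "\<dots> = sqrt L" using LL(1) by (simp add: powr_half_sqrt)
      also have "\<dots> \<le> sqrt (L * M)" using LM by simp
      finally show "L powr (\<beta> / 2) \<le> sqrt (L * M)" .
      have "sqrt (1 / D\<^sup>2) \<le> sqrt (L * M)" using LL(2) LM by (intro real_sqrt_le_mono) simp
      then have "1 / D \<le> sqrt (L * M)" using D(1) by (simp add: real_sqrt_divide)
      then show "1 / sqrt (L * M) \<le> D" using D(1) LL(1) M(1) by (simp add: field_simps)
    qed (use LL \<epsilon>(1) j K N in auto)
    obtain m where m: "\<bar>m - b\<bar> \<le> E"
      and av: "\<And>x. AE \<omega> in noise \<epsilon>. (\<lambda>n. birkhoff F (\<lambda>y. ln \<bar>?g y\<bar>) \<omega> n x / n) \<longlonglongrightarrow> m"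
      by (rule birkhoff_average[OF refl sq, folded b_def]) (rule that)
    \<comment> \<open>Almost surely the orbit never meets the countable set of critical points, so no factor of the derivative vanishes.\<close>
    define Z where "Z = {y. ?g y = 0}"
    have "Z \<subseteq> (\<Union>i::int. (\<lambda>p. p + of_int i) ` crit_set \<psi>)"
    proof
      fix y assume "y \<in> Z"
      then have "frac y \<in> crit_set \<psi>"
        using periodic_frac[of ?g y, OF g_per] frac_lt_1[of y] by (simp add: Z_def crit_set_def S1_def)
      moreover have "y = frac y + of_int \<lfloor>y\<rfloor>" by (simp add: frac_def)
      ultimately show "y \<in> (\<Union>i::int. (\<lambda>p. p + of_int i) ` crit_set \<psi>)" by blast
    qed
    then have Z: "countable Z"
      by (rule countable_subset) (use assms(2) in \<open>auto intro: countable_finite\<close>)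
    have null: "AE s in unif \<epsilon>. x + s \<notin> Z" for x
    proof -
      have "countable ((\<lambda>z. z - x) ` Z)" using Z by simp
      then have "AE s in lborel. s \<notin> (\<lambda>z. z - x) ` Z"
        by (intro AE_not_in countable_imp_null_set_lborel)
      then have "AE s in lborel. s \<in> {-\<epsilon>..\<epsilon>} \<longrightarrow> x + s \<notin> Z"
        by eventually_elim (auto simp: image_iff)
      then show ?thesis by (intro AE_uniform_measureI) auto
    qed
    have "product_prob_space (\<lambda>_::nat. unif \<epsilon>)"
      by (rule product_prob_spaceI) (rule prob_space_unif[OF \<epsilon>(1)])
    then have "sequence_space (unif \<epsilon>)" by (simp add: sequence_space_def)
    then have avoid: "AE \<omega> in noise \<epsilon>. \<forall>i. orbit F \<omega> i x + \<omega> i \<notin> Z" for x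
      unfolding noise_def
    proof (rule orbit_avoids_null_set[OF _ _ _ _ null])
      show "Z \<in> sets borel" using Z by (rule sets.countable[rotated]) auto
    qed (auto intro: borel_measurable_continuous_onI[OF continuous_F])
    show "\<exists>l. (\<forall>x\<in>S1. AE \<omega> in noise \<epsilon>. has_lyapunov_exponent (circle_map \<psi> L a) \<omega> x l) \<and>
        min (\<alpha> / (real k + 1)) (1 / 10) * ln L \<le> l"
    proof (intro exI[of _ "ln L + m"] conjI ballI)
      fix x
      show "AE \<omega> in noise \<epsilon>. has_lyapunov_exponent (circle_map \<psi> L a) \<omega> x (ln L + m)"
        using av[of x] avoid[of x]
      proof eventually_elim
        case (elim \<omega>)
        then show ?case
          using LL(1) by (intro has_lyapunov_exponent_of_average[OF periodic deriv1 F_def]) (auto simp: Z_def)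
      qed
    next
      have "min (\<alpha> / (real k + 1)) (1 / 10) * ln L \<le> 1 / 10 * ln L"
        using LL(1) by (intro mult_right_mono min.cobounded2) simp
      then show "min (\<alpha> / (real k + 1)) (1 / 10) * ln L \<le> ln L + m" using LL(5) m by linarith
    qed
  qed simp
qed

end
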